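(* Let $k$ be a field and let $A$ be an affine $k$-algebra that admits Hilbert-Samuel polynomials. Then $A$ is very nice.
   Context: Affine algebra: a finitely generated associative unital (not necessarily commutative) $k$-algebra. Modules are left modules; $A\text{-}\mathsf{mod}$ is the category of finitely generated $A$-modules. $\mathbb{N}$ contains $0$. Gelfand-Kirillov dimension: for $A$ affine, $V\subset A$ a finite-dimensional generating subspace with $1\in V$, and $M$ a module generated by a finite-dimensional subspace $F$, $\mathrm{GK}(M)=\limsup_{n\to\infty}\log_n \dim_k(V^nF)$ (independent of $V,F$); $\mathrm{GK}(A)=\limsup_{n\to\infty}\log_n\dim_k V^n$. Convention: $\mathrm{GK}(0)=-\infty$. Filtration on $A$: an increasing chain of subspaces $\mathcal{F}=\{F_i\}_{i\ge 0}$ with $1\in F_0$, $F_iF_j\subset F_{i+j}$, $A=\bigcup_i F_i$. The associated graded algebra is $\mathrm{gr}_{\mathcal F}A=\bigoplus_{i\ge0}F_i/F_{i-1}$ ($F_{-1}=0$). A filtration on an $A$-module $M$ is an increasing chain of subspaces $\Omega=\{M_i\}_{i\ge0}$ with $F_iM_j\subset M_{i+j}$, $M=\bigcup_iM_i$; $\mathrm{gr}_\Omega M=\bigoplus_i M_i/M_{i-1}$ ($M_{-1}=0$) is a $\mathrm{gr}_{\mathcal F}A$-module. A filtration is finite-dimensional if all its terms are finite-dimensional. $\Omega$ is good if $\mathrm{gr}_\Omega M$ is a finitely generated $\mathrm{gr}_{\mathcal F}A$-module. $A$ admits Hilbert-Samuel polynomials if it has a finite-dimensional filtration $\mathcal F$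 such that $\mathrm{gr}_{\mathcal F}A$ is affine and Noetherian, and for every $M\in A\text{-}\mathsf{mod}$ and every finite-dimensional good filtration $\Omega=\{M_i\}_{i\ge0}$ on $M$ there is a polynomial $H_{M,\Omega}$ with rational coefficients such that $H_{M,\Omega}(n)=\dim_k M_n$ for all sufficiently large $n$. An affine algebra $A$ is very nice if: (i) $\mathrm{GK}$ is exact on $A\text{-}\mathsf{mod}$, i.e. $\mathrm{GK}(M)=\max\{\mathrm{GK}(M'),\mathrm{GK}(M'')\}$ for every short exact sequence $0\to M'\to M\to M''\to0$ of finitely generated $A$-modules; (ii) $\mathrm{GK}(M)$ is a non-negative integer for every nonzero finitely generated $A$-module $M$; (iii) there is a function $e:A\text{-}\mathsf{mod}\to\mathbb{N}$ (multiplicity) such that for every short exact sequence $0\to M'\to M\to M''\to 0$ of finitely generated $A$-modules: (a) if $\mathrm{GK}(M')<\mathrm{GK}(M)=\mathrm{GK}(M'')$ then $e(M)=e(M'')$; (b) if $\mathrm{GK}(M')=\mathrm{GK}(M)>\mathrm{GK}(M'')$ then $e(M)=e(M')$; (c) if $\mathrm{GK}(M')=\mathrm{GK}(M)=\mathrm{GK}(M'')$ then $e(M)=e(M')+e(M'')$; and (d) $e(M)=0$ if and only if $M=0$. *)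

theory Defs
  imports
    "HOL-Library.Extended_Real"
    "HOL-Computational_Algebra.Polynomial"
    "HOL-Algebra.Subrings"
    "HOL-Algebra.AbelCoset"
    "Jordan_Normal_Form.Missing_VectorSpace"
begin

section \<open>Affine algebras and their modules\<close>

text \<open>The locales \<open>algebra\<close> and \<open>module\<close> of HOL-Algebra demand a commutative algebra and a
  commutative ring of scalars, respectively.  They are repeated here without commutativity.\<close>

locale assoc_algebra = vectorspace K A + A?: ring A for K (structure) and A (structure) +
  assumes smult_mult_left:
      "\<lbrakk>c \<in> carrier K; x \<in> carrier A; y \<in> carrier A\<rbrakk> \<Longrightarrow>
        (c \<odot>\<^bsub>A\<^esub> x) \<otimes>\<^bsub>A\<^esub> y = c \<odot>\<^bsub>A\<^esub> (x \<otimes>\<^bsub>A\<^esub> y)"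
    and smult_mult_right:
      "\<lbrakk>c \<in> carrier K; x \<in> carrier A; y \<in> carrier A\<rbrakk> \<Longrightarrow>
        x \<otimes>\<^bsub>A\<^esub> (c \<odot>\<^bsub>A\<^esub> y) = c \<odot>\<^bsub>A\<^esub> (x \<otimes>\<^bsub>A\<^esub> y)"

definition generated_subalgebra ::
    "'k ring \<Rightarrow> ('k, 'a) module \<Rightarrow> 'a set \<Rightarrow> 'a set" where
  "generated_subalgebra K A S = \<Inter>{B. VectorSpace.subspace K B A \<and> subring B A \<and> S \<subseteq> B}"

locale affine_algebra = assoc_algebra K A for K :: "'k ring" and A :: "('k, 'a) module" +
  assumes finitely_generated:
    "\<exists>S. finite S \<and> S \<subseteq> carrier A \<and> generated_subalgebra K A S = carrier A"

locale left_module = A?: ring A + M?: abelian_group M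
  for A :: "('a, 'r) ring_scheme" (structure) and M :: "('a, 'm) module" (structure) +
  assumes smult_closed:
      "\<lbrakk>a \<in> carrier A; x \<in> carrier M\<rbrakk> \<Longrightarrow> a \<odot>\<^bsub>M\<^esub> x \<in> carrier M"
    and smult_l_distr:
      "\<lbrakk>a \<in> carrier A; b \<in> carrier A; x \<in> carrier M\<rbrakk> \<Longrightarrow>
        (a \<oplus>\<^bsub>A\<^esub> b) \<odot>\<^bsub>M\<^esub> x = a \<odot>\<^bsub>M\<^esub> x \<oplus>\<^bsub>M\<^esub> b \<odot>\<^bsub>M\<^esub> x"
    and smult_r_distr:
      "\<lbrakk>a \<in> carrier A; x \<in> carrier M; y \<in> carrier M\<rbrakk> \<Longrightarrow>
        a \<odot>\<^bsub>M\<^esub> (x \<oplus>\<^bsub>M\<^esub> y) = a \<odot>\<^bsub>M\<^esub> x \<oplus>\<^bsub>M\<^esub> a \<odot>\<^bsub>M\<^esub> y"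
    and smult_assoc:
      "\<lbrakk>a \<in> carrier A; b \<in> carrier A; x \<in> carrier M\<rbrakk> \<Longrightarrow>
        (a \<otimes>\<^bsub>A\<^esub> b) \<odot>\<^bsub>M\<^esub> x = a \<odot>\<^bsub>M\<^esub> (b \<odot>\<^bsub>M\<^esub> x)"
    and smult_one:
      "x \<in> carrier M \<Longrightarrow> \<one>\<^bsub>A\<^esub> \<odot>\<^bsub>M\<^esub> x = x"

text \<open>\<open>Module.submodule\<close> is the HOL-Algebra notion, which makes sense over noncommutative rings
  (the AFP notion of the same name does not).\<close>

definition generated_submodule ::
    "('a, 'r) ring_scheme \<Rightarrow> ('a, 'm) module \<Rightarrow> 'm set \<Rightarrow> 'm set" where
  "generated_submodule A M S = \<Inter>{N. Module.submodule N A M \<and> S \<subseteq> N}"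

definition finitely_generated_over ::
    "('a, 'r) ring_scheme \<Rightarrow> ('a, 'm) module \<Rightarrow> bool" where
  "finitely_generated_over A M \<longleftrightarrow>
    (\<exists>S. finite S \<and> S \<subseteq> carrier M \<and> generated_submodule A M S = carrier M)"

definition fg_module :: "('a, 'r) ring_scheme \<Rightarrow> ('a, 'm) module \<Rightarrow> bool" where
  "fg_module A M \<longleftrightarrow> left_module A M \<and> finitely_generated_over A M"

definition regular_module :: "('a, 'r) ring_scheme \<Rightarrow> ('a, 'a) module" where
  "regular_module A = \<lparr>carrier = carrier A, mult = mult A, one = one A,
     zero = zero A, add = add A, smult = mult A\<rparr>"

text \<open>Modules are left modules, so Noetherian is read as left Noetherian.  As this occurs only in
  the hypothesis that an algebra admits Hilbert-Samuel polynomials, results for it include the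
  two-sided reading.\<close>

definition left_noetherian :: "('a, 'r) ring_scheme \<Rightarrow> bool" where
  "left_noetherian A \<longleftrightarrow>
    ring A \<and>
    (\<forall>I. Module.submodule I A (regular_module A) \<longrightarrow>
      (\<exists>S. finite S \<and> S \<subseteq> I \<and> generated_submodule A (regular_module A) S = I))"

text \<open>The vector space over \<open>K\<close> underlying an \<open>A\<close>-module.\<close>

definition restrict_scalars ::
    "('k, 'a) module \<Rightarrow> ('a, 'm) module \<Rightarrow> ('k, 'm) module" where
  "restrict_scalars A M = \<lparr>carrier = carrier M, mult = mult M, one = one M,
     zero = zero M, add = add M, smult = (\<lambda>c x. (c \<odot>\<^bsub>A\<^esub> \<one>\<^bsub>A\<^esub>) \<odot>\<^bsub>M\<^esub> x)\<rparr>"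

definition fin_dim_subspace :: "'k ring \<Rightarrow> 'v set \<Rightarrow> ('k, 'v) module \<Rightarrow> bool" where
  "fin_dim_subspace K W V \<longleftrightarrow>
    VectorSpace.subspace K W V \<and> vectorspace.fin_dim K (V\<lparr>carrier := W\<rparr>)"

definition dim_of :: "'k ring \<Rightarrow> ('k, 'v) module \<Rightarrow> 'v set \<Rightarrow> nat" where
  "dim_of K V W = vectorspace.dim K (V\<lparr>carrier := W\<rparr>)"

definition short_exact ::
    "('a, 'r) ring_scheme \<Rightarrow> ('a, 'm) module \<Rightarrow> ('a, 'm) module \<Rightarrow> ('a, 'm) module \<Rightarrow> bool" where
  "short_exact A M' M M'' \<longleftrightarrow>
    (\<exists>f \<in> module_hom A M' M. \<exists>g \<in> module_hom A M M''.
      inj_on f (carrier M') \<and>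
      f ` carrier M' = {x \<in> carrier M. g x = \<zero>\<^bsub>M''\<^esub>} \<and>
      g ` carrier M = carrier M'')"


section \<open>Gelfand-Kirillov dimension\<close>

primrec power_space ::
    "'k ring \<Rightarrow> ('k, 'a) module \<Rightarrow> 'a set \<Rightarrow> nat \<Rightarrow> 'a set" where
  "power_space K A V 0 = module.span K A {\<one>\<^bsub>A\<^esub>}"
| "power_space K A V (Suc n) =
    module.span K A {x \<otimes>\<^bsub>A\<^esub> y | x y. x \<in> power_space K A V n \<and> y \<in> V}"

definition product_space ::
    "'k ring \<Rightarrow> ('k, 'a) module \<Rightarrow> ('a, 'm) module \<Rightarrow> 'a set \<Rightarrow> 'm set \<Rightarrow> 'm set" where
  "product_space K A M W F =
    module.span K (restrict_scalars A M) {a \<odot>\<^bsub>M\<^esub> x | a x. a \<in> W \<and> x \<in> F}"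

text \<open>\<open>log_dim n d\<close> is \<open>log\<^sub>n d\<close> with \<open>log\<^sub>n 0 = -\<infinity>\<close> (in HOL, \<open>log n 0 = 0\<close>), so that the
  formula below gives the zero module the dimension \<open>-\<infinity>\<close>.\<close>

definition log_dim :: "nat \<Rightarrow> nat \<Rightarrow> ereal" where
  "log_dim n d = (if d = 0 then -\<infinity> else ereal (log (real n) (real d)))"

definition GK_generators ::
    "'k ring \<Rightarrow> ('k, 'a) module \<Rightarrow> ('a, 'm) module \<Rightarrow> 'a set \<Rightarrow> 'm set \<Rightarrow> bool" where
  "GK_generators K A M V F \<longleftrightarrow>
    fin_dim_subspace K V A \<and> \<one>\<^bsub>A\<^esub> \<in> V \<and> generated_subalgebra K A V = carrier A \<and>
    fin_dim_subspace K F (restrict_scalars A M) \<and> generated_submodule A M F = carrier M"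

text \<open>The value does not depend on the generating subspaces \<open>V\<close> and \<open>F\<close>, so an arbitrary
  choice is made.\<close>

definition GK :: "'k ring \<Rightarrow> ('k, 'a) module \<Rightarrow> ('a, 'm) module \<Rightarrow> ereal" where
  "GK K A M = (SOME d. \<exists>V F. GK_generators K A M V F \<and>
     d = limsup (\<lambda>n. log_dim n
           (dim_of K (restrict_scalars A M) (product_space K A M (power_space K A V n) F))))"


section \<open>Filtrations and associated graded objects\<close>

definition algebra_filtration ::
    "'k ring \<Rightarrow> ('k, 'a) module \<Rightarrow> (nat \<Rightarrow> 'a set) \<Rightarrow> bool" where
  "algebra_filtration K A F \<longleftrightarrow>
    (\<forall>i. VectorSpace.subspace K (F i) A) \<and> (\<forall>i. F i \<subseteq> F (Suc i)) \<and> \<one>\<^bsub>A\<^esub> \<in> F 0 \<and>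
    (\<forall>i j. \<forall>x \<in> F i. \<forall>y \<in> F j. x \<otimes>\<^bsub>A\<^esub> y \<in> F (i + j)) \<and>
    (\<Union>i. F i) = carrier A"

definition module_filtration ::
    "'k ring \<Rightarrow> ('k, 'a) module \<Rightarrow> (nat \<Rightarrow> 'a set) \<Rightarrow> ('a, 'm) module \<Rightarrow> (nat \<Rightarrow> 'm set) \<Rightarrow> bool"
  where
  "module_filtration K A F M \<Omega> \<longleftrightarrow>
    (\<forall>i. VectorSpace.subspace K (\<Omega> i) (restrict_scalars A M)) \<and> (\<forall>i. \<Omega> i \<subseteq> \<Omega> (Suc i)) \<and>
    (\<forall>i j. \<forall>a \<in> F i. \<forall>x \<in> \<Omega> j. a \<odot>\<^bsub>M\<^esub> x \<in> \<Omega> (i + j)) \<and>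
    (\<Union>i. \<Omega> i) = carrier M"

definition fin_dim_filtration :: "'k ring \<Rightarrow> ('k, 'v) module \<Rightarrow> (nat \<Rightarrow> 'v set) \<Rightarrow> bool" where
  "fin_dim_filtration K V F \<longleftrightarrow> (\<forall>i. fin_dim_subspace K (F i) V)"

text \<open>\<open>preceding G F n\<close> is \<open>F\<^sub>n\<^sub>-\<^sub>1\<close>, where \<open>F\<^sub>-\<^sub>1 = 0\<close>.\<close>

definition preceding :: "('v, 'r) ring_scheme \<Rightarrow> (nat \<Rightarrow> 'v set) \<Rightarrow> nat \<Rightarrow> 'v set" where
  "preceding G F n = (case n of 0 \<Rightarrow> {\<zero>\<^bsub>G\<^esub>} | Suc m \<Rightarrow> F m)"

text \<open>An element of the direct sum of the \<open>F\<^sub>n / F\<^sub>n\<^sub>-\<^sub>1\<close> is a function picking a coset of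
  \<open>F\<^sub>n\<^sub>-\<^sub>1\<close> in \<open>F\<^sub>n\<close> for every \<open>n\<close>, almost all of them zero.\<close>

definition gr_carrier :: "('v, 'r) ring_scheme \<Rightarrow> (nat \<Rightarrow> 'v set) \<Rightarrow> (nat \<Rightarrow> 'v set) set" where
  "gr_carrier G F =
    {f. (\<forall>n. \<exists>x \<in> F n. f n = preceding G F n +>\<^bsub>G\<^esub> x) \<and> finite {n. f n \<noteq> preceding G F n}}"

definition gr_add ::
    "('v, 'r) ring_scheme \<Rightarrow> (nat \<Rightarrow> 'v set) \<Rightarrow> (nat \<Rightarrow> 'v set) \<Rightarrow> nat \<Rightarrow> 'v set" where
  "gr_add G f g = (\<lambda>n. f n <+>\<^bsub>G\<^esub> g n)"

text \<open>The degree \<open>n\<close> component of a product \<open>f \<cdot> g\<close> is \<open>\<Sum>\<^sub>i\<^sub>\<le>\<^sub>n f\<^sub>i \<cdot> g\<^sub>n\<^sub>-\<^sub>i\<close>, computed on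
  representatives \<open>x\<^sub>i\<close> of \<open>f\<^sub>i\<close> and \<open>y\<^sub>j\<close> of \<open>g\<^sub>j\<close>.  All choices of representatives
  give the same coset; as in \<open>rcoset_mult\<close>, the result is written as the union over all of them.
  Here \<open>F\<close> is the filtration of the abelian group \<open>G\<close> in which the products lie.\<close>

definition gr_prod ::
    "('x \<Rightarrow> 'v \<Rightarrow> 'v) \<Rightarrow> ('v, 'r) ring_scheme \<Rightarrow> (nat \<Rightarrow> 'v set) \<Rightarrow>
      (nat \<Rightarrow> 'x set) \<Rightarrow> (nat \<Rightarrow> 'v set) \<Rightarrow> nat \<Rightarrow> 'v set" where
  "gr_prod m G F f g = (\<lambda>n. \<Union>x \<in> Pi UNIV f. \<Union>y \<in> Pi UNIV g.
     preceding G F n +>\<^bsub>G\<^esub> (\<Oplus>\<^bsub>G\<^esub>i \<in> {..n}. m (x i) (y (n - i))))"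

definition gr_algebra ::
    "('k, 'a) module \<Rightarrow> (nat \<Rightarrow> 'a set) \<Rightarrow> ('k, nat \<Rightarrow> 'a set) module" where
  "gr_algebra A F =
    \<lparr>carrier = gr_carrier A F,
     mult = gr_prod (mult A) A F,
     one = (\<lambda>n. preceding A F n +>\<^bsub>A\<^esub> (if n = 0 then \<one>\<^bsub>A\<^esub> else \<zero>\<^bsub>A\<^esub>)),
     zero = preceding A F,
     add = gr_add A,
     smult = (\<lambda>c f n. \<Union>x \<in> f n. preceding A F n +>\<^bsub>A\<^esub> (c \<odot>\<^bsub>A\<^esub> x))\<rparr>"

text \<open>The fields \<open>mult\<close> and \<open>one\<close> of the record play no role for a module.\<close>

definition gr_module ::
    "('a, 'm) module \<Rightarrow> (nat \<Rightarrow> 'm set) \<Rightarrow> (nat \<Rightarrow> 'a set, nat \<Rightarrow> 'm set) module" where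
  "gr_module M \<Omega> =
    \<lparr>carrier = gr_carrier M \<Omega>,
     mult = undefined,
     one = undefined,
     zero = preceding M \<Omega>,
     add = gr_add M,
     smult = gr_prod (smult M) M \<Omega>\<rparr>"

definition good_filtration ::
    "'k ring \<Rightarrow> ('k, 'a) module \<Rightarrow> (nat \<Rightarrow> 'a set) \<Rightarrow> ('a, 'm) module \<Rightarrow> (nat \<Rightarrow> 'm set) \<Rightarrow> bool"
  where
  "good_filtration K A F M \<Omega> \<longleftrightarrow>
    module_filtration K A F M \<Omega> \<and> finitely_generated_over (gr_algebra A F) (gr_module M \<Omega>)"


section \<open>Hilbert-Samuel polynomials and very nice algebras\<close>

text \<open>HOL cannot quantify over the carrier types of modules inside a formula, so the category of
  finitely generated \<open>A\<close>-modules is represented by the finitely generated modules with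
  carriers in a given type.  By the lemma \<open>fg_module_copy\<close> below, every finitely
  generated \<open>A\<close>-module has an isomorphic copy with carrier in the type \<open>(nat \<Rightarrow> 'a) set\<close>, so for
  this type the two notions below are those for the category of all of them.\<close>

lemma fg_module_copy:
  fixes A :: "('a, 'r) ring_scheme" and M :: "('a, 'm) module"
  assumes "fg_module A M"
  shows "\<exists>(N :: ('a, (nat \<Rightarrow> 'a) set) module) \<phi>.
    fg_module A N \<and> \<phi> \<in> module_hom A M N \<and> bij_betw \<phi> (carrier M) (carrier N)"
proof -
  interpret left_module A M using assms by (simp add: fg_module_def)
  obtain S where S: "finite S" "S \<subseteq> carrier M" "generated_submodule A M S = carrier M"
    using assms by (auto simp: fg_module_def finitely_generated_over_def)
  obtain m :: "nat \<Rightarrow> 'm" and n where m: "S = m ` {..<n}"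
    using S(1) by (metis finite_conv_nat_seg_image lessThan_def)
  have mc: "m i \<in> carrier M" if "i < n" for i using that S(2) m by auto
  define comb where "comb c = (\<Oplus>\<^bsub>M\<^esub>i\<in>{..<n}. c i \<odot>\<^bsub>M\<^esub> m i)" for c :: "nat \<Rightarrow> 'a"
  define C where "C = (UNIV :: nat set) \<rightarrow> carrier A"
  have summ: "(\<lambda>i. c i \<odot>\<^bsub>M\<^esub> m i) \<in> {..<n} \<rightarrow> carrier M" if "c \<in> C" for c
    using that mc by (auto simp: C_def Pi_def intro: smult_closed)
  have combc: "comb c \<in> carrier M" if "c \<in> C" for c
    unfolding comb_def using summ[OF that] by (rule finsum_closed)
  have smult_zero_r: "a \<odot>\<^bsub>M\<^esub> \<zero>\<^bsub>M\<^esub> = \<zero>\<^bsub>M\<^esub>" if "a \<in> carrier A" for a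
    by (metis M.add.l_cancel_one' M.zero_closed M.r_zero smult_closed smult_r_distr that)
  have smult_zero_l: "\<zero>\<^bsub>A\<^esub> \<odot>\<^bsub>M\<^esub> x = \<zero>\<^bsub>M\<^esub>" if "x \<in> carrier M" for x
    by (metis M.add.l_cancel_one' A.zero_closed A.r_zero smult_closed smult_l_distr that)
  have smult_sum: "a \<odot>\<^bsub>M\<^esub> (\<Oplus>\<^bsub>M\<^esub>i\<in>I. f i) = (\<Oplus>\<^bsub>M\<^esub>i\<in>I. a \<odot>\<^bsub>M\<^esub> f i)"
    if "finite I" "a \<in> carrier A" "f \<in> I \<rightarrow> carrier M" for a I and f :: "nat \<Rightarrow> 'm"
    using that
    by (induct I) (auto simp: smult_zero_r smult_r_distr smult_closed Pi_def)
  have comb_add: "comb (\<lambda>i. c i \<oplus>\<^bsub>A\<^esub> d i) = comb c \<oplus>\<^bsub>M\<^esub> comb d" if "c \<in> C" "d \<in> C" for c d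
  proof -
    have "comb (\<lambda>i. c i \<oplus>\<^bsub>A\<^esub> d i) = (\<Oplus>\<^bsub>M\<^esub>i\<in>{..<n}. c i \<odot>\<^bsub>M\<^esub> m i \<oplus>\<^bsub>M\<^esub> d i \<odot>\<^bsub>M\<^esub> m i)"
      unfolding comb_def using that mc
      by (intro M.finsum_cong') (auto simp: C_def Pi_def intro!: smult_l_distr smult_closed)
    also have "\<dots> = comb c \<oplus>\<^bsub>M\<^esub> comb d"
      unfolding comb_def by (rule finsum_addf[OF summ[OF that(1)] summ[OF that(2)]])
    finally show ?thesis .
  qed
  have comb_smult: "comb (\<lambda>i. a \<otimes>\<^bsub>A\<^esub> c i) = a \<odot>\<^bsub>M\<^esub> comb c" if "c \<in> C" "a \<in> carrier A" for c a
  proof -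
    have "comb (\<lambda>i. a \<otimes>\<^bsub>A\<^esub> c i) = (\<Oplus>\<^bsub>M\<^esub>i\<in>{..<n}. a \<odot>\<^bsub>M\<^esub> (c i \<odot>\<^bsub>M\<^esub> m i))"
      unfolding comb_def using that mc
      by (intro M.finsum_cong') (auto simp: C_def Pi_def intro!: smult_assoc smult_closed)
    then show ?thesis
      unfolding comb_def using smult_sum[OF _ that(2) summ[OF that(1)]] by simp
  qed
  have comb_unit: "m j \<in> comb ` C" if "j < n" for j
  proof
    let ?c = "\<lambda>i. if i = j then \<one>\<^bsub>A\<^esub> else \<zero>\<^bsub>A\<^esub>"
    show "?c \<in> C" by (auto simp: C_def)
    have "comb ?c = (\<Oplus>\<^bsub>M\<^esub>i\<in>{..<n}. if j = i then m i else \<zero>\<^bsub>M\<^esub>)"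
      unfolding comb_def using mc
      by (intro M.finsum_cong') (auto simp: Pi_def smult_one smult_zero_l)
    also have "\<dots> = m j"
      using that mc by (intro M.finsum_singleton) (auto simp: Pi_def)
    finally show "m j = comb ?c" by simp
  qed
  have sub: "Module.submodule (comb ` C) A M"
  proof -
    have *: "a \<odot>\<^bsub>M\<^esub> x \<in> comb ` C" if "a \<in> carrier A" "x \<in> comb ` C" for a x
    proof -
      obtain c where c: "c \<in> C" "x = comb c" using \<open>x \<in> comb ` C\<close> by auto
      have "(\<lambda>i. a \<otimes>\<^bsub>A\<^esub> c i) \<in> C" using c that(1) by (auto simp: C_def)
      then show ?thesis using comb_smult[OF c(1) that(1)] c(2) by (metis imageI)
    qed
    have neg: "\<ominus>\<^bsub>M\<^esub> x = (\<ominus>\<^bsub>A\<^esub> \<one>\<^bsub>A\<^esub>) \<odot>\<^bsub>M\<^esub> x" if "x \<in> carrier M" for x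
    proof -
      have "(\<ominus>\<^bsub>A\<^esub> \<one>\<^bsub>A\<^esub>) \<odot>\<^bsub>M\<^esub> x \<oplus>\<^bsub>M\<^esub> x = (\<ominus>\<^bsub>A\<^esub> \<one>\<^bsub>A\<^esub> \<oplus>\<^bsub>A\<^esub> \<one>\<^bsub>A\<^esub>) \<odot>\<^bsub>M\<^esub> x"
        using that by (simp add: smult_l_distr smult_one)
      also have "\<dots> = \<zero>\<^bsub>M\<^esub>" using that by (simp add: A.l_neg smult_zero_l)
      finally show ?thesis using that by (intro M.minus_equality) (auto intro: smult_closed)
    qed
    have "subgroup (comb ` C) (add_monoid M)"
    proof (rule M.add.subgroupI)
      show "comb ` C \<subseteq> carrier M" using combc by auto
      have "(\<lambda>i. \<zero>\<^bsub>A\<^esub>) \<in> C" by (auto simp: C_def)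
      then show "comb ` C \<noteq> {}" by auto
      show "\<ominus>\<^bsub>M\<^esub> x \<in> comb ` C" if "x \<in> comb ` C" for x
        using that neg combc *[of "\<ominus>\<^bsub>A\<^esub> \<one>\<^bsub>A\<^esub>" x] by auto
      show "x \<oplus>\<^bsub>M\<^esub> y \<in> comb ` C" if "x \<in> comb ` C" "y \<in> comb ` C" for x y
      proof -
        obtain c d where cd: "c \<in> C" "x = comb c" "d \<in> C" "y = comb d" using \<open>x \<in> comb ` C\<close> \<open>y \<in> comb ` C\<close> by auto
        have "(\<lambda>i. c i \<oplus>\<^bsub>A\<^esub> d i) \<in> C" using cd by (auto simp: C_def)
        then show ?thesis using comb_add[OF cd(1,3)] cd by (metis imageI)
      qed
    qed
    then show ?thesis
      using * by (simp add: Module.submodule_def Module.submodule_axioms_def)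
  qed
  have surj: "carrier M \<subseteq> comb ` C"
  proof -
    have "S \<subseteq> comb ` C" using m comb_unit by blast
    then show ?thesis using S(3) sub unfolding generated_submodule_def by blast
  qed
  define \<phi> where "\<phi> x = {c \<in> C. comb c = x}" for x
  have inj: "inj_on \<phi> (carrier M)"
  proof (rule inj_onI)
    fix x y assume "x \<in> carrier M" "\<phi> x = \<phi> y"
    moreover obtain c where "c \<in> C" "comb c = x" using surj \<open>x \<in> carrier M\<close> by auto
    ultimately show "x = y" unfolding \<phi>_def by auto
  qed
  define \<psi> where "\<psi> = the_inv_into (carrier M) \<phi>"
  have \<psi>[simp]: "\<psi> (\<phi> x) = x" if "x \<in> carrier M" for x
    unfolding \<psi>_def using inj that by (rule the_inv_into_f_f)
  define N :: "('a, (nat \<Rightarrow> 'a) set) module" where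
    "N = \<lparr>carrier = \<phi> ` carrier M, mult = undefined, one = undefined, zero = \<phi> \<zero>\<^bsub>M\<^esub>,
       add = (\<lambda>X Y. \<phi> (\<psi> X \<oplus>\<^bsub>M\<^esub> \<psi> Y)), smult = (\<lambda>a X. \<phi> (a \<odot>\<^bsub>M\<^esub> \<psi> X))\<rparr>"
  have Nsimps: "carrier N = \<phi> ` carrier M" "\<zero>\<^bsub>N\<^esub> = \<phi> \<zero>\<^bsub>M\<^esub>"
      "\<And>X Y. X \<oplus>\<^bsub>N\<^esub> Y = \<phi> (\<psi> X \<oplus>\<^bsub>M\<^esub> \<psi> Y)" "\<And>a X. a \<odot>\<^bsub>N\<^esub> X = \<phi> (a \<odot>\<^bsub>M\<^esub> \<psi> X)"
    by (simp_all add: N_def)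
  have agN: "abelian_group N"
  proof (rule abelian_groupI)
    fix X assume "X \<in> carrier N"
    then obtain x where x: "x \<in> carrier M" "X = \<phi> x" by (auto simp: Nsimps)
    show "\<exists>Y \<in> carrier N. Y \<oplus>\<^bsub>N\<^esub> X = \<zero>\<^bsub>N\<^esub>"
      using x by (intro bexI[of _ "\<phi> (\<ominus>\<^bsub>M\<^esub> x)"]) (auto simp: Nsimps M.l_neg)
  qed (auto simp: Nsimps M.a_ac)
  have lmN: "left_module A N"
    by (intro left_module.intro left_module_axioms.intro agN A.ring_axioms)
      (auto simp: Nsimps smult_closed smult_l_distr smult_r_distr smult_assoc smult_one)
  have subN: "Module.submodule {x \<in> carrier M. \<phi> x \<in> Q} A M" if "Module.submodule Q A N" for Q
  proof -
    interpret N: left_module A N by (rule lmN)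
    have Q: "subgroup Q (add_monoid N)" "\<And>a X. a \<in> carrier A \<Longrightarrow> X \<in> Q \<Longrightarrow> a \<odot>\<^bsub>N\<^esub> X \<in> Q"
      using that by (auto simp: Module.submodule_def Module.submodule_axioms_def)
    have inv: "\<ominus>\<^bsub>N\<^esub> (\<phi> x) = \<phi> (\<ominus>\<^bsub>M\<^esub> x)" if "x \<in> carrier M" for x
      using that by (intro N.M.minus_equality) (auto simp: Nsimps M.l_neg)
    have "subgroup {x \<in> carrier M. \<phi> x \<in> Q} (add_monoid M)"
    proof (rule M.add.subgroupI)
      show "{x \<in> carrier M. \<phi> x \<in> Q} \<noteq> {}"
        using subgroup.one_closed[OF Q(1)] by (auto simp: Nsimps)
      show "\<ominus>\<^bsub>M\<^esub> x \<in> {x \<in> carrier M. \<phi> x \<in> Q}" if "x \<in> {x \<in> carrier M. \<phi> x \<in> Q}" for x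
        using that subgroup.m_inv_closed[OF Q(1), of "\<phi> x"] inv[of x]
        by (auto simp: a_inv_def[of N])
      show "x \<oplus>\<^bsub>M\<^esub> y \<in> {x \<in> carrier M. \<phi> x \<in> Q}"
        if "x \<in> {x \<in> carrier M. \<phi> x \<in> Q}" "y \<in> {x \<in> carrier M. \<phi> x \<in> Q}" for x y
        using that subgroup.m_closed[OF Q(1), of "\<phi> x" "\<phi> y"] by (auto simp: Nsimps)
    qed auto
    moreover have "a \<odot>\<^bsub>M\<^esub> x \<in> {x \<in> carrier M. \<phi> x \<in> Q}"
      if "a \<in> carrier A" "x \<in> {x \<in> carrier M. \<phi> x \<in> Q}" for a x
      using that Q(2)[of a "\<phi> x"] by (auto simp: Nsimps smult_closed)
    ultimately show ?thesis
      by (simp add: Module.submodule_def Module.submodule_axioms_def)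
  qed
  have "generated_submodule A N (\<phi> ` S) = carrier N"
  proof
    interpret N: left_module A N by (rule lmN)
    have "Module.submodule (carrier N) A N"
      using N.M.add.subgroup_self N.smult_closed
      by (simp add: Module.submodule_def Module.submodule_axioms_def)
    then show "generated_submodule A N (\<phi> ` S) \<subseteq> carrier N"
      using S(2) unfolding generated_submodule_def Nsimps(1) by (intro Inter_lower) blast
    show "carrier N \<subseteq> generated_submodule A N (\<phi> ` S)"
      unfolding generated_submodule_def
    proof (rule Inter_greatest, clarify)
      fix Q X assume Q: "Module.submodule Q A N" "\<phi> ` S \<subseteq> Q" and X: "X \<in> carrier N"
      have "carrier M \<subseteq> {x \<in> carrier M. \<phi> x \<in> Q}"
        using S(2,3) subN[OF Q(1)] Q(2) unfolding generated_submodule_def by blast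
      then show "X \<in> Q" using X by (auto simp: Nsimps)
    qed
  qed
  then have "finitely_generated_over A N"
    unfolding finitely_generated_over_def using S(1,2)
    by (intro exI[of _ "\<phi> ` S"]) (auto simp: Nsimps)
  then have "fg_module A N" using lmN by (simp add: fg_module_def)
  moreover have "\<phi> \<in> module_hom A M N"
    by (auto simp: module_hom_def Nsimps)
  moreover have "bij_betw \<phi> (carrier M) (carrier N)"
    using inj by (simp add: bij_betw_def Nsimps)
  ultimately show ?thesis by blast
qed

definition admits_Hilbert_Samuel ::
    "'m itself \<Rightarrow> 'k ring \<Rightarrow> ('k, 'a) module \<Rightarrow> bool" where
  "admits_Hilbert_Samuel (_ :: 'm itself) K A \<longleftrightarrow>
    (\<exists>F. algebra_filtration K A F \<and> fin_dim_filtration K A F \<and>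
      affine_algebra K (gr_algebra A F) \<and> left_noetherian (gr_algebra A F) \<and>
      (\<forall>(M :: ('a, 'm) module) \<Omega>.
        fg_module A M \<longrightarrow> good_filtration K A F M \<Omega> \<longrightarrow>
        fin_dim_filtration K (restrict_scalars A M) \<Omega> \<longrightarrow>
        (\<exists>H :: rat poly. \<forall>\<^sub>F n in sequentially.
          poly H (of_nat n) = of_nat (dim_of K (restrict_scalars A M) (\<Omega> n)))))"

definition GK_exact :: "'m itself \<Rightarrow> 'k ring \<Rightarrow> ('k, 'a) module \<Rightarrow> bool" where
  "GK_exact (_ :: 'm itself) K A \<longleftrightarrow>
    (\<forall>M' M M'' :: ('a, 'm) module.
      fg_module A M' \<longrightarrow> fg_module A M \<longrightarrow> fg_module A M'' \<longrightarrow> short_exact A M' M M'' \<longrightarrow>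
      GK K A M = max (GK K A M') (GK K A M''))"

definition is_multiplicity ::
    "'k ring \<Rightarrow> ('k, 'a) module \<Rightarrow> (('a, 'm) module \<Rightarrow> nat) \<Rightarrow> bool" where
  "is_multiplicity K A e \<longleftrightarrow>
    (\<forall>M' M M''.
      fg_module A M' \<longrightarrow> fg_module A M \<longrightarrow> fg_module A M'' \<longrightarrow> short_exact A M' M M'' \<longrightarrow>
      (GK K A M' < GK K A M \<and> GK K A M = GK K A M'' \<longrightarrow> e M = e M'') \<and>
      (GK K A M' = GK K A M \<and> GK K A M > GK K A M'' \<longrightarrow> e M = e M') \<and>
      (GK K A M' = GK K A M \<and> GK K A M = GK K A M'' \<longrightarrow> e M = e M' + e M'')) \<and>
    (\<forall>M. fg_module A M \<longrightarrow> (e M = 0 \<longleftrightarrow> carrier M = {\<zero>\<^bsub>M\<^esub>}))"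

definition very_nice :: "'m itself \<Rightarrow> 'k ring \<Rightarrow> ('k, 'a) module \<Rightarrow> bool" where
  "very_nice (T :: 'm itself) K A \<longleftrightarrow>
    GK_exact T K A \<and>
    (\<forall>M :: ('a, 'm) module. fg_module A M \<longrightarrow> carrier M \<noteq> {\<zero>\<^bsub>M\<^esub>} \<longrightarrow>
      (\<exists>d :: nat. GK K A M = ereal (real d))) \<and>
    (\<exists>e :: ('a, 'm) module \<Rightarrow> nat. is_multiplicity K A e)"

end

theory Submission
  imports Defs "HOL-Real_Asymp.Real_Asymp"
begin

text \<open>Give a module \<open>M\<close> with homogeneous generators \<open>X\<close> the standard filtration
  \<open>M\<^sub>n = \<Sum> F\<^sub>n\<^sub>-\<^sub>i x\<close> over \<open>(i, x) \<in> X\<close>.  It is good, so its dimensions are eventually given by a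
  polynomial \<open>H\<close>.  Since \<open>gr A\<close> is affine, the \<open>F\<^sub>n\<close> grow like the powers of any generating subspace
  up to a linear change of the index, so the GK dimension of \<open>M\<close> is the degree \<open>d\<close> of \<open>H\<close>.  Two
  standard filtrations are contained in shifts of each other, so the leading coefficient of \<open>H\<close>
  depends on \<open>M\<close> only; multiplied by \<open>d!\<close> it is a \<open>d\<close>-th difference of an integer sequence, and this
  natural number is the multiplicity.  Given a short exact sequence, the standard filtration of the
  middle term induces standard filtrations on the quotient and, because \<open>gr A\<close> is Noetherian, on the
  submodule.  Hence Hilbert-Samuel polynomials add up, and all axioms of a very nice algebra become
  statements about sums of polynomials with positive leading coefficients.\<close>

section \<open>Growth of real polynomials\<close>

text \<open>Two comparisons of different strength are at work. A linear change of the index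
  preserves the degree of a polynomial but not its leading coefficient, so it suffices for the GK
  dimension; the multiplicity needs standard filtrations to agree up to a constant shift. Generators
  carry degrees because the filtration \<open>N \<inter> M_n\<close> induced on a submodule is in
  general not generated in a single degree. The Noetherian hypothesis concerns left ideals of gr A
  only; rather than passing to Noetherian graded modules, leading coefficients of elements of
  \<open>N\<close> at one generator at a time are collected into homogeneous left ideals of gr A.
  Homogeneous left ideals and graded subalgebras are represented by families of subgroups of A lying
  between consecutive terms of the filtration, which keeps most computations in A itself. The
  hypothesis provides polynomials for modules over one carrier type only; isomorphic copies bring
  them to modules of every type.\<close>

lemma lead_coeff_nonneg_if_eventually_nonneg:
  fixes p :: "real poly"
  assumes "\<forall>\<^sub>F n in sequentially. poly p (real n) \<ge> 0"
  shows "lead_coeff p \<ge> 0"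
proof (rule ccontr)
  assume "\<not> lead_coeff p \<ge> 0"
  then obtain N where N: "\<And>x. x \<ge> N \<Longrightarrow> poly (- p) x \<ge> lead_coeff (- p)"
    using poly_pinfty_gt_lc[of "- p"] by auto
  obtain M where M: "\<And>n. n \<ge> M \<Longrightarrow> poly p (real n) \<ge> 0"
    using assms by (auto simp: eventually_sequentially)
  have "poly p (real (max M (nat \<lceil>N\<rceil>))) \<ge> 0" by (rule M) simp
  moreover have "poly (- p) (real (max M (nat \<lceil>N\<rceil>))) \<ge> lead_coeff (- p)"
    by (rule N) linarith
  ultimately show False using \<open>\<not> lead_coeff p \<ge> 0\<close> by simp
qed

text \<open>Composing \<open>q\<close> with X + c changes neither degree nor leading coefficient, so
  a shift by a constant is harmless. The difference is eventually nonnegative, which rules out a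
  dominating \<open>p\<close>. Used in both directions, the bound makes two Hilbert polynomials of a
  module share degree and leading coefficient.\<close>

lemma lead_coeff_mono_if_eventually_le:
  fixes p q :: "real poly"
  assumes le: "\<forall>\<^sub>F n in sequentially. poly p (real n) \<le> poly q (real (n + c))"
    and pos: "lead_coeff p > 0"
  shows "degree p < degree q \<or> degree p = degree q \<and> lead_coeff p \<le> lead_coeff q"
proof -
  define q' where "q' = pcompose q [:real c, 1:]"
  have q': "degree q' = degree q" "lead_coeff q' = lead_coeff q"
    unfolding q'_def using lead_coeff_comp[of "[:real c, 1:]" q] by (simp_all add: degree_pcompose)
  have "\<forall>\<^sub>F n in sequentially. poly (q' - p) (real n) \<ge> 0"
    using le by eventually_elim (simp add: q'_def poly_pcompose add.commute)
  then have nn: "lead_coeff (q' - p) \<ge> 0" by (rule lead_coeff_nonneg_if_eventually_nonneg)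
  consider "degree p < degree q" | "degree p > degree q" | "degree p = degree q" by linarith
  then show ?thesis
  proof cases
    \<comment> \<open>If \<open>p\<close> had the larger degree, the difference would have the
      negative leading coefficient \<open>- lead_coeff p\<close>.\<close>
    case 2
    then have d: "degree (q' - p) = degree p"
      using q' degree_add_eq_right[of q' "- p"] by simp
    have "Polynomial.coeff q' (degree p) = 0" using 2 q' by (intro coeff_eq_0) simp
    then have "lead_coeff (q' - p) = - lead_coeff p" unfolding d by simp
    then show ?thesis using nn pos by simp
  next
    case 3
    have c: "Polynomial.coeff (q' - p) (degree p) = lead_coeff q - lead_coeff p" using 3 q' by simp
    have "degree (q' - p) \<le> degree p" using 3 q' by (intro degree_diff_le) auto
    then consider "degree (q' - p) = degree p" | "degree (q' - p) < degree p" by linarith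
    then have "lead_coeff q - lead_coeff p \<ge> 0"
    proof cases
      case 2
      then have "Polynomial.coeff (q' - p) (degree p) = 0" by (rule coeff_eq_0)
      then show ?thesis unfolding c by simp
    qed (use nn c in simp)
    then show ?thesis using 3 by simp
  qed simp
qed

text \<open>Induction by forward differences: \<Delta> p(x) = p(x + 1) - p(x) is again integral at
  large integers, its degree bound drops by one, and its coefficient at \<open>d\<close> is d + 1
  times that of \<open>p\<close> at d + 1. Repeated differences thus accumulate the
  factorial.\<close>

lemma fact_coeff_int_if_eventually_int:
  fixes p :: "real poly"
  assumes "degree p \<le> d" "\<forall>\<^sub>F n in sequentially. poly p (real n) \<in> \<int>"
  shows "fact d * Polynomial.coeff p d \<in> \<int>"
  using assms
proof (induction d arbitrary: p)
  case 0
  then obtain a where a: "p = [:a:]" using degree_eq_zeroE[of p] by auto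
  from 0(2) have "a \<in> \<int>" by (simp add: a)
  then show ?case by (simp add: a)
next
  case (Suc d)
  define \<Delta> where "\<Delta> = pcompose p [:1, 1:] - p"
  have pm: "(\<Sum>i\<le>Suc d. Polynomial.monom (Polynomial.coeff p i) i) = p" using Suc.prems(1)
    by (rule poly_as_sum_of_monoms')
  \<comment> \<open>Composition with X + 1 turns each monomial into a power of X + 1, whose
    coefficients are binomial coefficients.\<close>
  have comp: "pcompose p [:1, 1:] = (\<Sum>i\<le>Suc d. Polynomial.smult (Polynomial.coeff p i) ([:1, 1:] ^ i))"
  proof -
    have X: "pcompose ([:0, 1:] ^ i) [:1, 1:] = ([:1, 1:] ^ i :: real poly)" for i
      by (induction i) (simp_all add: pcompose_mult pcompose_pCons pcompose_1)
    have "pcompose (Polynomial.monom a i) [:1, 1:] = Polynomial.smult a ([:1, 1:] ^ i)"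
      for a :: real and i
      by (simp only: monom_altdef pcompose_smult X)
    then have "pcompose (\<Sum>i\<le>Suc d. Polynomial.monom (Polynomial.coeff p i) i) [:1, 1:]
        = (\<Sum>i\<le>Suc d. Polynomial.smult (Polynomial.coeff p i) ([:1, 1:] ^ i))"
      by (simp only: pcompose_sum)
    then show ?thesis by (simp only: pm)
  qed
  have c: "Polynomial.coeff (pcompose p [:1, 1:]) j = (\<Sum>i\<le>Suc d. Polynomial.coeff p i * real (i choose j))" for j
  proof -
    have "Polynomial.coeff ([:1, 1:] ^ i :: real poly) j = real (i choose j)" for i
    proof (cases "j \<le> i")
      case False
      have "degree ([:1, 1:] ^ i :: real poly) = i" by (simp add: degree_linear_power)
      with False show ?thesis by (simp add: coeff_eq_0 binomial_eq_0)
    qed (simp add: coeff_linear_poly_power)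
    then show ?thesis unfolding comp by (simp add: coeff_sum del: sum.atMost_Suc)
  qed
  \<comment> \<open>At exponent \<open>Suc d\<close> only the top term of \<open>p\<close>
    contributes, with binomial coefficient 1, so the difference cancels it.\<close>
  have top: "Polynomial.coeff \<Delta> (Suc d) = 0"
    by (simp only: \<Delta>_def Polynomial.coeff_diff c sum.atMost_Suc) (simp add: binomial_eq_0)
  have "degree \<Delta> \<le> Suc d" unfolding \<Delta>_def using Suc.prems(1)
    by (intro degree_diff_le) (simp_all add: degree_pcompose)
  with top have deg: "degree \<Delta> \<le> d"
    by (metis Polynomial.degree_0 le_SucE le_zero_eq leading_coeff_0_iff zero_le)
  \<comment> \<open>Only the exponents \<open>d\<close> and \<open>Suc d\<close> contribute; the
    latter enters with the factor Suc d choose d = Suc d.\<close>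
  have sub: "Polynomial.coeff \<Delta> d = real (Suc d) * Polynomial.coeff p (Suc d)"
  proof -
    have "(\<Sum>i<d. Polynomial.coeff p i * real (i choose d)) = 0" by (intro sum.neutral) simp
    then have "Polynomial.coeff (pcompose p [:1, 1:]) d
        = Polynomial.coeff p d + real (Suc d) * Polynomial.coeff p (Suc d)"
      unfolding c by (simp add: lessThan_Suc_atMost[symmetric])
    then show ?thesis by (simp add: \<Delta>_def)
  qed
  obtain N where N: "\<And>n. n \<ge> N \<Longrightarrow> poly p (real n) \<in> \<int>"
    using Suc.prems(2) by (auto simp: eventually_sequentially)
  have "poly \<Delta> (real n) \<in> \<int>" if "n \<ge> N" for n
  proof -
    have "poly \<Delta> (real n) = poly p (real (Suc n)) - poly p (real n)"
      by (simp add: \<Delta>_def poly_pcompose)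
    then show ?thesis using N[of n] N[of "Suc n"] that by simp
  qed
  then have "fact d * Polynomial.coeff \<Delta> d \<in> \<int>"
    by (intro Suc.IH deg) (auto simp: eventually_sequentially)
  then show ?case by (simp add: sub algebra_simps)
qed

text \<open>The factors 1/2 and 2 stand for any constants below and above 1: the differences with
  the two monomials keep a positive coefficient at \<open>degree p\<close> and are therefore
  eventually nonnegative.\<close>

lemma poly_bounds_at_top:
  fixes p :: "real poly"
  assumes "lead_coeff p > 0"
  obtains N where "\<And>x. x \<ge> N \<Longrightarrow> lead_coeff p / 2 * x ^ degree p \<le> poly p x"
    and "\<And>x. x \<ge> N \<Longrightarrow> poly p x \<le> 2 * lead_coeff p * x ^ degree p"
proof -
  let ?d = "degree p" and ?l = "lead_coeff p"
  have *: "\<exists>N. \<forall>x\<ge>N. poly q x \<ge> 0" if "degree q \<le> ?d" "Polynomial.coeff q ?d > 0" for q :: "real poly"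
  proof -
    have "degree q = ?d" using that le_degree[of q ?d] by simp
    then have "\<exists>N. \<forall>x\<ge>N. poly q x \<ge> Polynomial.coeff q ?d"
      using poly_pinfty_gt_lc[of q] that by simp
    then show ?thesis using that(2) by (meson less_imp_le order_trans)
  qed
  obtain N1 where N1: "\<forall>x\<ge>N1. poly (p - Polynomial.monom (?l / 2) ?d) x \<ge> 0"
    using *[of "p - Polynomial.monom (?l / 2) ?d"] assms
    by (auto simp: degree_diff_le degree_monom_le)
  obtain N2 where N2: "\<forall>x\<ge>N2. poly (Polynomial.monom (2 * ?l) ?d - p) x \<ge> 0"
    using *[of "Polynomial.monom (2 * ?l) ?d - p"] assms
    by (auto simp: degree_diff_le degree_monom_le)
  show ?thesis using N1 N2 by (intro that[of "max N1 N2"]) (auto simp: poly_monom)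
qed

text \<open>After division by ln n, constant factors and linear changes of the index vanish in the
  limit, so only the degree survives. The upper bound controls \<open>f\<close> at every index, the
  lower one only at the indices \<open>c * n + c'\<close>; this is enough because the limsup along a
  subsequence bounds the full limsup from below.\<close>

lemma limsup_log_dim:
  fixes p :: "real poly" and f h :: "nat \<Rightarrow> nat"
  assumes h: "\<forall>\<^sub>F n in sequentially. poly p (real n) = real (h n)"
    and pos: "lead_coeff p > 0"
    and upper: "\<And>n. f n \<le> h (a * n + b)" and "a > 0"
    and lower: "\<And>n. h n \<le> f (c * n + c')" and "c > 0"
  shows "limsup (\<lambda>n. log_dim n (f n)) = ereal (real (degree p))"
proof (rule antisym)
  let ?d = "degree p" and ?l = "lead_coeff p"
  obtain N where N1: "\<And>x. x \<ge> N \<Longrightarrow> ?l / 2 * x ^ ?d \<le> poly p x"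
    and N2: "\<And>x. x \<ge> N \<Longrightarrow> poly p x \<le> 2 * ?l * x ^ ?d"
    using poly_bounds_at_top[OF pos] by blast
  obtain N0 where N0: "\<And>n. n \<ge> N0 \<Longrightarrow> poly p (real n) = real (h n)"
    using h by (auto simp: eventually_sequentially)
  \<comment> \<open>The bound 2 makes ln n positive; beyond \<open>N0\<close> the polynomial
    computes \<open>h\<close>, and beyond \<open>N\<close> the power bounds hold.\<close>
  define M where "M = Max {2, N0, nat \<lceil>N\<rceil>}"
  have M: "M \<ge> 2" "M \<ge> N0" "real M \<ge> N" unfolding M_def by (auto simp: le_max_iff_disj, linarith)
  have le: "real (h n) \<le> 2 * ?l * real n ^ ?d" and ge: "?l / 2 * real n ^ ?d \<le> real (h n)"
    if "n \<ge> M" for n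
    using N0[of n] N1[of "real n"] N2[of "real n"] M that by auto
  define u where "u n = (ln (2 * ?l) + ?d * ln (a * real n + b)) / ln (real n)" for n
  have up: "log_dim n (f n) \<le> ereal (u n)" if "n \<ge> M" for n
  proof (cases "f n = 0")
    case False
    have n: "n \<ge> 2" using M that by simp
    \<comment> \<open>Hence \<open>a * n + b\<close> is beyond \<open>M\<close> as well, where the
      power bound for \<open>h\<close> applies.\<close>
    have an: "a * n + b \<ge> n" using \<open>a > 0\<close> by (cases a) auto
    have "real (f n) \<le> 2 * ?l * real (a * n + b) ^ ?d"
      using upper[of n] le[of "a * n + b"] an that by linarith
    then have "ln (real (f n)) \<le> ln (2 * ?l * real (a * n + b) ^ ?d)"
      using False by (subst ln_le_cancel_iff) (auto intro: less_le_trans)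
    also have "\<dots> = ln (2 * ?l) + ?d * ln (a * real n + b)"
    proof -
      have "real (a * n + b) > 0" using n an by linarith
      then show ?thesis using pos by (subst ln_mult) (auto simp: ln_realpow)
    qed
    finally show ?thesis using False n
      by (auto simp: log_dim_def log_def u_def intro!: divide_right_mono)
  qed (simp add: log_dim_def)
  have ulim: "u \<longlonglongrightarrow> real ?d"
  proof -
    have "real a > 0" using \<open>a > 0\<close> by simp
    have "(\<lambda>n. ln (real a * real n + real b) / ln (real n)) \<longlonglongrightarrow> 1" using \<open>real a > 0\<close> by real_asymp
    moreover have "(\<lambda>n. ln (2 * ?l) / ln (real n)) \<longlonglongrightarrow> 0" by real_asymp
    ultimately have "(\<lambda>n. ln (2 * ?l) / ln (real n) + ?d * (ln (a * real n + b) / ln (real n)))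
      \<longlonglongrightarrow> (0::real) + real ?d * 1" by (intro tendsto_intros)
    then show ?thesis by (simp add: u_def[abs_def] add_divide_distrib)
  qed
  have "limsup (\<lambda>n. log_dim n (f n)) \<le> limsup (\<lambda>n. ereal (u n))"
    using up by (intro Limsup_mono) (auto simp: eventually_sequentially)
  also have "\<dots> = ereal (real ?d)"
    by (intro lim_imp_Limsup) (use ulim in simp_all)
  finally show "limsup (\<lambda>n. log_dim n (f n)) \<le> ereal (real ?d)" .
  define r where "r n = c * n + c'" for n
  have r: "strict_mono r" unfolding r_def using \<open>c > 0\<close> by (simp add: strict_mono_def)
  define v where "v n = (ln (?l / 2) + ?d * ln (real n)) / ln (c * real n + c')" for n
  have low: "log_dim (r n) (f (r n)) \<ge> ereal (v n)" if "n \<ge> M" for n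
  proof -
    have n: "n \<ge> 2" using M that by simp
    have rn: "r n \<ge> n" using r by (rule strict_mono_imp_increasing)
    have fr: "?l / 2 * real n ^ ?d \<le> real (f (r n))"
      using lower[of n] ge[OF that] unfolding r_def by linarith
    moreover have p0: "?l / 2 * real n ^ ?d > 0" using pos n by simp
    ultimately have f0: "f (r n) > 0" by linarith
    have "ln (?l / 2) + ?d * ln (real n) = ln (?l / 2 * real n ^ ?d)"
      using pos n by (subst ln_mult) (auto simp: ln_realpow)
    also have "\<dots> \<le> ln (real (f (r n)))" using p0 fr f0 by (subst ln_le_cancel_iff) auto
    finally have *: "ln (?l / 2) + ?d * ln (real n) \<le> ln (real (f (r n)))" .
    have "c * real n + c' = real (r n)" by (simp add: r_def)
    then have "v n \<le> ln (real (f (r n))) / ln (real (r n))"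
      unfolding v_def using * rn n by (auto intro!: divide_right_mono)
    then show ?thesis using f0 by (simp add: log_dim_def log_def)
  qed
  have vlim: "v \<longlonglongrightarrow> real ?d"
  proof -
    have "real c > 0" using \<open>c > 0\<close> by simp
    have "(\<lambda>n. ln (real n) / ln (real c * real n + real c')) \<longlonglongrightarrow> 1" using \<open>real c > 0\<close> by real_asymp
    moreover have "(\<lambda>n. ln (?l / 2) / ln (real c * real n + real c')) \<longlonglongrightarrow> 0"
      using \<open>real c > 0\<close> by real_asymp
    ultimately have "(\<lambda>n. ln (?l / 2) / ln (real c * real n + real c')
        + ?d * (ln (real n) / ln (real c * real n + real c'))) \<longlonglongrightarrow> (0::real) + real ?d * 1"
      by (intro tendsto_intros)
    then show ?thesis by (simp add: v_def[abs_def] add_divide_distrib)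
  qed
  have "ereal (real ?d) = limsup (\<lambda>n. ereal (v n))"
    by (intro lim_imp_Limsup[symmetric]) (use vlim in simp_all)
  also have "\<dots> \<le> limsup (\<lambda>n. log_dim (r n) (f (r n)))"
    using low by (intro Limsup_mono) (auto simp: eventually_sequentially)
  also have "\<dots> \<le> limsup (\<lambda>n. log_dim n (f n))"
    using limsup_subseq_mono[OF r, of "\<lambda>n. log_dim n (f n)"] by (simp add: comp_def)
  finally show "ereal (real ?d) \<le> limsup (\<lambda>n. log_dim n (f n))" .
qed

section \<open>Subspaces and dimension\<close>

context vectorspace
begin

lemma subspaceI:
  assumes "W \<subseteq> carrier V" "\<zero>\<^bsub>V\<^esub> \<in> W"
    and "\<And>x y. x \<in> W \<Longrightarrow> y \<in> W \<Longrightarrow> x \<oplus>\<^bsub>V\<^esub> y \<in> W"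
    and "\<And>c x. c \<in> carrier K \<Longrightarrow> x \<in> W \<Longrightarrow> c \<odot>\<^bsub>V\<^esub> x \<in> W"
  shows "subspace K W V"
  unfolding subspace_def submodule_def using assms vectorspace_axioms module_axioms by auto

lemma subspaceD:
  assumes "subspace K W V"
  shows "W \<subseteq> carrier V" "\<zero>\<^bsub>V\<^esub> \<in> W"
    and "x \<in> W \<Longrightarrow> y \<in> W \<Longrightarrow> x \<oplus>\<^bsub>V\<^esub> y \<in> W"
    and "c \<in> carrier K \<Longrightarrow> x \<in> W \<Longrightarrow> c \<odot>\<^bsub>V\<^esub> x \<in> W"
    and "x \<in> W \<Longrightarrow> \<ominus>\<^bsub>V\<^esub> x \<in> W"
    and "x \<in> W \<Longrightarrow> y \<in> W \<Longrightarrow> x \<ominus>\<^bsub>V\<^esub> y \<in> W"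
proof -
  have sub: "submodule K W V" using assms by simp
  show *: "W \<subseteq> carrier V" "\<zero>\<^bsub>V\<^esub> \<in> W"
    "\<And>x y. x \<in> W \<Longrightarrow> y \<in> W \<Longrightarrow> x \<oplus>\<^bsub>V\<^esub> y \<in> W"
    "\<And>c x. c \<in> carrier K \<Longrightarrow> x \<in> W \<Longrightarrow> c \<odot>\<^bsub>V\<^esub> x \<in> W"
    using sub unfolding submodule_def by auto
  show m: "\<ominus>\<^bsub>V\<^esub> x \<in> W" if "x \<in> W" for x
  proof -
    have "(\<ominus>\<^bsub>K\<^esub> \<one>\<^bsub>K\<^esub>) \<odot>\<^bsub>V\<^esub> x \<in> W" using *(4) that by simp
    then show ?thesis using smult_minus_1[of x] that *(1) by auto
  qed
  show "x \<ominus>\<^bsub>V\<^esub> y \<in> W" if "x \<in> W" "y \<in> W"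
    unfolding a_minus_def using that *(3) m by simp
qed

lemma span_minimal:
  assumes "S \<subseteq> W" "subspace K W V"
  shows "span S \<subseteq> W"
  using span_is_subset[OF assms(1)] assms(2) by simp

lemma subspace_carrier: "subspace K (carrier V) V"
  by (rule subspaceI) auto

lemma subspace_Int:
  assumes "subspace K U V" "subspace K W V"
  shows "subspace K (U \<inter> W) V"
  using subspaceD[OF assms(1)] subspaceD[OF assms(2)] by (intro subspaceI) auto

end

text \<open>Linear independence does not depend on the surrounding subspace, so independent subsets
  of \<open>U\<close> have at most as many elements as the dimension of \<open>W\<close>. A maximal
  one therefore exists, and it is a basis of \<open>U\<close>.\<close>

lemma fin_dim_subspace_mono:
  assumes V: "vectorspace K V"
    and W: "fin_dim_subspace K W V" and U: "subspace K U V" "U \<subseteq> W"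
  shows "fin_dim_subspace K U V" "dim_of K V U \<le> dim_of K V W"
proof -
  interpret vectorspace K V by (rule V)
  have sW: "subspace K W V" and fW: "vectorspace.fin_dim K (vs W)"
    using W by (auto simp: fin_dim_subspace_def)
  interpret W: vectorspace K "vs W" by (rule subspace_is_vs[OF sW])
  interpret U: vectorspace K "vs U" by (rule subspace_is_vs[OF U(1)])
  have li: "W.lin_indpt B" if "B \<subseteq> U" "U.lin_indpt B" for B
    using span_li_not_depend(2)[of B U] span_li_not_depend(2)[of B W] that U sW by auto
  have small: "finite B \<and> card B \<le> W.dim" if "B \<subseteq> U \<and> U.lin_indpt B" for B
    using W.li_le_dim[OF fW, of B] li[of B] that U(2) by fastforce
  have "\<exists>B. finite B \<and> maximal B (\<lambda>S. S \<subseteq> carrier (vs U) \<and> U.lin_indpt S)"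
  proof (rule maximal_exists[where N = W.dim and B = "{}"])
    show "finite B \<and> card B \<le> W.dim" if "B \<subseteq> carrier (vs U) \<and> U.lin_indpt B" for B
      using small[of B] that by simp
    show "{} \<subseteq> carrier (vs U) \<and> U.lin_indpt {}" by (simp add: U.lin_dep_def)
  qed
  then obtain B where B: "finite B" "maximal B (\<lambda>S. S \<subseteq> carrier (vs U) \<and> U.lin_indpt S)"
    by blast
  then have bas: "U.basis B" by (intro U.max_li_is_basis)
  then have "U.fin_dim" using B(1) unfolding U.fin_dim_def U.basis_def by auto
  with U(1) show "fin_dim_subspace K U V" by (simp add: fin_dim_subspace_def)
  have "U.dim = card B" using U.dim_basis[OF B(1) bas] .
  moreover have "card B \<le> W.dim" using small[of B] bas by (auto simp: U.basis_def)
  ultimately show "dim_of K V U \<le> dim_of K V W" by (simp add: dim_of_def)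
qed

lemma fin_dim_subspace_span:
  assumes V: "vectorspace K V"
    and "finite S" "S \<subseteq> carrier V"
  shows "fin_dim_subspace K (module.span K V S) V"
proof -
  interpret vectorspace K V by (rule V)
  have sub: "subspace K (span S) V" using assms(3) by (intro span_is_subspace)
  interpret W: vectorspace K "vs (span S)" by (rule subspace_is_vs[OF sub])
  have "S \<subseteq> span S" using assms by (intro in_own_span)
  then have "W.span S = span S" using span_li_not_depend(1)[of S "span S"] sub by simp
  with \<open>S \<subseteq> span S\<close> assms sub show ?thesis
    by (auto simp: fin_dim_subspace_def W.fin_dim_def)
qed

lemma fin_dim_subspace_ex_span:
  assumes V: "vectorspace K V"
    and "fin_dim_subspace K W V"
  obtains S where "finite S" "S \<subseteq> W" "module.span K V S = W"
proof -
  interpret vectorspace K V by (rule V)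
  have sW: "subspace K W V" and fW: "vectorspace.fin_dim K (vs W)"
    using assms(2) by (auto simp: fin_dim_subspace_def)
  interpret W: vectorspace K "vs W" by (rule subspace_is_vs[OF sW])
  obtain S where S: "finite S" "S \<subseteq> W" "W.span S = W" using fW by (auto simp: W.fin_dim_def)
  then show thesis using that[of S] span_li_not_depend(1)[of S W] sW by simp
qed

lemma dim_of_eq_0_iff:
  assumes V: "vectorspace K V"
    and "fin_dim_subspace K W V"
  shows "dim_of K V W = 0 \<longleftrightarrow> W = {\<zero>\<^bsub>V\<^esub>}"
proof -
  interpret vectorspace K V by (rule V)
  have sW: "subspace K W V" and fW: "vectorspace.fin_dim K (vs W)"
    using assms(2) by (auto simp: fin_dim_subspace_def)
  interpret W: vectorspace K "vs W" by (rule subspace_is_vs[OF sW])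
  obtain B where B: "finite B" "W.basis B" using W.finite_basis_exists[OF fW] by auto
  then have d: "dim_of K V W = card B" using W.dim_basis by (simp add: dim_of_def)
  show ?thesis
  proof
    assume "dim_of K V W = 0"
    then have "B = {}" using d B by simp
    then show "W = {\<zero>\<^bsub>V\<^esub>}" using B(2) W.span_empty by (simp add: W.basis_def)
  next
    assume "W = {\<zero>\<^bsub>V\<^esub>}"
    then have "W.gen_set {\<zero>\<^bsub>vs W\<^esub>}"
      using W.in_own_span[of "{\<zero>\<^bsub>V\<^esub>}"] W.span_is_subset2[of "{\<zero>\<^bsub>V\<^esub>}"] by auto
    then show "dim_of K V W = 0" using W.dim0I by (simp add: dim_of_def)
  qed
qed

text \<open>Rank-nullity for the restriction of \<open>g\<close>, viewed as a linear map from
  \<open>W\<close> onto its image; the kernel on the right is the part inside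
  \<open>W\<close>.\<close>

lemma dim_of_image:
  assumes V: "vectorspace K V" and V': "vectorspace K V'"
    and W: "fin_dim_subspace K W V"
    and gW: "\<And>x. x \<in> W \<Longrightarrow> g x \<in> carrier V'"
    and add: "\<And>x y. x \<in> W \<Longrightarrow> y \<in> W \<Longrightarrow> g (x \<oplus>\<^bsub>V\<^esub> y) = g x \<oplus>\<^bsub>V'\<^esub> g y"
    and smult: "\<And>c x. c \<in> carrier K \<Longrightarrow> x \<in> W \<Longrightarrow> g (c \<odot>\<^bsub>V\<^esub> x) = c \<odot>\<^bsub>V'\<^esub> g x"
  shows "fin_dim_subspace K (g ` W) V'"
    and "dim_of K V W = dim_of K V {x \<in> W. g x = \<zero>\<^bsub>V'\<^esub>} + dim_of K V' (g ` W)"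
proof -
  interpret V: vectorspace K V by (rule V)
  interpret V': vectorspace K V' by (rule V')
  have sW: "subspace K W V" and fW: "vectorspace.fin_dim K (V.vs W)"
    using W by (auto simp: fin_dim_subspace_def)
  note W' = V.subspaceD[OF sW]
  have g0: "g \<zero>\<^bsub>V\<^esub> = \<zero>\<^bsub>V'\<^esub>"
    using smult[of "\<zero>\<^bsub>K\<^esub>" "\<zero>\<^bsub>V\<^esub>"] gW[of "\<zero>\<^bsub>V\<^esub>"] W' by simp
  have sub: "subspace K (g ` W) V'"
  proof (rule V'.subspaceI)
    show "\<zero>\<^bsub>V'\<^esub> \<in> g ` W" using g0 W' by (metis imageI)
    show "x \<oplus>\<^bsub>V'\<^esub> y \<in> g ` W" if "x \<in> g ` W" "y \<in> g ` W" for x y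
    proof -
      from that obtain u v where "u \<in> W" "v \<in> W" "x = g u" "y = g v" by blast
      then show ?thesis using add[of u v] W'(3)[of u v] by (metis imageI)
    qed
    show "c \<odot>\<^bsub>V'\<^esub> x \<in> g ` W" if "c \<in> carrier K" "x \<in> g ` W" for c x
    proof -
      from that(2) obtain u where "u \<in> W" "x = g u" by blast
      then show ?thesis using smult[of c u] W'(4)[of c u] that(1) by (metis imageI)
    qed
  qed (use gW in auto)
  interpret W: vectorspace K "V.vs W" by (rule V.subspace_is_vs[OF sW])
  interpret gW: vectorspace K "V'.vs (g ` W)" by (rule V'.subspace_is_vs[OF sub])
  interpret g: linear_map K "V.vs W" "V'.vs (g ` W)" g
    by unfold_locales (auto simp: LinearCombinations.module_hom_def add smult)
  have "gW.fin_dim" by (rule g.rank_nullity_main(2)[OF fW]) simp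
  with sub show "fin_dim_subspace K (g ` W) V'" by (simp add: fin_dim_subspace_def)
  have im: "g.im = g ` W" by (simp add: g.im_def)
  have ker: "g.ker = {x \<in> W. g x = \<zero>\<^bsub>V'\<^esub>}" by (simp add: g.ker_def)
  show "dim_of K V W = dim_of K V {x \<in> W. g x = \<zero>\<^bsub>V'\<^esub>} + dim_of K V' (g ` W)"
    using g.rank_nullity[OF fW] unfolding im ker by (simp add: dim_of_def)
qed

section \<open>Modules over an algebra and standard filtrations\<close>

locale algebra_module =
  fixes K :: "'k ring" and A :: "('k, 'a) module" and M :: "('a, 'm) module"
  assumes assoc_algebra: "assoc_algebra K A" and left_module: "left_module A M"
begin

sublocale A: ring A using assoc_algebra by (simp add: assoc_algebra_def)
sublocale M: abelian_group M using left_module by (simp add: left_module_def)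
sublocale AK: assoc_algebra K A by (rule assoc_algebra)
sublocale L: left_module A M by (rule left_module)

lemma smult_zero_right [simp]: "a \<in> carrier A \<Longrightarrow> a \<odot>\<^bsub>M\<^esub> \<zero>\<^bsub>M\<^esub> = \<zero>\<^bsub>M\<^esub>"
  by (metis M.add.l_cancel_one' M.zero_closed M.r_zero L.smult_closed L.smult_r_distr)

lemma smult_zero_left [simp]: "x \<in> carrier M \<Longrightarrow> \<zero>\<^bsub>A\<^esub> \<odot>\<^bsub>M\<^esub> x = \<zero>\<^bsub>M\<^esub>"
  by (metis M.add.l_cancel_one' A.zero_closed A.r_zero L.smult_closed L.smult_l_distr)

lemma smult_minus_left:
  "a \<in> carrier A \<Longrightarrow> x \<in> carrier M \<Longrightarrow> (\<ominus>\<^bsub>A\<^esub> a) \<odot>\<^bsub>M\<^esub> x = \<ominus>\<^bsub>M\<^esub> (a \<odot>\<^bsub>M\<^esub> x)"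
  by (rule M.minus_equality[symmetric])
    (simp_all add: L.smult_closed L.smult_l_distr[symmetric] A.l_neg)

abbreviation V :: "('k, 'm) module" where "V \<equiv> restrict_scalars A M"

lemma V_simps [simp]:
  "carrier V = carrier M" "\<zero>\<^bsub>V\<^esub> = \<zero>\<^bsub>M\<^esub>" "x \<oplus>\<^bsub>V\<^esub> y = x \<oplus>\<^bsub>M\<^esub> y"
  "c \<odot>\<^bsub>V\<^esub> x = (c \<odot>\<^bsub>A\<^esub> \<one>\<^bsub>A\<^esub>) \<odot>\<^bsub>M\<^esub> x"
  by (simp_all add: restrict_scalars_def)

lemma V_minus [simp]: "\<ominus>\<^bsub>V\<^esub> x = \<ominus>\<^bsub>M\<^esub> x" "x \<ominus>\<^bsub>V\<^esub> y = x \<ominus>\<^bsub>M\<^esub> y"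
  by (simp_all add: restrict_scalars_def a_inv_def a_minus_def m_inv_def)

lemma scalar_mult_left:
  "c \<in> carrier K \<Longrightarrow> a \<in> carrier A \<Longrightarrow> (c \<odot>\<^bsub>A\<^esub> \<one>\<^bsub>A\<^esub>) \<otimes>\<^bsub>A\<^esub> a = c \<odot>\<^bsub>A\<^esub> a"
  by (simp add: AK.smult_mult_left)

lemma scalar_mult_right:
  "c \<in> carrier K \<Longrightarrow> a \<in> carrier A \<Longrightarrow> a \<otimes>\<^bsub>A\<^esub> (c \<odot>\<^bsub>A\<^esub> \<one>\<^bsub>A\<^esub>) = c \<odot>\<^bsub>A\<^esub> a"
  by (simp add: AK.smult_mult_right)

lemma smult_smult:
  "c \<in> carrier K \<Longrightarrow> a \<in> carrier A \<Longrightarrow> x \<in> carrier M \<Longrightarrow>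
    (c \<odot>\<^bsub>A\<^esub> a) \<odot>\<^bsub>M\<^esub> x = c \<odot>\<^bsub>V\<^esub> (a \<odot>\<^bsub>M\<^esub> x)"
  by (simp add: L.smult_assoc[symmetric] scalar_mult_left)

lemma smult_comm:
  "c \<in> carrier K \<Longrightarrow> a \<in> carrier A \<Longrightarrow> x \<in> carrier M \<Longrightarrow>
    a \<odot>\<^bsub>M\<^esub> (c \<odot>\<^bsub>V\<^esub> x) = c \<odot>\<^bsub>V\<^esub> (a \<odot>\<^bsub>M\<^esub> x)"
  by (simp add: L.smult_assoc[symmetric] scalar_mult_left scalar_mult_right)

sublocale V: vectorspace K V
proof -
  have "abelian_group V"
    by (rule abelian_groupI) (auto simp: M.a_ac intro!: bexI[of _ "\<ominus>\<^bsub>M\<^esub> _"] M.l_neg)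
  moreover have "Module.module_axioms K V"
  proof
    fix a b x assume *: "a \<in> carrier K" "b \<in> carrier K" "x \<in> carrier V"
    \<comment> \<open>Scalars act through the multiples of one, so associativity of the action comes
      from c \<mapsto> c 1 being multiplicative.\<close>
    have "(a \<otimes>\<^bsub>K\<^esub> b) \<odot>\<^bsub>A\<^esub> \<one>\<^bsub>A\<^esub> = (a \<odot>\<^bsub>A\<^esub> \<one>\<^bsub>A\<^esub>) \<otimes>\<^bsub>A\<^esub> (b \<odot>\<^bsub>A\<^esub> \<one>\<^bsub>A\<^esub>)"
      using * by (simp add: scalar_mult_left AK.smult_assoc1)
    then show "(a \<otimes>\<^bsub>K\<^esub> b) \<odot>\<^bsub>V\<^esub> x = a \<odot>\<^bsub>V\<^esub> (b \<odot>\<^bsub>V\<^esub> x)"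
      using * by (simp add: L.smult_assoc[symmetric])
  qed (auto simp: AK.smult_l_distr L.smult_l_distr L.smult_r_distr L.smult_one L.smult_closed)
  ultimately have "Module.module K V"
    using AK.R.cring_axioms by (simp add: Module.module_def)
  then show "vectorspace K V"
    using AK.field_axioms by (simp add: vectorspace_def)
qed

lemma submoduleI:
  assumes "N \<subseteq> carrier M" "\<zero>\<^bsub>M\<^esub> \<in> N"
    and "\<And>x y. x \<in> N \<Longrightarrow> y \<in> N \<Longrightarrow> x \<oplus>\<^bsub>M\<^esub> y \<in> N"
    and "\<And>a x. a \<in> carrier A \<Longrightarrow> x \<in> N \<Longrightarrow> a \<odot>\<^bsub>M\<^esub> x \<in> N"
  shows "Module.submodule N A M"
proof -
  have "\<ominus>\<^bsub>M\<^esub> x \<in> N" if "x \<in> N" for x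
  proof -
    have "(\<ominus>\<^bsub>A\<^esub> \<one>\<^bsub>A\<^esub>) \<odot>\<^bsub>M\<^esub> x \<in> N" using assms(4) that by simp
    moreover have "(\<ominus>\<^bsub>A\<^esub> \<one>\<^bsub>A\<^esub>) \<odot>\<^bsub>M\<^esub> x = \<ominus>\<^bsub>M\<^esub> x"
      using that assms(1) smult_minus_left[of "\<one>\<^bsub>A\<^esub>" x] by (auto simp: L.smult_one)
    ultimately show ?thesis by simp
  qed
  then have "subgroup N (add_monoid M)"
    using assms by (intro M.add.subgroupI) auto
  then show ?thesis
    using assms(4) by (simp add: Module.submodule_def Module.submodule_axioms_def)
qed

lemma submoduleD:
  assumes "Module.submodule N A M"
  shows "N \<subseteq> carrier M" "\<zero>\<^bsub>M\<^esub> \<in> N"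
    and "x \<in> N \<Longrightarrow> y \<in> N \<Longrightarrow> x \<oplus>\<^bsub>M\<^esub> y \<in> N"
    and "a \<in> carrier A \<Longrightarrow> x \<in> N \<Longrightarrow> a \<odot>\<^bsub>M\<^esub> x \<in> N"
proof -
  have "subgroup N (add_monoid M)" using assms by (simp add: Module.submodule_def)
  then show "N \<subseteq> carrier M" "\<zero>\<^bsub>M\<^esub> \<in> N" "x \<in> N \<Longrightarrow> y \<in> N \<Longrightarrow> x \<oplus>\<^bsub>M\<^esub> y \<in> N"
    using subgroup.subset subgroup.one_closed subgroup.m_closed by fastforce+
  show "a \<in> carrier A \<Longrightarrow> x \<in> N \<Longrightarrow> a \<odot>\<^bsub>M\<^esub> x \<in> N"
    using assms by (simp add: Module.submodule_def Module.submodule_axioms_def)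
qed

lemma submodule_subspace:
  assumes "Module.submodule N A M"
  shows "VectorSpace.subspace K N V"
  using submoduleD[OF assms] by (intro V.subspaceI) auto

lemma submodule_carrier: "Module.submodule (carrier M) A M"
  by (rule submoduleI) (auto intro: L.smult_closed)

lemma generated_submodule_eq_carrierI:
  assumes "S \<subseteq> carrier M"
    and "\<And>N. Module.submodule N A M \<Longrightarrow> S \<subseteq> N \<Longrightarrow> carrier M \<subseteq> N"
  shows "generated_submodule A M S = carrier M"
  unfolding generated_submodule_def using assms submodule_carrier by blast

lemma generated_submodule_eq_carrierD:
  assumes "generated_submodule A M S = carrier M" "Module.submodule N A M" "S \<subseteq> N"
  shows "N = carrier M"
  using assms submoduleD(1)[OF assms(2)] unfolding generated_submodule_def by blast

text \<open>The elements that \<open>a\<close> sends into \<open>W\<close> form a K-subspace,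
  because multiplication by \<open>a\<close> commutes with the scalars.\<close>

lemma smult_span_in:
  assumes "S \<subseteq> carrier M" "VectorSpace.subspace K W V" "a \<in> carrier A"
    and "\<And>x. x \<in> S \<Longrightarrow> a \<odot>\<^bsub>M\<^esub> x \<in> W" and "x \<in> V.span S"
  shows "a \<odot>\<^bsub>M\<^esub> x \<in> W"
proof -
  note W = V.subspaceD[OF assms(2)]
  have "VectorSpace.subspace K {x \<in> carrier M. a \<odot>\<^bsub>M\<^esub> x \<in> W} V"
  proof (rule V.subspaceI)
    fix c x assume *: "c \<in> carrier K" "x \<in> {x \<in> carrier M. a \<odot>\<^bsub>M\<^esub> x \<in> W}"
    then have "c \<odot>\<^bsub>V\<^esub> (a \<odot>\<^bsub>M\<^esub> x) \<in> W" by (intro W(4)) auto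
    then have "a \<odot>\<^bsub>M\<^esub> (c \<odot>\<^bsub>V\<^esub> x) \<in> W" using * assms(3) smult_comm[of c a x] by simp
    then show "c \<odot>\<^bsub>V\<^esub> x \<in> {x \<in> carrier M. a \<odot>\<^bsub>M\<^esub> x \<in> W}" using * by (auto intro: L.smult_closed)
  qed (use W(2) W(3) assms(3) in \<open>auto simp: L.smult_r_distr\<close>)
  then have "V.span S \<subseteq> {x \<in> carrier M. a \<odot>\<^bsub>M\<^esub> x \<in> W}"
    using assms(1,4) by (intro V.span_minimal) auto
  then show ?thesis using assms(5) by auto
qed

lemma span_smult_in:
  assumes "B \<subseteq> carrier A" "VectorSpace.subspace K W V" "x \<in> carrier M"
    and "\<And>b. b \<in> B \<Longrightarrow> b \<odot>\<^bsub>M\<^esub> x \<in> W" and "b \<in> AK.span B"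
  shows "b \<odot>\<^bsub>M\<^esub> x \<in> W"
proof -
  note W = V.subspaceD[OF assms(2)]
  have "VectorSpace.subspace K {b \<in> carrier A. b \<odot>\<^bsub>M\<^esub> x \<in> W} A"
  proof (rule AK.subspaceI)
    fix c b assume *: "c \<in> carrier K" "b \<in> {b \<in> carrier A. b \<odot>\<^bsub>M\<^esub> x \<in> W}"
    then have "c \<odot>\<^bsub>V\<^esub> (b \<odot>\<^bsub>M\<^esub> x) \<in> W" by (intro W(4)) auto
    then show "c \<odot>\<^bsub>A\<^esub> b \<in> {b \<in> carrier A. b \<odot>\<^bsub>M\<^esub> x \<in> W}" using * assms(3) smult_smult[of c b x] by simp
  qed (use W(2) W(3) assms(3) in \<open>auto simp: L.smult_l_distr\<close>)
  then have "AK.span B \<subseteq> {b \<in> carrier A. b \<odot>\<^bsub>M\<^esub> x \<in> W}"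
    using assms(1,4) by (intro AK.span_minimal) auto
  then show ?thesis using assms(5) by auto
qed

end

text \<open>A pair \<open>(i, x)\<close> in \<open>X\<close> is a generator \<open>x\<close> placed in degree \<open>i\<close>.\<close>

definition std_filtration ::
    "'k ring \<Rightarrow> ('k, 'a) module \<Rightarrow> (nat \<Rightarrow> 'a set) \<Rightarrow> ('a, 'm) module \<Rightarrow> (nat \<times> 'm) set \<Rightarrow> nat \<Rightarrow> 'm set"
  where
  "std_filtration K A F M X n = module.span K (restrict_scalars A M)
     {b \<odot>\<^bsub>M\<^esub> x | b i x. (i, x) \<in> X \<and> i \<le> n \<and> b \<in> F (n - i)}"

lemma preceding_simps [simp]:
  "preceding G F 0 = {\<zero>\<^bsub>G\<^esub>}" "preceding G F (Suc n) = F n"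
  by (simp_all add: preceding_def)

locale filtered_algebra_module = algebra_module K A M
  for K :: "'k ring" and A :: "('k, 'a) module" and M :: "('a, 'm) module" +
  fixes F :: "nat \<Rightarrow> 'a set"
  assumes algebra_filtration: "algebra_filtration K A F"
begin

lemma F_subspace: "VectorSpace.subspace K (F i) A"
  and F_Suc: "F i \<subseteq> F (Suc i)"
  and one_in_F: "\<one>\<^bsub>A\<^esub> \<in> F 0"
  and F_mult: "a \<in> F i \<Longrightarrow> b \<in> F j \<Longrightarrow> a \<otimes>\<^bsub>A\<^esub> b \<in> F (i + j)"
  and F_Un: "(\<Union>i. F i) = carrier A"
  using algebra_filtration by (auto simp: algebra_filtration_def)

lemmas F = AK.subspaceD[OF F_subspace]

lemma F_carrier: "a \<in> F i \<Longrightarrow> a \<in> carrier A"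
  using F(1) by auto

lemma F_mono: "i \<le> j \<Longrightarrow> F i \<subseteq> F j"
  using F_Suc by (rule lift_Suc_mono_le)

lemma scalar_in_F: "c \<in> carrier K \<Longrightarrow> c \<odot>\<^bsub>A\<^esub> \<one>\<^bsub>A\<^esub> \<in> F 0"
  using F(4) one_in_F by auto

lemma preceding_subset_F: "preceding A F n \<subseteq> F n"
  using F(2) F_Suc by (cases n) auto

lemma preceding_subspace: "VectorSpace.subspace K (preceding A F n) A"
  by (cases n) (auto intro: AK.subspaceI F_subspace)

abbreviation filt :: "(nat \<times> 'm) set \<Rightarrow> nat \<Rightarrow> 'm set" where
  "filt \<equiv> std_filtration K A F M"

context
  fixes X :: "(nat \<times> 'm) set"
  assumes X: "X \<subseteq> UNIV \<times> carrier M"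
begin

lemma filt_generators_carrier:
  "{b \<odot>\<^bsub>M\<^esub> x | b i x. (i, x) \<in> X \<and> i \<le> n \<and> b \<in> F (n - i)} \<subseteq> carrier M"
  using X by (auto intro!: L.smult_closed F_carrier)

lemma filt_subspace: "VectorSpace.subspace K (filt X n) V"
  unfolding std_filtration_def using filt_generators_carrier by (intro V.span_is_subspace) simp

lemmas filtD = V.subspaceD[OF filt_subspace, simplified V_simps V_minus]

lemma filt_memI: "(i, x) \<in> X \<Longrightarrow> i \<le> n \<Longrightarrow> b \<in> F (n - i) \<Longrightarrow> b \<odot>\<^bsub>M\<^esub> x \<in> filt X n"
  unfolding std_filtration_def
  using V.in_own_span[of "{b \<odot>\<^bsub>M\<^esub> x | b i x. (i, x) \<in> X \<and> i \<le> n \<and> b \<in> F (n - i)}"]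
    filt_generators_carrier by auto

lemma filt_subset:
  assumes "VectorSpace.subspace K W V"
    and "\<And>b i x. (i, x) \<in> X \<Longrightarrow> i \<le> n \<Longrightarrow> b \<in> F (n - i) \<Longrightarrow> b \<odot>\<^bsub>M\<^esub> x \<in> W"
  shows "filt X n \<subseteq> W"
  unfolding std_filtration_def using assms by (intro V.span_minimal) auto

lemma generator_in_filt:
  assumes "(i, x) \<in> X" "i \<le> n"
  shows "x \<in> filt X n"
proof -
  have "\<one>\<^bsub>A\<^esub> \<in> F (n - i)" using one_in_F F_mono[of 0 "n - i"] by auto
  then have "\<one>\<^bsub>A\<^esub> \<odot>\<^bsub>M\<^esub> x \<in> filt X n" by (rule filt_memI[OF assms])
  then show ?thesis using X assms(1) by (auto simp: L.smult_one)
qed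

lemma smult_filt:
  assumes "a \<in> F i" "x \<in> filt X j"
  shows "a \<odot>\<^bsub>M\<^esub> x \<in> filt X (i + j)"
  using filt_generators_carrier filt_subspace F_carrier[OF assms(1)] _
    assms(2)[unfolded std_filtration_def]
proof (rule smult_span_in)
  fix y assume "y \<in> {b \<odot>\<^bsub>M\<^esub> x | b k x. (k, x) \<in> X \<and> k \<le> j \<and> b \<in> F (j - k)}"
  then obtain b k x where y: "y = b \<odot>\<^bsub>M\<^esub> x" "(k, x) \<in> X" "k \<le> j" "b \<in> F (j - k)" by auto
  have "a \<otimes>\<^bsub>A\<^esub> b \<in> F (i + j - k)" using F_mult[OF assms(1) y(4)] y(3) by simp
  then have "(a \<otimes>\<^bsub>A\<^esub> b) \<odot>\<^bsub>M\<^esub> x \<in> filt X (i + j)" using y by (intro filt_memI) auto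
  then show "a \<odot>\<^bsub>M\<^esub> y \<in> filt X (i + j)"
    using y X assms(1) by (auto simp: L.smult_assoc F_carrier)
qed

lemma filt_mono: "i \<le> j \<Longrightarrow> filt X i \<subseteq> filt X j"
  by (intro filt_subset filt_subspace)
    (auto intro!: filt_memI elim!: subsetD[OF F_mono, rotated])

lemma filt_Un_submodule: "Module.submodule (\<Union>n. filt X n) A M"
proof (rule submoduleI)
  show "(\<Union>n. filt X n) \<subseteq> carrier M" using filtD(1) by auto
  show "\<zero>\<^bsub>M\<^esub> \<in> (\<Union>n. filt X n)" using filtD(2) by auto
  show "x \<oplus>\<^bsub>M\<^esub> y \<in> (\<Union>n. filt X n)" if xy: "x \<in> (\<Union>n. filt X n)" "y \<in> (\<Union>n. filt X n)" for x y
  proof -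
    from xy obtain m n where "x \<in> filt X m" "y \<in> filt X n" by auto
    then have "x \<in> filt X (max m n)" "y \<in> filt X (max m n)"
      using filt_mono[of m "max m n"] filt_mono[of n "max m n"] by auto
    then show ?thesis using filtD(3) by blast
  qed
  show "a \<odot>\<^bsub>M\<^esub> x \<in> (\<Union>n. filt X n)" if ax: "a \<in> carrier A" "x \<in> (\<Union>n. filt X n)" for a x
  proof -
    from ax obtain i j where "a \<in> F i" "x \<in> filt X j" using F_Un by blast
    then show ?thesis using smult_filt by blast
  qed
qed

text \<open>The union is the submodule generated by the generators: it is a submodule, it contains
  each generator from its degree on, and a submodule containing the generators contains every term.
  The degrees only affect how fast the terms grow.\<close>

lemma filt_Un_iff: "(\<Union>n. filt X n) = carrier M \<longleftrightarrow> generated_submodule A M (snd ` X) = carrier M"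
proof
  assume *: "(\<Union>n. filt X n) = carrier M"
  show "generated_submodule A M (snd ` X) = carrier M"
  proof (rule generated_submodule_eq_carrierI)
    fix N assume N: "Module.submodule N A M" "snd ` X \<subseteq> N"
    have "filt X n \<subseteq> N" for n
      using N(2) by (intro filt_subset submodule_subspace N(1) submoduleD(4)[OF N(1)])
        (auto intro: F_carrier)
    then show "carrier M \<subseteq> N" unfolding *[symmetric] by blast
  qed (use X in auto)
next
  assume "generated_submodule A M (snd ` X) = carrier M"
  moreover have "snd ` X \<subseteq> (\<Union>n. filt X n)"
  proof clarify
    fix i x assume "(i, x) \<in> X"
    then show "snd (i, x) \<in> (\<Union>n. filt X n)" using generator_in_filt[of i x i] by auto
  qed
  ultimately show "(\<Union>n. filt X n) = carrier M"
    by (rule generated_submodule_eq_carrierD[OF _ filt_Un_submodule])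
qed

lemma filt_module_filtration:
  assumes "generated_submodule A M (snd ` X) = carrier M"
  shows "module_filtration K A F M (filt X)"
  unfolding module_filtration_def
  by (intro conjI allI ballI filt_subspace smult_filt filt_mono iffD2[OF filt_Un_iff assms]) simp_all

lemma filt_fin_dim:
  assumes "finite X" and fd: "fin_dim_filtration K A F"
  shows "fin_dim_subspace K (filt X n) V"
proof -
  have "\<exists>B. \<forall>i. finite (B i) \<and> B i \<subseteq> F i \<and> AK.span (B i) = F i"
  proof (intro choice allI)
    fix i
    have "fin_dim_subspace K (F i) A" using fd by (simp add: fin_dim_filtration_def)
    then obtain S where "finite S" "S \<subseteq> F i" "AK.span S = F i"
      by (rule fin_dim_subspace_ex_span[OF AK.vectorspace_axioms])
    then show "\<exists>S. finite S \<and> S \<subseteq> F i \<and> AK.span S = F i" by blast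
  qed
  then obtain B where B: "\<And>i. finite (B i)" "\<And>i. B i \<subseteq> F i" "\<And>i. AK.span (B i) = F i" by auto
  \<comment> \<open>Finite spanning sets of the spaces \<open>F (n - i)\<close>, multiplied with the
    finitely many generators, span a space containing the term.\<close>
  define S where "S = (\<Union>(i, x)\<in>X. (\<lambda>b. b \<odot>\<^bsub>M\<^esub> x) ` B (n - i))"
  have S: "S \<subseteq> carrier M" "finite S"
    unfolding S_def using assms(1) B(1) B(2) X by (auto intro!: L.smult_closed F_carrier)
  have sub: "VectorSpace.subspace K (V.span S) V" using S by (intro V.span_is_subspace) simp
  have "filt X n \<subseteq> V.span S"
  proof (rule filt_subset[OF sub])
    fix b i x assume *: "(i, x) \<in> X" "i \<le> n" "b \<in> F (n - i)"
    show "b \<odot>\<^bsub>M\<^esub> x \<in> V.span S"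
    proof (rule span_smult_in[OF _ sub])
      show "B (n - i) \<subseteq> carrier A" using B(2) F(1) by blast
      show "b \<in> AK.span (B (n - i))" using B(3) * by simp
      show "b \<odot>\<^bsub>M\<^esub> x \<in> V.span S" if "b \<in> B (n - i)" for b
        using that *(1) V.in_own_span[of S] S(1) unfolding S_def by auto
    qed (use * X in auto)
  qed
  moreover have "fin_dim_subspace K (V.span S) V"
    using S by (intro fin_dim_subspace_span V.vectorspace_axioms) auto
  ultimately show ?thesis
    using fin_dim_subspace_mono(1)[OF V.vectorspace_axioms] filt_subspace by blast
qed

end

text \<open>Finitely many elements of \<open>M\<close> lie in one term \<open>filt Y q\<close>, and
  acting by \<open>F (n - i)\<close> moves that term by at most \<open>n\<close>. Finiteness of
  \<open>X\<close> makes the shift uniform.\<close>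

lemma filt_shift:
  assumes X: "finite X" "X \<subseteq> UNIV \<times> carrier M" and Y: "Y \<subseteq> UNIV \<times> carrier M"
    and gen: "generated_submodule A M (snd ` Y) = carrier M"
  shows "\<exists>q. \<forall>n. filt X n \<subseteq> filt Y (n + q)"
proof -
  have "\<exists>q. \<forall>(i, x)\<in>X. x \<in> filt Y q" using X
  proof (induction X rule: finite_induct)
    case (insert p X)
    obtain q where q: "\<forall>(i, x)\<in>X. x \<in> filt Y q" using insert by auto
    obtain i x where p: "p = (i, x)" by (cases p)
    have "x \<in> carrier M" using insert.prems p by auto
    then obtain r where "x \<in> filt Y r" using filt_Un_iff[OF Y] gen by blast
    then have "\<forall>(i, x)\<in>insert p X. x \<in> filt Y (max q r)"
      using q filt_mono[OF Y, of q "max q r"] filt_mono[OF Y, of r "max q r"] p by auto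
    then show ?case by blast
  qed auto
  then obtain q where q: "\<forall>(i, x)\<in>X. x \<in> filt Y q" by auto
  have "filt X n \<subseteq> filt Y (n + q)" for n
  proof (rule filt_subset[OF X(2) filt_subspace[OF Y]])
    fix b i x assume "(i, x) \<in> X" "i \<le> n" "b \<in> F (n - i)"
    then have "b \<odot>\<^bsub>M\<^esub> x \<in> filt Y (n - i + q)" using smult_filt[OF Y, of b "n - i" x q] q by auto
    then show "b \<odot>\<^bsub>M\<^esub> x \<in> filt Y (n + q)" using filt_mono[OF Y, of "n - i + q" "n + q"] by auto
  qed
  then show ?thesis by blast
qed

end

section \<open>Associated graded groups\<close>

locale filtered_group = abelian_group G for G :: "('v, 'r) ring_scheme" (structure) +
  fixes \<Omega> :: "nat \<Rightarrow> 'v set"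
  assumes filt_subgroup: "additive_subgroup (\<Omega> n) G" and filt_Suc: "\<Omega> n \<subseteq> \<Omega> (Suc n)"
begin

abbreviation pre :: "nat \<Rightarrow> 'v set" where "pre \<equiv> preceding G \<Omega>"

lemma filt_carrier: "x \<in> \<Omega> n \<Longrightarrow> x \<in> carrier G"
  using additive_subgroup.a_subset[OF filt_subgroup] by auto

lemma filt_zero: "\<zero> \<in> \<Omega> n"
  by (rule additive_subgroup.zero_closed[OF filt_subgroup])

lemma pre_subset: "pre n \<subseteq> \<Omega> n"
  using filt_Suc filt_zero by (cases n) auto

lemma pre_subgroup: "additive_subgroup (pre n) G"
proof (cases n)
  case 0
  then show ?thesis by (auto intro!: additive_subgroupI add.subgroupI)
qed (simp add: filt_subgroup)

sublocale pre: abelian_subgroup "pre n" G for n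
  by (rule abelian_subgroupI3[OF pre_subgroup]) (rule abelian_group_axioms)

text \<open>Computations in the associated graded group are carried out on sequences of
  representatives, one for each degree, which this map turns into cosets.\<close>

definition gr_class :: "(nat \<Rightarrow> 'v) \<Rightarrow> nat \<Rightarrow> 'v set" where
  "gr_class x = (\<lambda>n. pre n +> x n)"

lemma coset_eq_iff:
  assumes "x \<in> carrier G" "y \<in> carrier G"
  shows "pre n +> x = pre n +> y \<longleftrightarrow> x \<ominus> y \<in> pre n"
  using pre.a_rcos_module[OF assms(2,1)] pre.a_rcos_self[OF assms(1)]
    a_repr_independence[OF _ assms(2) pre_subgroup[unfolded additive_subgroup_def]]
  by (metis a_minus_def)

lemma mem_coset_iff:
  assumes "x \<in> carrier G"
  shows "y \<in> pre n +> x \<longleftrightarrow> y \<in> carrier G \<and> y \<ominus> x \<in> pre n"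
proof
  assume y: "y \<in> pre n +> x"
  then have "y \<in> carrier G" using pre.a_elemrcos_carrier[OF assms] by simp
  then show "y \<in> carrier G \<and> y \<ominus> x \<in> pre n"
    using pre.a_rcos_module[OF assms] y by (simp add: a_minus_def)
next
  assume "y \<in> carrier G \<and> y \<ominus> x \<in> pre n"
  then show "y \<in> pre n +> x" using pre.a_rcos_module[OF assms] by (simp add: a_minus_def)
qed

lemma coset_zero: "x \<in> pre n \<Longrightarrow> pre n +> x = pre n"
  by (rule pre.a_rcos_const)

lemma gr_carrierE:
  assumes "f \<in> gr_carrier G \<Omega>"
  obtains x where "\<And>n. x n \<in> \<Omega> n" "\<And>n. x n \<in> carrier G"
    "finite {n. x n \<noteq> \<zero>}" "f = gr_class x"
proof -
  have f: "\<forall>n. \<exists>x\<in>\<Omega> n. f n = pre n +> x" "finite {n. f n \<noteq> pre n}"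
    using assms by (auto simp: gr_carrier_def)
  \<comment> \<open>Zero is chosen wherever the component is trivial, so that the sequence of
    representatives inherits finite support.\<close>
  have "\<exists>x. \<forall>n. x n \<in> \<Omega> n \<and> f n = pre n +> x n \<and> (f n = pre n \<longrightarrow> x n = \<zero>)"
  proof (intro choice allI)
    fix n
    show "\<exists>x. x \<in> \<Omega> n \<and> f n = pre n +> x \<and> (f n = pre n \<longrightarrow> x = \<zero>)"
      using f(1) filt_zero[of n] coset_zero[of \<zero> n] by (cases "f n = pre n") auto
  qed
  then obtain x where x: "\<And>n. x n \<in> \<Omega> n" "\<And>n. f n = pre n +> x n" "\<And>n. f n = pre n \<Longrightarrow> x n = \<zero>"
    by blast
  have "finite {n. x n \<noteq> \<zero>}"
    by (rule finite_subset[OF _ f(2)]) (use x(3) in auto)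
  moreover have "f = gr_class x" using x(2) by (auto simp: gr_class_def)
  ultimately show thesis using that[of x] x(1) filt_carrier by blast
qed

lemma gr_class_in_carrier:
  assumes "\<And>n. x n \<in> \<Omega> n" "finite {n. x n \<noteq> \<zero>}"
  shows "gr_class x \<in> gr_carrier G \<Omega>"
proof -
  have "finite {n. gr_class x n \<noteq> pre n}"
    by (rule finite_subset[OF _ assms(2)]) (auto simp: gr_class_def coset_zero)
  then show ?thesis using assms(1) by (auto simp: gr_carrier_def gr_class_def)
qed

lemma gr_class_zero: "gr_class (\<lambda>_. \<zero>) = pre"
  by (auto simp: gr_class_def coset_zero)

lemma gr_add_class:
  assumes "\<And>n. x n \<in> carrier G" "\<And>n. y n \<in> carrier G"
  shows "gr_add G (gr_class x) (gr_class y) = gr_class (\<lambda>n. x n \<oplus> y n)"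
  using assms by (simp add: gr_add_def gr_class_def pre.a_rcos_sum)

text \<open>\<open>C\<close> is a union of cosets of the preceding term, so one representative
  decides. This allows subobjects of the graded group to be described by subgroups of
  \<open>G\<close>.\<close>

lemma gr_class_subset_iff:
  assumes "additive_subgroup C G" "pre n \<subseteq> C" "x n \<in> carrier G"
  shows "gr_class x n \<subseteq> C \<longleftrightarrow> x n \<in> C"
proof
  assume "gr_class x n \<subseteq> C"
  then show "x n \<in> C" using assms(3) by (auto simp: gr_class_def mem_coset_iff a_minus_def r_neg)
next
  interpret C: additive_subgroup C G by (rule assms(1))
  assume x: "x n \<in> C"
  show "gr_class x n \<subseteq> C"
  proof
    fix y assume "y \<in> gr_class x n"
    then have y: "y \<in> carrier G" "y \<ominus> x n \<in> pre n"
      using assms(3) by (auto simp: gr_class_def mem_coset_iff)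
    then have "(y \<ominus> x n) \<oplus> x n \<in> C" using x assms(2) by auto
    then show "y \<in> C" using y(1) assms(3) by (simp add: a_minus_def a_assoc l_neg)
  qed
qed

lemma gr_add_in_carrier:
  assumes "f \<in> gr_carrier G \<Omega>" "g \<in> gr_carrier G \<Omega>"
  shows "gr_add G f g \<in> gr_carrier G \<Omega>"
proof -
  obtain x where x: "\<And>n. x n \<in> \<Omega> n" "\<And>n. x n \<in> carrier G"
      "finite {n. x n \<noteq> \<zero>}" "f = gr_class x"
    using gr_carrierE[OF assms(1)] by blast
  obtain y where y: "\<And>n. y n \<in> \<Omega> n" "\<And>n. y n \<in> carrier G"
      "finite {n. y n \<noteq> \<zero>}" "g = gr_class y"
    using gr_carrierE[OF assms(2)] by blast
  have "finite {n. x n \<oplus> y n \<noteq> \<zero>}"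
    by (rule finite_subset[OF _ finite_UnI[OF x(3) y(3)]]) (use x(2) y(2) in auto)
  then have "gr_class (\<lambda>n. x n \<oplus> y n) \<in> gr_carrier G \<Omega>"
    using x(1) y(1) by (intro gr_class_in_carrier additive_subgroup.a_closed[OF filt_subgroup])
  then show ?thesis using x y by (simp add: gr_add_class)
qed

lemma gr_add_comm_monoid:
  assumes "f \<in> gr_carrier G \<Omega>" "g \<in> gr_carrier G \<Omega>" "h \<in> gr_carrier G \<Omega>"
  shows "gr_add G f g = gr_add G g f"
    and "gr_add G (gr_add G f g) h = gr_add G f (gr_add G g h)"
    and "gr_add G pre f = f"
    and "\<exists>f'\<in>gr_carrier G \<Omega>. gr_add G f' f = pre"
proof -
  obtain x where x: "\<And>n. x n \<in> \<Omega> n" "\<And>n. x n \<in> carrier G"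
      "finite {n. x n \<noteq> \<zero>}" "f = gr_class x"
    using gr_carrierE[OF assms(1)] by blast
  obtain y where y: "\<And>n. y n \<in> carrier G" "g = gr_class y"
    using gr_carrierE[OF assms(2)] by blast
  obtain z where z: "\<And>n. z n \<in> carrier G" "h = gr_class z"
    using gr_carrierE[OF assms(3)] by blast
  show "gr_add G f g = gr_add G g f"
    using x y by (simp add: gr_add_class a_comm)
  show "gr_add G (gr_add G f g) h = gr_add G f (gr_add G g h)"
    using x y z by (simp add: gr_add_class a_assoc)
  show "gr_add G pre f = f"
    using x by (subst gr_class_zero[symmetric]) (simp add: gr_add_class)
  have "finite {n. \<ominus> x n \<noteq> \<zero>}"
    by (rule finite_subset[OF _ x(3)]) auto
  then have "gr_class (\<lambda>n. \<ominus> x n) \<in> gr_carrier G \<Omega>"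
    using x(1) by (intro gr_class_in_carrier additive_subgroup.a_inv_closed[OF filt_subgroup])
  moreover have "gr_add G (gr_class (\<lambda>n. \<ominus> x n)) f = pre"
    using x by (subst gr_class_zero[symmetric]) (simp add: gr_add_class l_neg)
  ultimately show "\<exists>f'\<in>gr_carrier G \<Omega>. gr_add G f' f = pre" by blast
qed

lemma preceding_in_gr_carrier: "pre \<in> gr_carrier G \<Omega>"
  using gr_class_in_carrier[of "\<lambda>_. \<zero>"] filt_zero gr_class_zero by simp

end

section \<open>Graded products\<close>

lemma (in abelian_group) finsum_diff_mem:
  assumes "additive_subgroup H G" "finite I"
    and "\<And>i. i \<in> I \<Longrightarrow> f i \<in> carrier G" "\<And>i. i \<in> I \<Longrightarrow> g i \<in> carrier G"
    and "\<And>i. i \<in> I \<Longrightarrow> f i \<ominus>\<^bsub>G\<^esub> g i \<in> H"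
  shows "(\<Oplus>\<^bsub>G\<^esub>i\<in>I. f i) \<ominus>\<^bsub>G\<^esub> (\<Oplus>\<^bsub>G\<^esub>i\<in>I. g i) \<in> H"
  using assms(2-5)
proof (induction I rule: finite_induct)
  case empty
  have "\<zero>\<^bsub>G\<^esub> \<ominus>\<^bsub>G\<^esub> \<zero>\<^bsub>G\<^esub> = \<zero>\<^bsub>G\<^esub>" by (simp add: a_minus_def r_neg del: minus_zero)
  then show ?case using additive_subgroup.zero_closed[OF assms(1)] by (simp only: finsum_empty)
next
  case (insert i I)
  have c: "f \<in> I \<rightarrow> carrier G" "g \<in> I \<rightarrow> carrier G" using insert by auto
  let ?s = "\<Oplus>\<^bsub>G\<^esub>i\<in>I. f i" and ?t = "\<Oplus>\<^bsub>G\<^esub>i\<in>I. g i"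
  have "f i \<oplus>\<^bsub>G\<^esub> ?s \<ominus>\<^bsub>G\<^esub> (g i \<oplus>\<^bsub>G\<^esub> ?t) = (f i \<ominus>\<^bsub>G\<^esub> g i) \<oplus>\<^bsub>G\<^esub> (?s \<ominus>\<^bsub>G\<^esub> ?t)"
    using c insert.prems by (simp add: a_minus_def minus_add a_ac)
  moreover have "\<dots> \<in> H"
    using insert by (intro additive_subgroup.a_closed[OF assms(1)]) auto
  ultimately show ?case using c insert by simp
qed

lemma (in abelian_group) finsum_mem:
  assumes "additive_subgroup H G" "finite I" "\<And>i. i \<in> I \<Longrightarrow> f i \<in> H"
  shows "(\<Oplus>\<^bsub>G\<^esub>i\<in>I. f i) \<in> H"
  using assms(2,3)
proof (induction I rule: finite_induct)
  case (insert i I)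
  then have "f \<in> insert i I \<rightarrow> carrier G" using additive_subgroup.a_subset[OF assms(1)] by auto
  then show ?case using insert additive_subgroup.a_closed[OF assms(1)] by simp
qed (use additive_subgroup.zero_closed[OF assms(1)] in simp)

text \<open>One setting for both the multiplication of gr A and its action on gr M: \<open>m\<close>
  is biadditive and adds filtration degrees.\<close>

locale filtered_pairing = G1: filtered_group G1 F + G2: filtered_group G2 \<Omega>
  for G1 :: "('x, 'r) ring_scheme" and F and G2 :: "('v, 's) ring_scheme" and \<Omega> +
  fixes m :: "'x \<Rightarrow> 'v \<Rightarrow> 'v"
  assumes m_closed: "a \<in> carrier G1 \<Longrightarrow> x \<in> carrier G2 \<Longrightarrow> m a x \<in> carrier G2"
    and m_add_left: "a \<in> carrier G1 \<Longrightarrow> b \<in> carrier G1 \<Longrightarrow> x \<in> carrier G2 \<Longrightarrow>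
      m (a \<oplus>\<^bsub>G1\<^esub> b) x = m a x \<oplus>\<^bsub>G2\<^esub> m b x"
    and m_add_right: "a \<in> carrier G1 \<Longrightarrow> x \<in> carrier G2 \<Longrightarrow> y \<in> carrier G2 \<Longrightarrow>
      m a (x \<oplus>\<^bsub>G2\<^esub> y) = m a x \<oplus>\<^bsub>G2\<^esub> m a y"
    and m_filt: "a \<in> F i \<Longrightarrow> x \<in> \<Omega> j \<Longrightarrow> m a x \<in> \<Omega> (i + j)"
begin

lemma m_zero_left: "x \<in> carrier G2 \<Longrightarrow> m \<zero>\<^bsub>G1\<^esub> x = \<zero>\<^bsub>G2\<^esub>"
  using m_add_left[of "\<zero>\<^bsub>G1\<^esub>" "\<zero>\<^bsub>G1\<^esub>" x] m_closed[of "\<zero>\<^bsub>G1\<^esub>" x] G2.add.l_cancel_one' by simp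

lemma m_zero_right: "a \<in> carrier G1 \<Longrightarrow> m a \<zero>\<^bsub>G2\<^esub> = \<zero>\<^bsub>G2\<^esub>"
  using m_add_right[of a "\<zero>\<^bsub>G2\<^esub>" "\<zero>\<^bsub>G2\<^esub>"] m_closed[of a "\<zero>\<^bsub>G2\<^esub>"] G2.add.l_cancel_one' by simp

lemma m_minus_left: "a \<in> carrier G1 \<Longrightarrow> x \<in> carrier G2 \<Longrightarrow> m (\<ominus>\<^bsub>G1\<^esub> a) x = \<ominus>\<^bsub>G2\<^esub> m a x"
  using m_add_left[of "\<ominus>\<^bsub>G1\<^esub> a" a x]
  by (intro G2.minus_equality[symmetric]) (simp_all add: G1.l_neg m_zero_left m_closed)

lemma m_minus_right: "a \<in> carrier G1 \<Longrightarrow> x \<in> carrier G2 \<Longrightarrow> m a (\<ominus>\<^bsub>G2\<^esub> x) = \<ominus>\<^bsub>G2\<^esub> m a x"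
  using m_add_right[of a "\<ominus>\<^bsub>G2\<^esub> x" x]
  by (intro G2.minus_equality[symmetric]) (simp_all add: G2.l_neg m_zero_right m_closed)

lemma m_pre_left: "a \<in> preceding G1 F i \<Longrightarrow> x \<in> \<Omega> j \<Longrightarrow> m a x \<in> preceding G2 \<Omega> (i + j)"
  by (cases i) (auto simp: m_zero_left G2.filt_carrier m_filt)

lemma m_pre_right: "a \<in> F i \<Longrightarrow> x \<in> preceding G2 \<Omega> j \<Longrightarrow> m a x \<in> preceding G2 \<Omega> (i + j)"
  by (cases j) (auto simp: m_zero_right G1.filt_carrier m_filt)

text \<open>The difference splits as m a' (x' - x) + m (a' - a) x, and in each summand one factor
  comes from a preceding term.\<close>

lemma m_congruent:
  assumes "a \<in> F i" "a' \<in> F i" "a' \<ominus>\<^bsub>G1\<^esub> a \<in> preceding G1 F i"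
    and "x \<in> \<Omega> j" "x' \<in> \<Omega> j" "x' \<ominus>\<^bsub>G2\<^esub> x \<in> preceding G2 \<Omega> j"
  shows "m a' x' \<ominus>\<^bsub>G2\<^esub> m a x \<in> preceding G2 \<Omega> (i + j)"
proof -
  note c = G1.filt_carrier[OF assms(1)] G1.filt_carrier[OF assms(2)]
    G2.filt_carrier[OF assms(4)] G2.filt_carrier[OF assms(5)]
  have "m a' x' \<ominus>\<^bsub>G2\<^esub> m a x = m a' (x' \<ominus>\<^bsub>G2\<^esub> x) \<oplus>\<^bsub>G2\<^esub> m (a' \<ominus>\<^bsub>G1\<^esub> a) x"
    using c by (simp add: a_minus_def m_add_left m_add_right m_minus_left m_minus_right m_closed
        G2.a_assoc G2.r_neg1 G2.r_neg2)
  moreover have "\<dots> \<in> preceding G2 \<Omega> (i + j)"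
    using assms by (intro G2.pre.a_closed m_pre_left m_pre_right)
  ultimately show ?thesis by simp
qed

abbreviation conv :: "(nat \<Rightarrow> 'x) \<Rightarrow> (nat \<Rightarrow> 'v) \<Rightarrow> nat \<Rightarrow> 'v" where
  "conv a x \<equiv> (\<lambda>n. \<Oplus>\<^bsub>G2\<^esub>i\<in>{..n}. m (a i) (x (n - i)))"

text \<open>\<open>gr_prod\<close> is a union over all choices of representatives. All choices are
  congruent degree by degree and yield the same coset by \<open>m_congruent\<close>, so the union is
  that single coset.\<close>

lemma gr_prod_class:
  assumes a: "\<And>n. a n \<in> F n" and x: "\<And>n. x n \<in> \<Omega> n"
  shows "gr_prod m G2 \<Omega> (G1.gr_class a) (G2.gr_class x) = G2.gr_class (conv a x)"
proof
  fix n
  have mc: "m (b i) (y j) \<in> carrier G2"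
    if "\<And>n. b n \<in> F n" "\<And>n. y n \<in> \<Omega> n" for b y i j
    using that(1)[of i] that(2)[of j] by (intro m_closed G1.filt_carrier G2.filt_carrier)
  have ac: "a i \<in> carrier G1" and xc: "x i \<in> carrier G2" for i
    using a x G1.filt_carrier G2.filt_carrier by blast+
  have "preceding G2 \<Omega> n +>\<^bsub>G2\<^esub> conv b y n = preceding G2 \<Omega> n +>\<^bsub>G2\<^esub> conv a x n"
    if b: "b \<in> Pi UNIV (G1.gr_class a)" and y: "y \<in> Pi UNIV (G2.gr_class x)" for b y
  proof -
    have bi: "b i \<in> G1.gr_class a i" and yi: "y i \<in> G2.gr_class x i" for i using b y by auto
    have b1: "b i \<in> F i" for i
      using bi[of i] G1.gr_class_subset_iff[OF G1.filt_subgroup G1.pre_subset, where x = a, OF ac] a by blast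
    have y1: "y i \<in> \<Omega> i" for i
      using yi[of i] G2.gr_class_subset_iff[OF G2.filt_subgroup G2.pre_subset, where x = x, OF xc] x by blast
    have b2: "b i \<ominus>\<^bsub>G1\<^esub> a i \<in> preceding G1 F i" for i
      using bi[of i] by (simp add: G1.gr_class_def G1.mem_coset_iff ac)
    have y2: "y i \<ominus>\<^bsub>G2\<^esub> x i \<in> preceding G2 \<Omega> i" for i
      using yi[of i] by (simp add: G2.gr_class_def G2.mem_coset_iff xc)
    have "m (b i) (y (n - i)) \<ominus>\<^bsub>G2\<^esub> m (a i) (x (n - i)) \<in> preceding G2 \<Omega> n" if "i \<le> n" for i
      using m_congruent[OF a b1 b2 x y1 y2, of i "n - i"] that by simp
    then have "conv b y n \<ominus>\<^bsub>G2\<^esub> conv a x n \<in> preceding G2 \<Omega> n"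
      by (intro G2.finsum_diff_mem G2.pre_subgroup) (simp_all add: mc a b1 x y1)
    then show ?thesis by (subst G2.coset_eq_iff) (simp_all add: mc a b1 x y1)
  qed
  \<comment> \<open>The given sequences are themselves admissible choices, so the union is not
    empty.\<close>
  moreover have "a \<in> Pi UNIV (G1.gr_class a)" "x \<in> Pi UNIV (G2.gr_class x)"
    by (simp_all add: G1.gr_class_def G1.pre.a_rcos_self ac G2.gr_class_def G2.pre.a_rcos_self xc)
  ultimately show "gr_prod m G2 \<Omega> (G1.gr_class a) (G2.gr_class x) n = G2.gr_class (conv a x) n"
    unfolding gr_prod_def G2.gr_class_def by blast
qed

text \<open>Stated for an arbitrary family \<open>C\<close> of subgroups, so that it serves the
  filtration itself as well as the smaller families inside it.\<close>

lemma conv_in_filt: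
  assumes "\<And>i j. m (a i) (x j) \<in> C (i + j)" "\<And>n. additive_subgroup (C n) G2"
  shows "conv a x n \<in> C n"
proof (rule G2.finsum_mem[OF assms(2)])
  fix i assume "i \<in> {..n}"
  then show "m (a i) (x (n - i)) \<in> C n" using assms(1)[of i "n - i"] by simp
qed simp

lemma gr_prod_in_carrier:
  assumes "f \<in> gr_carrier G1 F" "g \<in> gr_carrier G2 \<Omega>"
  shows "gr_prod m G2 \<Omega> f g \<in> gr_carrier G2 \<Omega>"
proof -
  obtain a where a: "\<And>n. a n \<in> F n" "\<And>n. a n \<in> carrier G1" "finite {n. a n \<noteq> \<zero>\<^bsub>G1\<^esub>}" "f = G1.gr_class a"
    using G1.gr_carrierE[OF assms(1)] by blast
  obtain x where x: "\<And>n. x n \<in> \<Omega> n" "\<And>n. x n \<in> carrier G2" "finite {n. x n \<noteq> \<zero>\<^bsub>G2\<^esub>}" "g = G2.gr_class x"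
    using G2.gr_carrierE[OF assms(2)] by blast
  obtain p where p: "\<And>n. a n \<noteq> \<zero>\<^bsub>G1\<^esub> \<Longrightarrow> n < p" using a(3) by (auto simp: finite_nat_set_iff_bounded)
  obtain q where q: "\<And>n. x n \<noteq> \<zero>\<^bsub>G2\<^esub> \<Longrightarrow> n < q" using x(3) by (auto simp: finite_nat_set_iff_bounded)
  \<comment> \<open>For an index \<open>n\<close> this large, \<open>i < p\<close> forces
    \<open>n - i \<ge> q\<close>, so in every term one of the two factors vanishes.\<close>
  have "conv a x n = \<zero>\<^bsub>G2\<^esub>" if "n \<ge> p + q" for n
  proof -
    have "m (a i) (x (n - i)) = \<zero>\<^bsub>G2\<^esub>" for i
    proof (cases "i < p")
      case True
      then have "x (n - i) = \<zero>\<^bsub>G2\<^esub>" using q[of "n - i"] that by linarith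
      then show ?thesis using a(2) by (simp add: m_zero_right)
    next
      case False
      then have "a i = \<zero>\<^bsub>G1\<^esub>" using p[of i] by auto
      then show ?thesis using x(2) by (simp add: m_zero_left)
    qed
    then show ?thesis by simp
  qed
  then have "{n. conv a x n \<noteq> \<zero>\<^bsub>G2\<^esub>} \<subseteq> {..<p + q}" by (auto simp: not_le[symmetric])
  then have "finite {n. conv a x n \<noteq> \<zero>\<^bsub>G2\<^esub>}" by (rule finite_subset) simp
  moreover have "conv a x n \<in> \<Omega> n" for n
    using a(1) x(1) by (intro conv_in_filt m_filt G2.filt_subgroup)
  ultimately show ?thesis
    unfolding a(4) x(4) gr_prod_class[OF a(1) x(1)] by (intro G2.gr_class_in_carrier)
qed

end

section \<open>Homogeneous elements and good filtrations\<close>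

lemma regular_module_simps [simp]:
  "carrier (regular_module R) = carrier R" "\<zero>\<^bsub>regular_module R\<^esub> = \<zero>\<^bsub>R\<^esub>"
  "x \<oplus>\<^bsub>regular_module R\<^esub> y = x \<oplus>\<^bsub>R\<^esub> y" "a \<odot>\<^bsub>regular_module R\<^esub> x = a \<otimes>\<^bsub>R\<^esub> x"
  by (simp_all add: regular_module_def)

lemma regular_left_module:
  assumes "ring R"
  shows "left_module R (regular_module R)"
proof -
  interpret ring R by (rule assms)
  have "abelian_group (regular_module R)"
    by (rule abelian_groupI) (auto simp: a_ac intro!: bexI[of _ "\<ominus>\<^bsub>R\<^esub> _"] l_neg)
  then show ?thesis
    by (intro left_module.intro left_module_axioms.intro assms)
      (simp_all add: l_distr r_distr m_assoc)
qed

text \<open>The regular module makes the facts on submodules and filtrations available for left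
  ideals, of A and of gr A alike.\<close>

lemma regular_algebra_module:
  assumes "assoc_algebra K A"
  shows "algebra_module K A (regular_module A)"
  using assms by (auto simp: algebra_module_def assoc_algebra_def intro: regular_left_module)

lemma gr_algebra_simps [simp]:
  "carrier (gr_algebra A F) = gr_carrier A F" "\<zero>\<^bsub>gr_algebra A F\<^esub> = preceding A F"
  "f \<oplus>\<^bsub>gr_algebra A F\<^esub> g = gr_add A f g" "f \<otimes>\<^bsub>gr_algebra A F\<^esub> g = gr_prod (mult A) A F f g"
  by (simp_all add: gr_algebra_def)

lemma gr_module_simps [simp]:
  "carrier (gr_module M \<Omega>) = gr_carrier M \<Omega>" "\<zero>\<^bsub>gr_module M \<Omega>\<^esub> = preceding M \<Omega>"
  "f \<oplus>\<^bsub>gr_module M \<Omega>\<^esub> g = gr_add M f g" "r \<odot>\<^bsub>gr_module M \<Omega>\<^esub> g = gr_prod (smult M) M \<Omega> r g"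
  by (simp_all add: gr_module_def)

context filtered_group
begin

abbreviation hom_seq :: "nat \<Rightarrow> 'v \<Rightarrow> nat \<Rightarrow> 'v" where
  "hom_seq i x \<equiv> (\<lambda>n. if n = i then x else \<zero>)"

lemma hom_class_in_carrier: "x \<in> \<Omega> i \<Longrightarrow> gr_class (hom_seq i x) \<in> gr_carrier G \<Omega>"
  by (rule gr_class_in_carrier) (auto simp: filt_zero)

lemma hom_class_subset_iff:
  assumes "\<And>n. additive_subgroup (C n) G" "\<And>n. pre n \<subseteq> C n" "x \<in> carrier G"
  shows "(\<forall>n. gr_class (hom_seq i x) n \<subseteq> C n) \<longleftrightarrow> x \<in> C i"
  using assms additive_subgroup.zero_closed[OF assms(1)] by (auto simp: gr_class_subset_iff)

lemma gr_abelian_groupI: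
  assumes "carrier H = gr_carrier G \<Omega>" "\<zero>\<^bsub>H\<^esub> = pre" "\<And>f g. f \<oplus>\<^bsub>H\<^esub> g = gr_add G f g"
  shows "abelian_group H"
proof (rule abelian_groupI)
  fix f assume "f \<in> carrier H"
  then show "\<exists>g\<in>carrier H. g \<oplus>\<^bsub>H\<^esub> f = \<zero>\<^bsub>H\<^esub>"
    using gr_add_comm_monoid(4)[of f f f] by (simp add: assms)
qed (simp_all add: assms gr_add_in_carrier gr_add_comm_monoid(2,3) preceding_in_gr_carrier,
    rule gr_add_comm_monoid(1))

text \<open>Every element is a finite sum of homogeneous classes; the sum is built up over the
  finite support of a sequence of representatives.\<close>

lemma gr_carrier_induct [consumes 1, case_names zero add]:
  assumes "f \<in> gr_carrier G \<Omega>" "P pre"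
    and "\<And>i x g. x \<in> \<Omega> i \<Longrightarrow> g \<in> gr_carrier G \<Omega> \<Longrightarrow> P g \<Longrightarrow> P (gr_add G (gr_class (hom_seq i x)) g)"
  shows "P f"
proof -
  obtain x where x: "\<And>n. x n \<in> \<Omega> n" "\<And>n. x n \<in> carrier G" "finite {n. x n \<noteq> \<zero>}" "f = gr_class x"
    using gr_carrierE[OF assms(1)] by blast
  let ?x = "\<lambda>T n. if n \<in> T then x n else \<zero>"
  have "P (gr_class (?x T)) \<and> gr_class (?x T) \<in> gr_carrier G \<Omega>" if "finite T" for T
    using that
  proof (induction T rule: finite_induct)
    case empty
    then show ?case using assms(2) preceding_in_gr_carrier by (simp add: gr_class_zero)
  next
    case (insert i T)
    have "?x (insert i T) = (\<lambda>n. hom_seq i (x i) n \<oplus> ?x T n)"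
      using insert.hyps x(2) by auto
    then have "gr_class (?x (insert i T)) = gr_add G (gr_class (hom_seq i (x i))) (gr_class (?x T))"
      using x(2) by (simp add: gr_add_class)
    then show ?case
      using insert assms(3)[OF x(1)] hom_class_in_carrier[OF x(1)] by (simp add: gr_add_in_carrier)
  qed
  moreover have "?x {n. x n \<noteq> \<zero>} = x" by auto
  ultimately show ?thesis using x(3,4) by metis
qed

end

text \<open>In the convolution at most the term \<open>k = i\<close> survives, and it does so in
  degree \<open>i + j\<close> alone.\<close>

lemma (in filtered_pairing) gr_prod_hom:
  assumes "a \<in> F i" "x \<in> \<Omega> j"
  shows "gr_prod m G2 \<Omega> (G1.gr_class (G1.hom_seq i a)) (G2.gr_class (G2.hom_seq j x))
    = G2.gr_class (G2.hom_seq (i + j) (m a x))"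
proof -
  note c = G1.filt_carrier[OF assms(1)] G2.filt_carrier[OF assms(2)]
  have "conv (G1.hom_seq i a) (G2.hom_seq j x) n = G2.hom_seq (i + j) (m a x) n" for n
  proof -
    have "conv (G1.hom_seq i a) (G2.hom_seq j x) n =
      (\<Oplus>\<^bsub>G2\<^esub>k\<in>{..n}. if i = k then (if n = i + j then m a x else \<zero>\<^bsub>G2\<^esub>) else \<zero>\<^bsub>G2\<^esub>)"
      using c by (intro G2.finsum_cong') (auto simp: m_zero_left m_zero_right m_closed)
    also have "\<dots> = G2.hom_seq (i + j) (m a x) n"
    proof (cases "i \<le> n")
      case True
      then show ?thesis
        using c by (subst G2.finsum_singleton) (auto simp: m_closed)
    next
      case False
      then have "(\<Oplus>\<^bsub>G2\<^esub>k\<in>{..n}. if i = k then (if n = i + j then m a x else \<zero>\<^bsub>G2\<^esub>) else \<zero>\<^bsub>G2\<^esub>)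
          = (\<Oplus>\<^bsub>G2\<^esub>k\<in>{..n}. \<zero>\<^bsub>G2\<^esub>)"
        by (intro G2.finsum_cong') auto
      then show ?thesis using False by simp
    qed
    finally show ?thesis .
  qed
  moreover have "gr_prod m G2 \<Omega> (G1.gr_class (G1.hom_seq i a)) (G2.gr_class (G2.hom_seq j x))
      = G2.gr_class (conv (G1.hom_seq i a) (G2.hom_seq j x))"
    using assms by (intro gr_prod_class) (auto simp: G1.filt_zero G2.filt_zero)
  ultimately show ?thesis by (simp only:)
qed

context filtered_algebra_module
begin

sublocale GA: filtered_group A F
  using AK.subspaceD[OF F_subspace] F_Suc
  by unfold_locales (auto intro!: A.add.subgroupI simp: a_inv_def[symmetric])

text \<open>A spanning product b x of the term in degree \<open>n\<close>, with
  \<open>b \<in> F (n - i)\<close>, has as its class the product of the class of \<open>b\<close> in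
  degree \<open>n - i\<close> and the class of \<open>x\<close> in degree \<open>i\<close>. So the
  classes of the generators, each in its own degree, generate gr M.\<close>

lemma filt_good:
  assumes X: "X \<subseteq> UNIV \<times> carrier M" "finite X"
    and gen: "generated_submodule A M (snd ` X) = carrier M"
  shows "good_filtration K A F M (filt X)"
proof -
  note X' = X(1)
  interpret GM: filtered_group M "filt X"
    using filtD[OF X'] filt_mono[OF X', of n "Suc n" for n]
    by unfold_locales (auto intro!: M.add.subgroupI simp: a_inv_def[symmetric])
  interpret P: filtered_pairing A F M "filt X" "smult M"
    using smult_filt[OF X']
    by unfold_locales (auto simp: L.smult_closed L.smult_l_distr L.smult_r_distr)
  let ?R = "gr_algebra A F" and ?N = "gr_module M (filt X)"
  interpret N: abelian_group ?N by (rule GM.gr_abelian_groupI) simp_all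
  define h where "h i x = GM.gr_class (GM.hom_seq i x)" for i x
  have hc: "h i x \<in> gr_carrier M (filt X)" if "x \<in> filt X i" for i x
    using that GM.hom_class_in_carrier by (simp add: h_def)
  let ?S = "(\<lambda>(i, x). h i x) ` X"
  have S: "finite ?S" "?S \<subseteq> carrier ?N"
    using X(2) hc generator_in_filt[OF X'] by auto
  have all: "Module.submodule (carrier ?N) ?R ?N"
    using N.add.subgroup_self P.gr_prod_in_carrier
    by (simp add: Module.submodule_def Module.submodule_axioms_def)
  have "carrier ?N \<subseteq> Q" if Q: "Module.submodule Q ?R ?N" "?S \<subseteq> Q" for Q
  proof
    have sg: "subgroup Q (add_monoid ?N)" using Q(1) by (simp add: Module.submodule_def)
    have Qc: "Q \<subseteq> gr_carrier M (filt X)" using subgroup.subset[OF sg] by simp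
    have Qadd: "gr_add M f g \<in> Q" if "f \<in> Q" "g \<in> Q" for f g
      using subgroup.m_closed[OF sg that] by simp
    have Qsm: "gr_prod (smult M) M (filt X) f g \<in> Q" if "f \<in> gr_carrier A F" "g \<in> Q" for f g
      using Q(1) that by (simp add: Module.submodule_def Module.submodule_axioms_def)
    have Q0: "preceding M (filt X) \<in> Q" using subgroup.one_closed[OF sg] by simp
    have hsm: "h (i + j) (a \<odot>\<^bsub>M\<^esub> x) \<in> Q" if "a \<in> F i" "x \<in> filt X j" "h j x \<in> Q" for a x i j
    proof -
      have "gr_prod (smult M) M (filt X) (GA.gr_class (GA.hom_seq i a)) (h j x) \<in> Q"
        using that by (intro Qsm GA.hom_class_in_carrier)
      then show ?thesis using that by (simp add: h_def P.gr_prod_hom)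
    qed
    have hom: "h n y \<in> Q" if y: "y \<in> filt X n" for n y
    proof -
      \<comment> \<open>It suffices to treat spanning products once the elements whose degree
        \<open>n\<close> class lies in \<open>Q\<close> are known to form a subspace.\<close>
      have "VectorSpace.subspace K {y \<in> filt X n. h n y \<in> Q} V"
      proof (rule V.subspaceI)
        have "GM.hom_seq n \<zero>\<^bsub>M\<^esub> = (\<lambda>_. \<zero>\<^bsub>M\<^esub>)" by auto
        then have "h n \<zero>\<^bsub>M\<^esub> \<in> Q" using Q0 by (simp only: h_def GM.gr_class_zero)
        then show "\<zero>\<^bsub>V\<^esub> \<in> {y \<in> filt X n. h n y \<in> Q}" using filtD(2)[OF X'] by simp
        show "x \<oplus>\<^bsub>V\<^esub> y \<in> {y \<in> filt X n. h n y \<in> Q}"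
          if "x \<in> {y \<in> filt X n. h n y \<in> Q}" "y \<in> {y \<in> filt X n. h n y \<in> Q}" for x y
        proof -
          have c: "x \<in> carrier M" "y \<in> carrier M" using that filtD(1)[OF X'] by auto
          have "gr_add M (h n x) (h n y) = GM.gr_class (\<lambda>m. GM.hom_seq n x m \<oplus>\<^bsub>M\<^esub> GM.hom_seq n y m)"
            using c by (simp add: h_def GM.gr_add_class)
          also have "(\<lambda>m. GM.hom_seq n x m \<oplus>\<^bsub>M\<^esub> GM.hom_seq n y m) = GM.hom_seq n (x \<oplus>\<^bsub>M\<^esub> y)"
            by auto
          finally have "h n (x \<oplus>\<^bsub>M\<^esub> y) \<in> Q" using Qadd[of "h n x" "h n y"] that by (simp add: h_def)
          then show ?thesis using that filtD(3)[OF X'] by simp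
        qed
        \<comment> \<open>A scalar acts as the class of c 1 in degree 0 of gr A, so a submodule over
          gr A is closed under it.\<close>
        show "c \<odot>\<^bsub>V\<^esub> x \<in> {y \<in> filt X n. h n y \<in> Q}"
          if "c \<in> carrier K" "x \<in> {y \<in> filt X n. h n y \<in> Q}" for c x
          using that hsm[OF scalar_in_F, of c x n] filtD(4)[OF X'] by simp
      qed (use filtD(1)[OF X'] in auto)
      then have "filt X n \<subseteq> {y \<in> filt X n. h n y \<in> Q}"
      proof (rule filt_subset[OF X'])
        fix b i x assume *: "(i, x) \<in> X" "i \<le> n" "b \<in> F (n - i)"
        have "h (n - i + i) (b \<odot>\<^bsub>M\<^esub> x) \<in> Q"
          using * Q(2) by (intro hsm generator_in_filt[OF X']) auto
        then show "b \<odot>\<^bsub>M\<^esub> x \<in> {y \<in> filt X n. h n y \<in> Q}"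
          using * filt_memI[OF X'] by simp
      qed
      then show ?thesis using y by auto
    qed
    fix f assume "f \<in> carrier ?N"
    then have "f \<in> gr_carrier M (filt X)" by simp
    then show "f \<in> Q"
      by (induction rule: GM.gr_carrier_induct) (use Q0 Qadd hom in \<open>auto simp: h_def\<close>)
  qed
  then have "generated_submodule ?R ?N ?S = carrier ?N"
    unfolding generated_submodule_def using all S(2) by blast
  then have "finitely_generated_over ?R ?N"
    unfolding finitely_generated_over_def using S by blast
  then show ?thesis
    unfolding good_filtration_def using filt_module_filtration[OF X' gen] by simp
qed

end

section \<open>Families of subspaces and the associated graded algebra\<close>

locale filtered_algebra = assoc_algebra K A
  for K :: "'k ring" and A :: "('k, 'a) module" +
  fixes F :: "nat \<Rightarrow> 'a set"
  assumes algebra_filtration: "algebra_filtration K A F"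
begin

sublocale R: filtered_algebra_module K A "regular_module A" F
  using regular_algebra_module[OF assoc_algebra_axioms] algebra_filtration
  by (simp add: filtered_algebra_module_def filtered_algebra_module_axioms_def)

sublocale P: filtered_pairing A F A F "mult A"
  using R.F_mult by unfold_locales (auto simp: A.l_distr A.r_distr)

text \<open>Such a family stands for the homogeneous left ideal of gr A with components
  \<open>C n\<close> modulo the preceding term; because \<open>C n\<close> contains that term, it
  can be recovered from its cosets.\<close>

definition left_ideal_family :: "(nat \<Rightarrow> 'a set) \<Rightarrow> bool" where
  "left_ideal_family C \<longleftrightarrow>
    (\<forall>n. additive_subgroup (C n) A \<and> preceding A F n \<subseteq> C n \<and> C n \<subseteq> F n) \<and>
    (\<forall>i j. \<forall>a\<in>F i. \<forall>b\<in>C j. a \<otimes>\<^bsub>A\<^esub> b \<in> C (i + j))"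

definition gr_part :: "(nat \<Rightarrow> 'a set) \<Rightarrow> (nat \<Rightarrow> 'a set) set" where
  "gr_part C = {f \<in> gr_carrier A F. \<forall>n. f n \<subseteq> C n}"

lemma gr_partE:
  assumes "\<And>n. additive_subgroup (C n) A" "\<And>n. preceding A F n \<subseteq> C n" "f \<in> gr_part C"
  obtains x where "\<And>n. x n \<in> F n" "\<And>n. x n \<in> C n" "\<And>n. x n \<in> carrier A"
    "finite {n. x n \<noteq> \<zero>\<^bsub>A\<^esub>}" "f = R.GA.gr_class x"
proof -
  have f: "f \<in> gr_carrier A F" "\<And>n. f n \<subseteq> C n" using assms(3) by (auto simp: gr_part_def)
  obtain x where x: "\<And>n. x n \<in> F n" "\<And>n. x n \<in> carrier A"
    "finite {n. x n \<noteq> \<zero>\<^bsub>A\<^esub>}" "f = R.GA.gr_class x"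
    using R.GA.gr_carrierE[OF f(1)] by blast
  have "x n \<in> C n" for n
    using f(2)[of n] R.GA.gr_class_subset_iff[OF assms(1,2), where x = x, OF x(2)]
    by (simp add: x(4))
  then show thesis using that x by blast
qed

lemma gr_partI:
  assumes "\<And>n. additive_subgroup (C n) A" "\<And>n. preceding A F n \<subseteq> C n"
    and "\<And>n. x n \<in> F n" "\<And>n. x n \<in> C n" "finite {n. x n \<noteq> \<zero>\<^bsub>A\<^esub>}"
  shows "R.GA.gr_class x \<in> gr_part C"
proof -
  have "x n \<in> carrier A" for n using assms(3) R.GA.filt_carrier by blast
  then show ?thesis
    using R.GA.gr_class_in_carrier[OF assms(3,5)]
      R.GA.gr_class_subset_iff[OF assms(1,2), where x = x] assms(4)
    by (simp add: gr_part_def)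
qed

lemma hom_in_gr_part_iff:
  assumes "\<And>n. additive_subgroup (C n) A" "\<And>n. preceding A F n \<subseteq> C n" "a \<in> F i"
  shows "R.GA.gr_class (R.GA.hom_seq i a) \<in> gr_part C \<longleftrightarrow> a \<in> C i"
  using R.GA.hom_class_in_carrier[OF assms(3)]
    R.GA.hom_class_subset_iff[OF assms(1,2) R.F_carrier[OF assms(3)]]
  by (simp add: gr_part_def)

lemma gr_part_add:
  assumes "\<And>n. additive_subgroup (C n) A" "\<And>n. preceding A F n \<subseteq> C n"
    and "f \<in> gr_part C" "g \<in> gr_part C"
  shows "gr_add A f g \<in> gr_part C"
proof -
  obtain x where x: "\<And>n. x n \<in> F n" "\<And>n. x n \<in> C n" "\<And>n. x n \<in> carrier A"
    "finite {n. x n \<noteq> \<zero>\<^bsub>A\<^esub>}" "f = R.GA.gr_class x"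
    using gr_partE[OF assms(1-3)] by blast
  obtain y where y: "\<And>n. y n \<in> F n" "\<And>n. y n \<in> C n" "\<And>n. y n \<in> carrier A"
    "finite {n. y n \<noteq> \<zero>\<^bsub>A\<^esub>}" "g = R.GA.gr_class y"
    using gr_partE[OF assms(1,2,4)] by blast
  have "finite {n. x n \<oplus>\<^bsub>A\<^esub> y n \<noteq> \<zero>\<^bsub>A\<^esub>}"
    by (rule finite_subset[OF _ finite_UnI[OF x(4) y(4)]]) auto
  then show ?thesis
    unfolding x(5) y(5) R.GA.gr_add_class[OF x(3) y(3)]
    by (intro gr_partI assms(1,2) R.F(3) additive_subgroup.a_closed[OF assms(1)] x y)
qed

text \<open>Three families are allowed so that one argument covers left ideals, where the left
  factor ranges over all of \<open>F\<close>, and subalgebras, where the three coincide.\<close>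

lemma gr_part_mult:
  assumes "\<And>n. additive_subgroup (C n) A" "\<And>n. preceding A F n \<subseteq> C n"
    and "\<And>n. additive_subgroup (D n) A" "\<And>n. preceding A F n \<subseteq> D n"
    and "\<And>n. additive_subgroup (E n) A" "\<And>n. preceding A F n \<subseteq> E n"
    and CD: "\<And>i j a b. a \<in> C i \<Longrightarrow> b \<in> D j \<Longrightarrow> a \<otimes>\<^bsub>A\<^esub> b \<in> E (i + j)"
    and "f \<in> gr_part C" "g \<in> gr_part D"
  shows "gr_prod (mult A) A F f g \<in> gr_part E"
proof -
  obtain x where x: "\<And>n. x n \<in> F n" "\<And>n. x n \<in> C n" "\<And>n. x n \<in> carrier A"
    "finite {n. x n \<noteq> \<zero>\<^bsub>A\<^esub>}" "f = R.GA.gr_class x"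
    using gr_partE[OF assms(1,2,8)] by blast
  obtain y where y: "\<And>n. y n \<in> F n" "\<And>n. y n \<in> D n" "\<And>n. y n \<in> carrier A"
    "finite {n. y n \<noteq> \<zero>\<^bsub>A\<^esub>}" "g = R.GA.gr_class y"
    using gr_partE[OF assms(3,4,9)] by blast
  have "f \<in> gr_carrier A F" "g \<in> gr_carrier A F" using assms(8,9) by (auto simp: gr_part_def)
  then have c: "gr_prod (mult A) A F f g \<in> gr_carrier A F" by (rule P.gr_prod_in_carrier)
  have F: "P.conv x y n \<in> F n" for n by (intro P.conv_in_filt P.m_filt x y R.GA.filt_subgroup)
  have "P.conv x y n \<in> E n" for n by (intro P.conv_in_filt assms(5) CD x y)
  then have "R.GA.gr_class (P.conv x y) n \<subseteq> E n" for n
    using R.GA.gr_class_subset_iff[OF assms(5,6), where x = "P.conv x y"] R.F_carrier[OF F]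
    by blast
  then show ?thesis
    using c P.gr_prod_class[OF x(1) y(1)] by (simp add: gr_part_def x(5) y(5))
qed

lemma gr_part_F: "gr_part F = gr_carrier A F"
proof -
  have "f \<in> gr_part F" if "f \<in> gr_carrier A F" for f
    using that by (rule R.GA.gr_carrierE)
      (simp add: gr_partI R.GA.filt_subgroup R.GA.pre_subset)
  then show ?thesis by (auto simp: gr_part_def)
qed

lemma preceding_in_gr_part:
  assumes "\<And>n. preceding A F n \<subseteq> C n"
  shows "preceding A F \<in> gr_part C"
  using assms R.GA.preceding_in_gr_carrier by (simp add: gr_part_def)

lemma gr_part_left_ideal:
  assumes grA: "assoc_algebra K (gr_algebra A F)" and C: "left_ideal_family C"
  shows "Module.submodule (gr_part C) (gr_algebra A F) (regular_module (gr_algebra A F))"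
proof -
  interpret gr: algebra_module K "gr_algebra A F" "regular_module (gr_algebra A F)"
    by (rule regular_algebra_module[OF grA])
  have C': "\<And>n. additive_subgroup (C n) A" "\<And>n. preceding A F n \<subseteq> C n"
    "\<And>i j a b. a \<in> F i \<Longrightarrow> b \<in> C j \<Longrightarrow> a \<otimes>\<^bsub>A\<^esub> b \<in> C (i + j)"
    using C by (auto simp: left_ideal_family_def)
  show ?thesis
    using preceding_in_gr_part[OF C'(2)] gr_part_add[OF C'(1,2)]
      gr_part_mult[OF R.GA.filt_subgroup R.GA.pre_subset C'(1,2) C'(1,2) C'(3)]
    by (intro gr.submoduleI) (auto simp: gr_part_F, simp add: gr_part_def)
qed

text \<open>The witness \<open>X\<close> consists of representatives of the homogeneous components of finitely many
  generators of the left ideal \<open>gr_part C\<close>.\<close>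

lemma noetherian_family:
  assumes grA: "assoc_algebra K (gr_algebra A F)" and noeth: "left_noetherian (gr_algebra A F)"
    and C: "left_ideal_family C"
  shows "\<exists>X. finite X \<and> (\<forall>(i, a)\<in>X. a \<in> C i) \<and>
    (\<forall>D. left_ideal_family D \<longrightarrow> (\<forall>(i, a)\<in>X. a \<in> D i) \<longrightarrow> (\<forall>n. C n \<subseteq> D n))"
proof -
  let ?gr = "gr_algebra A F"
  obtain S where S: "finite S" "S \<subseteq> gr_part C"
      "generated_submodule ?gr (regular_module ?gr) S = gr_part C"
    using noeth gr_part_left_ideal[OF grA C] unfolding left_noetherian_def by blast
  have C': "\<And>n. additive_subgroup (C n) A" "\<And>n. preceding A F n \<subseteq> C n" "\<And>n. C n \<subseteq> F n"
    using C by (auto simp: left_ideal_family_def)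
  have "\<exists>r. \<forall>f\<in>S. (\<forall>n. r f n \<in> F n) \<and> (\<forall>n. r f n \<in> C n) \<and> finite {n. r f n \<noteq> \<zero>\<^bsub>A\<^esub>} \<and> f = R.GA.gr_class (r f)"
  proof (intro bchoice ballI)
    fix f assume "f \<in> S"
    then have f: "f \<in> gr_part C" using S(2) by auto
    show "\<exists>x. (\<forall>n. x n \<in> F n) \<and> (\<forall>n. x n \<in> C n) \<and> finite {n. x n \<noteq> \<zero>\<^bsub>A\<^esub>} \<and> f = R.GA.gr_class x"
      by (rule gr_partE[OF C'(1,2) f]) blast
  qed
  then obtain r where r: "\<And>f n. f \<in> S \<Longrightarrow> r f n \<in> F n" "\<And>f n. f \<in> S \<Longrightarrow> r f n \<in> C n"
    "\<And>f. f \<in> S \<Longrightarrow> finite {n. r f n \<noteq> \<zero>\<^bsub>A\<^esub>}" "\<And>f. f \<in> S \<Longrightarrow> f = R.GA.gr_class (r f)"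
    by blast
  define X where "X = (\<Union>f\<in>S. (\<lambda>n. (n, r f n)) ` {n. r f n \<noteq> \<zero>\<^bsub>A\<^esub>})"
  have "C n \<subseteq> D n" if D: "left_ideal_family D" and X: "\<forall>(i, a)\<in>X. a \<in> D i" for D n
  proof
    have D': "\<And>n. additive_subgroup (D n) A" "\<And>n. preceding A F n \<subseteq> D n"
      using D by (auto simp: left_ideal_family_def)
    \<comment> \<open>Only nonzero representatives are recorded in \<open>X\<close>; the vanishing
      ones lie in every \<open>D n\<close> anyway.\<close>
    have "S \<subseteq> gr_part D"
    proof
      fix f assume f: "f \<in> S"
      have "r f n \<in> D n" for n
        using f X additive_subgroup.zero_closed[OF D'(1)] by (cases "r f n = \<zero>\<^bsub>A\<^esub>") (auto simp: X_def)
      then have "R.GA.gr_class (r f) \<in> gr_part D"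
        using f r by (intro gr_partI[OF D']) auto
      then show "f \<in> gr_part D" using r(4)[OF f] by simp
    qed
    then have sub: "gr_part C \<subseteq> gr_part D"
      using gr_part_left_ideal[OF grA D] S(3) unfolding generated_submodule_def by blast
    fix a assume a: "a \<in> C n"
    then have "a \<in> F n" using C'(3) by auto
    \<comment> \<open>The inclusion of the ideals is read off on the class of \<open>a\<close>
      placed in degree \<open>n\<close>.\<close>
    then show "a \<in> D n" using a sub hom_in_gr_part_iff[OF C'(1,2)] hom_in_gr_part_iff[OF D'] by blast
  qed
  moreover have "finite X" using S(1) r(3) by (simp add: X_def)
  moreover have "\<forall>(i, a)\<in>X. a \<in> C i" using r(2) by (auto simp: X_def)
  ultimately show ?thesis by blast
qed

text \<open>The analogue of \<open>left_ideal_family\<close> for graded subalgebras. Its terms are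
  K-subspaces because \<open>generated_subalgebra\<close> is an intersection of subrings that are
  K-subspaces.\<close>

definition subalgebra_family :: "(nat \<Rightarrow> 'a set) \<Rightarrow> bool" where
  "subalgebra_family B \<longleftrightarrow>
    (\<forall>n. VectorSpace.subspace K (B n) A \<and> preceding A F n \<subseteq> B n \<and> B n \<subseteq> F n) \<and>
    \<one>\<^bsub>A\<^esub> \<in> B 0 \<and> (\<forall>i j. \<forall>a\<in>B i. \<forall>b\<in>B j. a \<otimes>\<^bsub>A\<^esub> b \<in> B (i + j))"

text \<open>Here \<open>D\<close> bounds the degrees of finitely many generators of the associated graded algebra, so
  the subalgebra \<open>gr_part B\<close> contains all of them.\<close>

lemma affine_family:
  assumes grA: "affine_algebra K (gr_algebra A F)"
  shows "\<exists>D. \<forall>B. subalgebra_family B \<longrightarrow> (\<forall>n\<le>D. B n = F n) \<longrightarrow> (\<forall>n. B n = F n)"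
proof -
  let ?gr = "gr_algebra A F"
  interpret gr: affine_algebra K ?gr by (rule grA)
  obtain S where S: "finite S" "S \<subseteq> gr_carrier A F" "generated_subalgebra K ?gr S = carrier ?gr"
    using gr.finitely_generated by auto
  \<comment> \<open>An element of gr A has finitely many nonzero components, so finitely many
    elements share a bound on their degrees.\<close>
  have "\<exists>D. \<forall>f\<in>S. \<forall>n>D. f n = preceding A F n"
    using S(1,2)
  proof (induction S rule: finite_induct)
    case (insert f S)
    have "S \<subseteq> gr_carrier A F" using insert.prems by simp
    from insert.IH[OF this] obtain D where D: "\<forall>f\<in>S. \<forall>n>D. f n = preceding A F n" ..
    have "finite {n. f n \<noteq> preceding A F n}" using insert.prems by (auto simp: gr_carrier_def)
    then obtain D' where "\<And>n. f n \<noteq> preceding A F n \<Longrightarrow> n < D'"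
      by (auto simp: finite_nat_set_iff_bounded)
    then have "f n = preceding A F n" if "n > max D D'" for n using that by fastforce
    then have "\<forall>f\<in>insert f S. \<forall>n>max D D'. f n = preceding A F n" using D by simp
    then show ?case ..
  qed simp
  then obtain D where "\<forall>f\<in>S. \<forall>n>D. f n = preceding A F n" ..
  then have D: "f n = preceding A F n" if "f \<in> S" "n > D" for f n using that by simp
  have *: "F n \<subseteq> B n" if B: "subalgebra_family B" and BF: "\<forall>n\<le>D. B n = F n" for B n
  proof
    have B': "\<And>n. VectorSpace.subspace K (B n) A" "\<And>n. preceding A F n \<subseteq> B n" "\<And>n. B n \<subseteq> F n"
      "\<one>\<^bsub>A\<^esub> \<in> B 0" "\<And>i j a b. a \<in> B i \<Longrightarrow> b \<in> B j \<Longrightarrow> a \<otimes>\<^bsub>A\<^esub> b \<in> B (i + j)"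
      using B by (auto simp: subalgebra_family_def)
    have Bg: "additive_subgroup (B n) A" for n
      using subspaceD[OF B'(1)[of n]]
      by (auto intro!: additive_subgroupI M.add.subgroupI simp: a_inv_def[symmetric])
    have sp: "VectorSpace.subspace K (gr_part B) ?gr"
    proof (rule gr.subspaceI)
      show "c \<odot>\<^bsub>?gr\<^esub> f \<in> gr_part B" if "c \<in> carrier K" "f \<in> gr_part B" for c f
      proof -
        have f: "f \<in> carrier ?gr" "\<And>n. f n \<subseteq> B n" using that(2) by (auto simp: gr_part_def)
        \<comment> \<open>The scalar multiple is defined as a union over representatives, so each of
          its cosets has to be placed in \<open>B n\<close>.\<close>
        have "preceding A F n +>\<^bsub>A\<^esub> (c \<odot>\<^bsub>A\<^esub> x) \<subseteq> B n" if "x \<in> f n" for x n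
        proof -
          have x: "c \<odot>\<^bsub>A\<^esub> x \<in> B n"
            using that f(2) \<open>c \<in> carrier K\<close> subspaceD(4)[OF B'(1)] by blast
          then have "c \<odot>\<^bsub>A\<^esub> x \<in> carrier A" using B'(3) R.F_carrier by blast
          then show ?thesis
            using R.GA.gr_class_subset_iff[OF Bg B'(2), of "\<lambda>_. c \<odot>\<^bsub>A\<^esub> x" n] x
            by (simp add: R.GA.gr_class_def)
        qed
        then have "(c \<odot>\<^bsub>?gr\<^esub> f) n \<subseteq> B n" for n by (auto simp: gr_algebra_def)
        moreover have "c \<odot>\<^bsub>?gr\<^esub> f \<in> carrier ?gr" using that(1) f(1) by (rule gr.smult_closed)
        ultimately show ?thesis by (simp add: gr_part_def)
      qed
    qed (use preceding_in_gr_part[OF B'(2)] gr_part_add[OF Bg B'(2)] in \<open>auto simp: gr_part_def\<close>)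
    have one: "\<one>\<^bsub>?gr\<^esub> = R.GA.gr_class (R.GA.hom_seq 0 \<one>\<^bsub>A\<^esub>)"
      by (auto simp: gr_algebra_def R.GA.gr_class_def)
    have sr: "subring (gr_part B) ?gr"
    proof (rule ring.subringI)
      show "ring ?gr" by (rule gr.A.ring_axioms)
      show "\<one>\<^bsub>?gr\<^esub> \<in> gr_part B"
        unfolding one using B'(4) R.one_in_F by (simp add: hom_in_gr_part_iff[OF Bg B'(2)])
      show "f \<otimes>\<^bsub>?gr\<^esub> g \<in> gr_part B" if "f \<in> gr_part B" "g \<in> gr_part B" for f g
        using gr_part_mult[OF Bg B'(2) Bg B'(2) Bg B'(2) B'(5) that] by simp
    qed (use gr.subspaceD[OF sp] in auto)
    have "S \<subseteq> gr_part B"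
    proof
      fix f assume f: "f \<in> S"
      then have fc: "f \<in> gr_part F" using S(2) by (auto simp: gr_part_F)
      \<comment> \<open>Up to \<open>D\<close> the families agree by assumption; beyond
        \<open>D\<close> the component of a generator is zero, that is, equal to the preceding
        term.\<close>
      have "f n \<subseteq> B n" for n
        using D[OF f, of n] B'(2)[of n] BF fc by (cases "n \<le> D") (auto simp: gr_part_def)
      then show "f \<in> gr_part B" using f S(2) by (auto simp: gr_part_def)
    qed
    then have sub: "gr_carrier A F \<subseteq> gr_part B"
      using S(3) sp sr unfolding generated_subalgebra_def gr_algebra_simps by blast
    fix a assume a: "a \<in> F n"
    have "R.GA.gr_class (R.GA.hom_seq n a) \<in> gr_part B"
      by (rule subsetD[OF sub R.GA.hom_class_in_carrier[OF a]])
    then show "a \<in> B n" using hom_in_gr_part_iff[OF Bg B'(2) a] by simp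
  qed
  show ?thesis
  proof (intro exI allI impI)
    fix B n assume B: "subalgebra_family B" "\<forall>n\<le>D. B n = F n"
    then have "B n \<subseteq> F n" by (simp add: subalgebra_family_def)
    with *[OF B] show "B n = F n" by (rule equalityI[rotated])
  qed
qed

end

section \<open>Filtrations of submodules\<close>

context filtered_algebra_module
begin

lemma F_mult_preceding: "a \<in> F i \<Longrightarrow> b \<in> preceding A F n \<Longrightarrow> a \<otimes>\<^bsub>A\<^esub> b \<in> preceding A F (i + n)"
  using F_mult[of a i b] by (cases n) (auto dest: F_carrier)

text \<open>Leading coefficients with respect to a vector \<open>s\<close>, modulo lower terms \<open>W\<close>.\<close>

definition leading :: "(nat \<Rightarrow> 'm set) \<Rightarrow> 'm \<Rightarrow> (nat \<Rightarrow> 'm set) \<Rightarrow> nat \<Rightarrow> 'a set" where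
  "leading W s P n = {a \<in> F n. \<exists>w\<in>W n. a \<odot>\<^bsub>M\<^esub> s \<oplus>\<^bsub>M\<^esub> w \<in> P n}"

text \<open>A coefficient \<open>a\<close> from a preceding term belongs to the family because a s
  is itself a lower term and cancels against its negative. \<open>P\<close> is kept general because
  division compares the constant family \<open>N\<close> with the filtration generated by the chosen
  elements.\<close>

lemma leading_family:
  assumes s: "s \<in> carrier M"
    and W: "\<And>n. VectorSpace.subspace K (W n) V" "\<And>i n a w. a \<in> F i \<Longrightarrow> w \<in> W n \<Longrightarrow> a \<odot>\<^bsub>M\<^esub> w \<in> W (i + n)"
    and sW: "\<And>n a. a \<in> preceding A F n \<Longrightarrow> a \<odot>\<^bsub>M\<^esub> s \<in> W n"
    and P: "\<And>n. VectorSpace.subspace K (P n) V" "\<And>i n a w. a \<in> F i \<Longrightarrow> w \<in> P n \<Longrightarrow> a \<odot>\<^bsub>M\<^esub> w \<in> P (i + n)"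
  shows "filtered_algebra.left_ideal_family A F (leading W s P)"
proof -
  interpret FA: filtered_algebra K A F
    using AK.assoc_algebra_axioms algebra_filtration
    by (simp add: filtered_algebra_def filtered_algebra_axioms_def)
  note W' = V.subspaceD[OF W(1), simplified V_simps V_minus]
  note P' = V.subspaceD[OF P(1), simplified V_simps V_minus]
  have Wc: "w \<in> W n \<Longrightarrow> w \<in> carrier M" for w n using W'(1) by auto
  have "additive_subgroup (leading W s P n) A" for n
  proof (intro additive_subgroupI A.add.subgroupI)
    show "leading W s P n \<subseteq> carrier A" using F_carrier by (auto simp: leading_def)
    have "\<zero>\<^bsub>A\<^esub> \<in> leading W s P n"
      unfolding leading_def using F(2) W'(2) P'(2) s by (auto intro!: bexI[of _ "\<zero>\<^bsub>M\<^esub>"])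
    then show "leading W s P n \<noteq> {}" by auto
  next
    fix a assume "a \<in> leading W s P n"
    then obtain w where a: "a \<in> F n" "w \<in> W n" "a \<odot>\<^bsub>M\<^esub> s \<oplus>\<^bsub>M\<^esub> w \<in> P n" by (auto simp: leading_def)
    have "\<ominus>\<^bsub>M\<^esub> (a \<odot>\<^bsub>M\<^esub> s \<oplus>\<^bsub>M\<^esub> w) = (\<ominus>\<^bsub>A\<^esub> a) \<odot>\<^bsub>M\<^esub> s \<oplus>\<^bsub>M\<^esub> \<ominus>\<^bsub>M\<^esub> w"
      using a(1,2) s by (simp add: F_carrier Wc M.minus_add smult_minus_left L.smult_closed)
    then have "(\<ominus>\<^bsub>A\<^esub> a) \<odot>\<^bsub>M\<^esub> s \<oplus>\<^bsub>M\<^esub> \<ominus>\<^bsub>M\<^esub> w \<in> P n" using P'(5)[OF a(3)] by simp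
    then show "\<ominus>\<^bsub>A\<^esub> a \<in> leading W s P n" using F(5)[OF a(1)] W'(5)[OF a(2)] by (auto simp: leading_def)
  next
    fix a b assume "a \<in> leading W s P n" "b \<in> leading W s P n"
    then obtain v w where a: "a \<in> F n" "w \<in> W n" "a \<odot>\<^bsub>M\<^esub> s \<oplus>\<^bsub>M\<^esub> w \<in> P n"
      and b: "b \<in> F n" "v \<in> W n" "b \<odot>\<^bsub>M\<^esub> s \<oplus>\<^bsub>M\<^esub> v \<in> P n"
      unfolding leading_def by blast
    have "(a \<odot>\<^bsub>M\<^esub> s \<oplus>\<^bsub>M\<^esub> w) \<oplus>\<^bsub>M\<^esub> (b \<odot>\<^bsub>M\<^esub> s \<oplus>\<^bsub>M\<^esub> v) = (a \<oplus>\<^bsub>A\<^esub> b) \<odot>\<^bsub>M\<^esub> s \<oplus>\<^bsub>M\<^esub> (w \<oplus>\<^bsub>M\<^esub> v)"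
      using F_carrier[OF a(1)] F_carrier[OF b(1)] Wc[OF a(2)] Wc[OF b(2)] s
      by (simp add: L.smult_l_distr L.smult_closed M.a_ac)
    then have "(a \<oplus>\<^bsub>A\<^esub> b) \<odot>\<^bsub>M\<^esub> s \<oplus>\<^bsub>M\<^esub> (w \<oplus>\<^bsub>M\<^esub> v) \<in> P n" using P'(3)[OF a(3) b(3)] by simp
    then show "a \<oplus>\<^bsub>A\<^esub> b \<in> leading W s P n"
      using F(3)[OF a(1) b(1)] W'(3)[OF a(2) b(2)] by (auto simp: leading_def)
  qed
  moreover have "preceding A F n \<subseteq> leading W s P n" for n
  proof
    fix a assume a: "a \<in> preceding A F n"
    then have aF: "a \<in> F n" using preceding_subset_F by auto
    have "\<ominus>\<^bsub>M\<^esub> (a \<odot>\<^bsub>M\<^esub> s) \<in> W n" by (rule W'(5)[OF sW[OF a]])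
    moreover have "a \<odot>\<^bsub>M\<^esub> s \<oplus>\<^bsub>M\<^esub> \<ominus>\<^bsub>M\<^esub> (a \<odot>\<^bsub>M\<^esub> s) \<in> P n"
      using s F_carrier[OF aF] P'(2) by (simp add: M.r_neg L.smult_closed)
    ultimately show "a \<in> leading W s P n" using aF by (auto simp: leading_def)
  qed
  moreover have "leading W s P n \<subseteq> F n" for n by (auto simp: leading_def)
  moreover have "a \<otimes>\<^bsub>A\<^esub> b \<in> leading W s P (i + j)"
    if a: "a \<in> F i" and "b \<in> leading W s P j" for a b i j
  proof -
    from that(2) obtain w where b: "b \<in> F j" "w \<in> W j" "b \<odot>\<^bsub>M\<^esub> s \<oplus>\<^bsub>M\<^esub> w \<in> P j"
      by (auto simp: leading_def)
    have "a \<odot>\<^bsub>M\<^esub> (b \<odot>\<^bsub>M\<^esub> s \<oplus>\<^bsub>M\<^esub> w) = (a \<otimes>\<^bsub>A\<^esub> b) \<odot>\<^bsub>M\<^esub> s \<oplus>\<^bsub>M\<^esub> a \<odot>\<^bsub>M\<^esub> w"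
      using F_carrier[OF a] F_carrier[OF b(1)] Wc[OF b(2)] s
      by (simp add: L.smult_r_distr L.smult_assoc L.smult_closed)
    then have "(a \<otimes>\<^bsub>A\<^esub> b) \<odot>\<^bsub>M\<^esub> s \<oplus>\<^bsub>M\<^esub> a \<odot>\<^bsub>M\<^esub> w \<in> P (i + j)" using P(2)[OF a b(3)] by simp
    then show ?thesis using F_mult[OF a b(1)] W(2)[OF a b(2)] by (auto simp: leading_def)
  qed
  ultimately show ?thesis unfolding FA.left_ideal_family_def by blast
qed

text \<open>This is division as for Groebner bases, ordering terms by degree and then by the index of
  the generator \<open>s j\<close>.  The leading coefficients of \<open>N\<close> at each generator form a left ideal
  family; \<open>Y\<close> consists of elements of \<open>N\<close> realising finitely many generators of each of them.\<close>

lemma submodule_filtration: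
  assumes grA: "assoc_algebra K (gr_algebra A F)" and noeth: "left_noetherian (gr_algebra A F)"
    and S: "finite S" "S \<subseteq> carrier M" and N: "Module.submodule N A M"
  shows "\<exists>Y. finite Y \<and> Y \<subseteq> UNIV \<times> N \<and> (\<forall>n. N \<inter> filt ({0} \<times> S) n = filt Y n)"
proof -
  interpret FA: filtered_algebra K A F
    using AK.assoc_algebra_axioms algebra_filtration
    by (simp add: filtered_algebra_def filtered_algebra_axioms_def)
  obtain s and r :: nat where s: "S = s ` {..<r}"
    using S(1) by (metis finite_conv_nat_seg_image lessThan_def)
  have sc: "s j \<in> carrier M" if "j < r" for j using that S(2) s by auto
  let ?X = "{0} \<times> S"
  have X: "?X \<subseteq> UNIV \<times> carrier M" using S(2) by auto
  have sX: "b \<odot>\<^bsub>M\<^esub> s j \<in> filt ?X n" if "j < r" "b \<in> F n" for j b n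
    using that by (intro filt_memI[OF X, of 0]) (auto simp: s)
  \<comment> \<open>The span \<open>W k n\<close> collects the terms below degree \<open>n\<close>
    at \<open>s k\<close>: coefficients of degree \<open>n\<close> at earlier generators, and
    coefficients of smaller degree at any generator.\<close>
  define G where "G n k = {b \<odot>\<^bsub>M\<^esub> s j | b j. j < k \<and> j < r \<and> b \<in> F n} \<union>
    {b \<odot>\<^bsub>M\<^esub> s j | b j. j < r \<and> b \<in> preceding A F n}" for n k
  define W where "W k n = V.span (G n k)" for n k
  have Gc: "G n k \<subseteq> carrier V" for n k
    unfolding G_def using preceding_subset_F[of n] by (auto intro!: L.smult_closed sc F_carrier)
  have W: "VectorSpace.subspace K (W k n) V" for n k
    unfolding W_def by (intro V.span_is_subspace Gc)
  note W' = V.subspaceD[OF W, simplified V_simps V_minus]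
  have GW: "G n k \<subseteq> W k n" for n k unfolding W_def by (intro V.in_own_span Gc)
  have Wmin: "W k n \<subseteq> U" if "VectorSpace.subspace K U V" "G n k \<subseteq> U" for n k U
    unfolding W_def using that by (intro V.span_minimal)
  have Wc: "w \<in> W k n \<Longrightarrow> w \<in> carrier M" for w k n using W'(1) by auto
  have Wsm: "a \<odot>\<^bsub>M\<^esub> w \<in> W k (i + n)" if a: "a \<in> F i" and w: "w \<in> W k n" for a w i n k
  proof (rule smult_span_in[OF _ W F_carrier[OF a] _ w[unfolded W_def]])
    show "G n k \<subseteq> carrier M" using Gc by simp
    fix g assume "g \<in> G n k"
    then consider b j where "g = b \<odot>\<^bsub>M\<^esub> s j" "j < k" "j < r" "b \<in> F n"
      | b j where "g = b \<odot>\<^bsub>M\<^esub> s j" "j < r" "b \<in> preceding A F n" unfolding G_def by blast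
    then have "a \<odot>\<^bsub>M\<^esub> g \<in> G (i + n) k"
    proof cases
      case 1
      then have "a \<odot>\<^bsub>M\<^esub> g = (a \<otimes>\<^bsub>A\<^esub> b) \<odot>\<^bsub>M\<^esub> s j"
        using a by (simp add: L.smult_assoc F_carrier sc)
      moreover have "a \<otimes>\<^bsub>A\<^esub> b \<in> F (i + n)" using a 1 by (intro F_mult)
      ultimately show ?thesis using 1 unfolding G_def by blast
    next
      case 2
      then have "b \<in> F n" using preceding_subset_F by auto
      then have "a \<odot>\<^bsub>M\<^esub> g = (a \<otimes>\<^bsub>A\<^esub> b) \<odot>\<^bsub>M\<^esub> s j"
        using a 2 by (simp add: L.smult_assoc F_carrier sc)
      moreover have "a \<otimes>\<^bsub>A\<^esub> b \<in> preceding A F (i + n)" using a 2 by (intro F_mult_preceding)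
      ultimately show ?thesis using 2 unfolding G_def by blast
    qed
    then show "a \<odot>\<^bsub>M\<^esub> g \<in> W k (i + n)" using GW by auto
  qed
  have Wr: "filt ?X n \<subseteq> W r n" for n
  proof (rule filt_subset[OF X W])
    fix b i x assume "(i, x) \<in> ?X" "i \<le> n" "b \<in> F (n - i)"
    then have "b \<odot>\<^bsub>M\<^esub> x \<in> G n r" using s unfolding G_def by auto
    then show "b \<odot>\<^bsub>M\<^esub> x \<in> W r n" using GW by auto
  qed
  have Wfilt: "W k n \<subseteq> filt ?X n" for k n
    using preceding_subset_F[of n] sX by (intro Wmin filt_subspace[OF X]) (auto simp: G_def)
  have W0: "W 0 0 \<subseteq> {\<zero>\<^bsub>M\<^esub>}"
    by (rule Wmin) (auto simp: G_def sc intro: V.subspaceI smult_zero_right)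
  \<comment> \<open>With no generator allowed in degree \<open>Suc n\<close>, only coefficients from
    \<open>F n\<close> remain; this links consecutive degrees in the final induction.\<close>
  have WSuc0: "W 0 (Suc n) \<subseteq> filt ?X n" for n
    using sX by (intro Wmin filt_subspace[OF X]) (auto simp: G_def)
  \<comment> \<open>The top term, the one at \<open>s k\<close>, is split off from the lower
    ones.\<close>
  have Wdec: "\<exists>a\<in>F n. \<exists>w\<in>W k n. x = a \<odot>\<^bsub>M\<^esub> s k \<oplus>\<^bsub>M\<^esub> w" if k: "k < r" and x: "x \<in> W (Suc k) n" for k n x
  proof -
    let ?U = "{a \<odot>\<^bsub>M\<^esub> s k \<oplus>\<^bsub>M\<^esub> w | a w. a \<in> F n \<and> w \<in> W k n}"
    have "VectorSpace.subspace K ?U V"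
    proof (rule V.subspaceI)
      show "?U \<subseteq> carrier V" using sc[OF k] Wc by (auto intro!: M.a_closed L.smult_closed F_carrier)
      have "\<zero>\<^bsub>V\<^esub> = \<zero>\<^bsub>A\<^esub> \<odot>\<^bsub>M\<^esub> s k \<oplus>\<^bsub>M\<^esub> \<zero>\<^bsub>M\<^esub>" using sc[OF k] by simp
      then show "\<zero>\<^bsub>V\<^esub> \<in> ?U" using F(2) W'(2) by blast
    next
      fix x y assume "x \<in> ?U" "y \<in> ?U"
      then obtain a w b v where x: "a \<in> F n" "w \<in> W k n" "x = a \<odot>\<^bsub>M\<^esub> s k \<oplus>\<^bsub>M\<^esub> w"
        and y: "b \<in> F n" "v \<in> W k n" "y = b \<odot>\<^bsub>M\<^esub> s k \<oplus>\<^bsub>M\<^esub> v" by blast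
      have "x \<oplus>\<^bsub>V\<^esub> y = (a \<oplus>\<^bsub>A\<^esub> b) \<odot>\<^bsub>M\<^esub> s k \<oplus>\<^bsub>M\<^esub> (w \<oplus>\<^bsub>M\<^esub> v)"
        using F_carrier[OF x(1)] F_carrier[OF y(1)] Wc[OF x(2)] Wc[OF y(2)] sc[OF k]
        by (simp add: x(3) y(3) L.smult_l_distr L.smult_closed M.a_ac)
      then show "x \<oplus>\<^bsub>V\<^esub> y \<in> ?U" using F(3)[OF x(1) y(1)] W'(3)[OF x(2) y(2)] by blast
    next
      fix c x assume c: "c \<in> carrier K" and "x \<in> ?U"
      then obtain a w where x: "a \<in> F n" "w \<in> W k n" "x = a \<odot>\<^bsub>M\<^esub> s k \<oplus>\<^bsub>M\<^esub> w" by blast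
      have "c \<odot>\<^bsub>V\<^esub> x = c \<odot>\<^bsub>V\<^esub> (a \<odot>\<^bsub>M\<^esub> s k) \<oplus>\<^bsub>M\<^esub> c \<odot>\<^bsub>V\<^esub> w"
        using V.smult_r_distr[OF c, of "a \<odot>\<^bsub>M\<^esub> s k" w] F_carrier[OF x(1)] Wc[OF x(2)] sc[OF k]
        by (simp add: x(3) L.smult_closed)
      also have "c \<odot>\<^bsub>V\<^esub> (a \<odot>\<^bsub>M\<^esub> s k) = (c \<odot>\<^bsub>A\<^esub> a) \<odot>\<^bsub>M\<^esub> s k"
        using smult_smult[OF c F_carrier[OF x(1)] sc[OF k]] by simp
      finally show "c \<odot>\<^bsub>V\<^esub> x \<in> ?U"
        using F(4)[OF c x(1)] V.subspaceD(4)[OF W c x(2)] by blast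
    qed
    moreover have "G n (Suc k) \<subseteq> ?U"
    proof
      fix g assume "g \<in> G n (Suc k)"
      then consider "g \<in> G n k" | b where "g = b \<odot>\<^bsub>M\<^esub> s k" "b \<in> F n"
        unfolding G_def less_Suc_eq by blast
      then show "g \<in> ?U"
      proof cases
        case 1
        then have "g \<in> W k n" using GW by auto
        moreover from this have "g = \<zero>\<^bsub>A\<^esub> \<odot>\<^bsub>M\<^esub> s k \<oplus>\<^bsub>M\<^esub> g" using sc[OF k] Wc by simp
        ultimately show ?thesis using F(2) by blast
      next
        case 2
        then have "g = b \<odot>\<^bsub>M\<^esub> s k \<oplus>\<^bsub>M\<^esub> \<zero>\<^bsub>M\<^esub>" using sc[OF k] by (simp add: L.smult_closed F_carrier)
        then show ?thesis using 2(2) W'(2) by blast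
      qed
    qed
    ultimately show ?thesis using Wmin x by blast
  qed
  note N' = submoduleD[OF N]
  have fam: "FA.left_ideal_family (leading (W k) (s k) P)"
    if "k < r" "\<And>n. VectorSpace.subspace K (P n) V"
      "\<And>i n a w. a \<in> F i \<Longrightarrow> w \<in> P n \<Longrightarrow> a \<odot>\<^bsub>M\<^esub> w \<in> P (i + n)" for k P
  proof (rule leading_family[where W = "W k" and s = "s k" and P = P])
    fix n a assume "a \<in> preceding A F n"
    then have "a \<odot>\<^bsub>M\<^esub> s k \<in> G n k" using that(1) unfolding G_def by blast
    then show "a \<odot>\<^bsub>M\<^esub> s k \<in> W k n" using GW by auto
  qed (use that sc W Wsm in simp_all)
  have "\<exists>Z. \<forall>k<r. finite (Z k) \<and> (\<forall>(i, a)\<in>Z k. a \<in> leading (W k) (s k) (\<lambda>_. N) i) \<and>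
    (\<forall>D. FA.left_ideal_family D \<longrightarrow> (\<forall>(i, a)\<in>Z k. a \<in> D i) \<longrightarrow>
      (\<forall>n. leading (W k) (s k) (\<lambda>_. N) n \<subseteq> D n))"
  proof (intro choice allI)
    fix k
    show "\<exists>Z. k < r \<longrightarrow> finite Z \<and> (\<forall>(i, a)\<in>Z. a \<in> leading (W k) (s k) (\<lambda>_. N) i) \<and>
      (\<forall>D. FA.left_ideal_family D \<longrightarrow> (\<forall>(i, a)\<in>Z. a \<in> D i) \<longrightarrow>
        (\<forall>n. leading (W k) (s k) (\<lambda>_. N) n \<subseteq> D n))"
    proof (cases "k < r")
      case True
      have "FA.left_ideal_family (leading (W k) (s k) (\<lambda>_. N))"
        using True submodule_subspace[OF N] N'(4)[OF F_carrier] by (intro fam)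
      from FA.noetherian_family[OF grA noeth this] show ?thesis by simp
    qed simp
  qed
  then obtain Z where Z0: "\<forall>k<r. finite (Z k) \<and>
    (\<forall>(i, a)\<in>Z k. a \<in> leading (W k) (s k) (\<lambda>_. N) i) \<and>
    (\<forall>D. FA.left_ideal_family D \<longrightarrow> (\<forall>(i, a)\<in>Z k. a \<in> D i) \<longrightarrow>
      (\<forall>n. leading (W k) (s k) (\<lambda>_. N) n \<subseteq> D n))" ..
  have Z: "\<And>k. k < r \<Longrightarrow> finite (Z k)"
    "\<And>k i a. k < r \<Longrightarrow> (i, a) \<in> Z k \<Longrightarrow> a \<in> leading (W k) (s k) (\<lambda>_. N) i"
    "\<And>k D n. k < r \<Longrightarrow> FA.left_ideal_family D \<Longrightarrow> (\<forall>(i, a)\<in>Z k. a \<in> D i) \<Longrightarrow>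
      leading (W k) (s k) (\<lambda>_. N) n \<subseteq> D n"
    using Z0 by (blast, fast, simp)
  \<comment> \<open>Each chosen leading coefficient is completed by lower terms to an element of
    \<open>N\<close>; these elements form \<open>Y\<close>, each in the degree of its
    coefficient.\<close>
  have "\<exists>w. \<forall>k i a. k < r \<longrightarrow> (i, a) \<in> Z k \<longrightarrow> w k i a \<in> W k i \<and> a \<odot>\<^bsub>M\<^esub> s k \<oplus>\<^bsub>M\<^esub> w k i a \<in> N"
  proof (intro choice allI)
    fix k i a
    show "\<exists>w. k < r \<longrightarrow> (i, a) \<in> Z k \<longrightarrow> w \<in> W k i \<and> a \<odot>\<^bsub>M\<^esub> s k \<oplus>\<^bsub>M\<^esub> w \<in> N"
      using Z(2)[of k i a] by (auto simp: leading_def)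
  qed
  then obtain w where w: "\<And>k i a. k < r \<Longrightarrow> (i, a) \<in> Z k \<Longrightarrow> w k i a \<in> W k i"
    "\<And>k i a. k < r \<Longrightarrow> (i, a) \<in> Z k \<Longrightarrow> a \<odot>\<^bsub>M\<^esub> s k \<oplus>\<^bsub>M\<^esub> w k i a \<in> N" by blast
  define Y where "Y = (\<Union>k\<in>{..<r}. (\<lambda>(i, a). (i, a \<odot>\<^bsub>M\<^esub> s k \<oplus>\<^bsub>M\<^esub> w k i a)) ` Z k)"
  have YI: "(i, a \<odot>\<^bsub>M\<^esub> s k \<oplus>\<^bsub>M\<^esub> w k i a) \<in> Y" if "k < r" "(i, a) \<in> Z k" for k i a
    unfolding Y_def using that by force
  have YN: "Y \<subseteq> UNIV \<times> N" using w(2) by (auto simp: Y_def)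
  have finY: "finite Y" using Z(1) by (simp add: Y_def)
  have Y: "Y \<subseteq> UNIV \<times> carrier M" using YN N'(1) by blast
  have YX: "x \<in> filt ?X i" if "(i, x) \<in> Y" for i x
  proof -
    from that obtain k a where *: "k < r" "(i, a) \<in> Z k" "x = a \<odot>\<^bsub>M\<^esub> s k \<oplus>\<^bsub>M\<^esub> w k i a"
      unfolding Y_def by auto
    have "a \<in> F i" using Z(2)[OF *(1,2)] by (simp add: leading_def)
    then show ?thesis
      unfolding *(3) using sX[OF *(1)] subsetD[OF Wfilt w(1)[OF *(1,2)]] by (intro filtD(3)[OF X])
  qed
  have filtY: "filt Y n \<subseteq> N \<inter> filt ?X n" for n
  proof (rule filt_subset[OF Y])
    show "VectorSpace.subspace K (N \<inter> filt ?X n) V"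
      by (intro V.subspace_Int submodule_subspace[OF N] filt_subspace[OF X])
    fix b i x assume *: "(i, x) \<in> Y" "i \<le> n" "b \<in> F (n - i)"
    have "b \<odot>\<^bsub>M\<^esub> x \<in> filt ?X (n - i + i)" using * by (intro smult_filt[OF X] YX)
    moreover have "b \<odot>\<^bsub>M\<^esub> x \<in> N" using * YN by (intro N'(4)) (auto intro: F_carrier)
    ultimately show "b \<odot>\<^bsub>M\<^esub> x \<in> N \<inter> filt ?X n" using * by simp
  qed
  have step: "N \<inter> W (Suc k) n \<subseteq> filt Y n" if k: "k < r" and IH: "N \<inter> W k n \<subseteq> filt Y n" for k n
  proof
    fix y assume y: "y \<in> N \<inter> W (Suc k) n"
    then obtain a v where a: "a \<in> F n" "v \<in> W k n" "y = a \<odot>\<^bsub>M\<^esub> s k \<oplus>\<^bsub>M\<^esub> v" using Wdec[OF k] by blast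
    then have "a \<in> leading (W k) (s k) (\<lambda>_. N) n" using y by (auto simp: leading_def)
    \<comment> \<open>Each chosen coefficient is also a leading coefficient of
      \<open>filt Y\<close>, witnessed by its completed element; the choice of \<open>Z\<close> then
      extends this to all leading coefficients of \<open>N\<close>.\<close>
    moreover have "\<forall>(i, a)\<in>Z k. a \<in> leading (W k) (s k) (filt Y) i"
    proof clarify
      fix i b assume ib: "(i, b) \<in> Z k"
      have "b \<odot>\<^bsub>M\<^esub> s k \<oplus>\<^bsub>M\<^esub> w k i b \<in> filt Y i"
        using YI[OF k ib] by (intro generator_in_filt[OF Y]) auto
      then show "b \<in> leading (W k) (s k) (filt Y) i"
        using Z(2)[OF k ib] w(1)[OF k ib] by (auto simp: leading_def)
    qed
    moreover have "FA.left_ideal_family (leading (W k) (s k) (filt Y))"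
      by (intro fam k filt_subspace[OF Y] smult_filt[OF Y])
    ultimately have "a \<in> leading (W k) (s k) (filt Y) n" using Z(3)[OF k] by blast
    then obtain v' where v': "v' \<in> W k n" "a \<odot>\<^bsub>M\<^esub> s k \<oplus>\<^bsub>M\<^esub> v' \<in> filt Y n" by (auto simp: leading_def)
    let ?z = "a \<odot>\<^bsub>M\<^esub> s k \<oplus>\<^bsub>M\<^esub> v'"
    have c: "a \<odot>\<^bsub>M\<^esub> s k \<in> carrier M" "v \<in> carrier M" "v' \<in> carrier M"
      using a v'(1) Wc sc[OF k] F_carrier by (auto intro: L.smult_closed)
    \<comment> \<open>The terms at \<open>s k\<close> cancel, so the difference consists of lower
      terms and falls under the assumption \<open>IH\<close>.\<close>
    have "y \<ominus>\<^bsub>M\<^esub> ?z = v \<ominus>\<^bsub>M\<^esub> v'"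
      unfolding a(3) using c
      by (simp add: a_minus_def M.minus_add M.a_ac) (simp add: M.a_assoc[symmetric] M.r_neg)
    moreover have "v \<ominus>\<^bsub>M\<^esub> v' \<in> W k n" using a(2) v'(1) by (rule W'(6))
    moreover have "y \<ominus>\<^bsub>M\<^esub> ?z \<in> N"
      using V.subspaceD(6)[OF submodule_subspace[OF N], of y ?z] y subsetD[OF filtY v'(2)] by simp
    ultimately have "y \<ominus>\<^bsub>M\<^esub> ?z \<in> filt Y n" using IH by auto
    then have "(y \<ominus>\<^bsub>M\<^esub> ?z) \<oplus>\<^bsub>M\<^esub> ?z \<in> filt Y n" using v'(2) by (rule filtD(3)[OF Y])
    moreover have "(y \<ominus>\<^bsub>M\<^esub> ?z) \<oplus>\<^bsub>M\<^esub> ?z = y"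
      unfolding a(3) using c by (simp add: a_minus_def M.a_assoc M.l_neg)
    ultimately show "y \<in> filt Y n" by simp
  qed
  have up: "N \<inter> W k n \<subseteq> filt Y n" if "k \<le> r" "N \<inter> W 0 n \<subseteq> filt Y n" for k n
    using that
  proof (induction k)
    case (Suc k)
    then show ?case using step[of k n] by simp
  qed
  \<comment> \<open>Induction on the degree; inside each degree \<open>up\<close> climbs through the
    generators.\<close>
  have "N \<inter> filt ?X n \<subseteq> filt Y n" for n
  proof (induction n)
    case 0
    have "N \<inter> W 0 0 \<subseteq> filt Y 0" using W0 filtD(2)[OF Y] by auto
    then show ?case using up[of r 0] Wr[of 0] by auto
  next
    case (Suc n)
    then have "N \<inter> W 0 (Suc n) \<subseteq> filt Y (Suc n)"
      using WSuc0[of n] filt_mono[OF Y, of n "Suc n"] by auto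
    then show ?case using up[of r "Suc n"] Wr[of "Suc n"] by auto
  qed
  then have "\<forall>n. N \<inter> filt ?X n = filt Y n" using filtY by blast
  then show ?thesis using finY YN by blast
qed

end

section \<open>Powers of generating subspaces and Gelfand-Kirillov dimension\<close>

lemma module_homD:
  assumes "g \<in> module_hom A M M'"
  shows "x \<in> carrier M \<Longrightarrow> g x \<in> carrier M'"
    and "x \<in> carrier M \<Longrightarrow> y \<in> carrier M \<Longrightarrow> g (x \<oplus>\<^bsub>M\<^esub> y) = g x \<oplus>\<^bsub>M'\<^esub> g y"
    and "a \<in> carrier A \<Longrightarrow> x \<in> carrier M \<Longrightarrow> g (a \<odot>\<^bsub>M\<^esub> x) = a \<odot>\<^bsub>M'\<^esub> g x"
  using assms by (auto simp: module_hom_def)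

context assoc_algebra
begin

text \<open>Bilinearity, used in one variable at a time: the left factor runs through its span with
  \<open>t\<close> fixed, then the right factor with \<open>x\<close> fixed.\<close>

lemma mult_spans_in:
  assumes S: "S \<subseteq> carrier A" and T: "T \<subseteq> carrier A" and W: "VectorSpace.subspace K W A"
    and ST: "\<And>s t. s \<in> S \<Longrightarrow> t \<in> T \<Longrightarrow> s \<otimes>\<^bsub>A\<^esub> t \<in> W"
    and x: "x \<in> span S" and y: "y \<in> span T"
  shows "x \<otimes>\<^bsub>A\<^esub> y \<in> W"
proof -
  note W' = subspaceD[OF W]
  have "span S \<subseteq> {x \<in> carrier A. x \<otimes>\<^bsub>A\<^esub> t \<in> W}" if t: "t \<in> T" for t
  proof (rule span_minimal)
    show "VectorSpace.subspace K {x \<in> carrier A. x \<otimes>\<^bsub>A\<^esub> t \<in> W} A"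
    proof (rule subspaceI)
      have "t \<in> carrier A" using t T by auto
      then show "\<zero>\<^bsub>A\<^esub> \<in> {x \<in> carrier A. x \<otimes>\<^bsub>A\<^esub> t \<in> W}"
        "\<And>x y. x \<in> {x \<in> carrier A. x \<otimes>\<^bsub>A\<^esub> t \<in> W} \<Longrightarrow> y \<in> {x \<in> carrier A. x \<otimes>\<^bsub>A\<^esub> t \<in> W} \<Longrightarrow>
          x \<oplus>\<^bsub>A\<^esub> y \<in> {x \<in> carrier A. x \<otimes>\<^bsub>A\<^esub> t \<in> W}"
        "\<And>c x. c \<in> carrier K \<Longrightarrow> x \<in> {x \<in> carrier A. x \<otimes>\<^bsub>A\<^esub> t \<in> W} \<Longrightarrow>
          c \<odot>\<^bsub>A\<^esub> x \<in> {x \<in> carrier A. x \<otimes>\<^bsub>A\<^esub> t \<in> W}"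
        using W'(2) W'(3) W'(4) by (simp_all add: A.l_distr smult_mult_left)
    qed auto
  qed (use S ST t in auto)
  then have xt: "x \<otimes>\<^bsub>A\<^esub> t \<in> W" if "t \<in> T" for t using x that by auto
  have xc: "x \<in> carrier A" using x S span_closed by blast
  have "span T \<subseteq> {y \<in> carrier A. x \<otimes>\<^bsub>A\<^esub> y \<in> W}"
  proof (rule span_minimal)
    show "VectorSpace.subspace K {y \<in> carrier A. x \<otimes>\<^bsub>A\<^esub> y \<in> W} A"
    proof (rule subspaceI)
      show "\<zero>\<^bsub>A\<^esub> \<in> {y \<in> carrier A. x \<otimes>\<^bsub>A\<^esub> y \<in> W}"
        "\<And>y z. y \<in> {y \<in> carrier A. x \<otimes>\<^bsub>A\<^esub> y \<in> W} \<Longrightarrow> z \<in> {y \<in> carrier A. x \<otimes>\<^bsub>A\<^esub> y \<in> W} \<Longrightarrow>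
          y \<oplus>\<^bsub>A\<^esub> z \<in> {y \<in> carrier A. x \<otimes>\<^bsub>A\<^esub> y \<in> W}"
        "\<And>c y. c \<in> carrier K \<Longrightarrow> y \<in> {y \<in> carrier A. x \<otimes>\<^bsub>A\<^esub> y \<in> W} \<Longrightarrow>
          c \<odot>\<^bsub>A\<^esub> y \<in> {y \<in> carrier A. x \<otimes>\<^bsub>A\<^esub> y \<in> W}"
        using xc W'(2) W'(3) W'(4) by (simp_all add: A.r_distr smult_mult_right)
    qed auto
  qed (use T xt in auto)
  then show ?thesis using y by auto
qed

end

text \<open>Starting the powers at \<open>B\<close> covers both \<open>power_space\<close>, where \<open>B\<close> is the field, and the powers of
  a term \<open>F D\<close> of the filtration, where \<open>B = F 0\<close> absorbs generators of degree 0.\<close>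

primrec subspace_power ::
    "'k ring \<Rightarrow> ('k, 'a) module \<Rightarrow> 'a set \<Rightarrow> 'a set \<Rightarrow> nat \<Rightarrow> 'a set" where
  "subspace_power K A B W 0 = B"
| "subspace_power K A B W (Suc n) =
    module.span K A {x \<otimes>\<^bsub>A\<^esub> y | x y. x \<in> subspace_power K A B W n \<and> y \<in> W}"

lemma power_space_eq: "power_space K A W n = subspace_power K A (module.span K A {\<one>\<^bsub>A\<^esub>}) W n"
  by (induction n) simp_all

text \<open>The last two assumptions let \<open>B\<close> act as a zeroth power: multiplying by it
  from the right does not raise the exponent.\<close>

locale subspace_powers = assoc_algebra K A for K :: "'k ring" and A :: "('k, 'a) module" +
  fixes B W :: "'a set"
  assumes B: "VectorSpace.subspace K B A" and W: "VectorSpace.subspace K W A"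
    and one_B: "\<one>\<^bsub>A\<^esub> \<in> B" and BW: "B \<subseteq> W"
    and BB: "x \<in> B \<Longrightarrow> y \<in> B \<Longrightarrow> x \<otimes>\<^bsub>A\<^esub> y \<in> B"
    and WB: "x \<in> W \<Longrightarrow> y \<in> B \<Longrightarrow> x \<otimes>\<^bsub>A\<^esub> y \<in> W"
begin

abbreviation P :: "nat \<Rightarrow> 'a set" where "P \<equiv> subspace_power K A B W"

lemma P_subspace: "VectorSpace.subspace K (P n) A"
proof (induction n)
  case (Suc n)
  then have "{x \<otimes>\<^bsub>A\<^esub> y | x y. x \<in> P n \<and> y \<in> W} \<subseteq> carrier A"
    using subspaceD(1)[OF Suc] subspaceD(1)[OF W] by auto
  then show ?case by (simp add: span_is_subspace)
qed (simp add: B)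

lemma P_carrier: "x \<in> P n \<Longrightarrow> x \<in> carrier A"
  using subspaceD(1)[OF P_subspace] by auto

lemma W_carrier: "x \<in> W \<Longrightarrow> x \<in> carrier A"
  using subspaceD(1)[OF W] by auto

lemma gens_carrier: "{x \<otimes>\<^bsub>A\<^esub> y | x y. x \<in> P n \<and> y \<in> W} \<subseteq> carrier A"
  using P_carrier W_carrier by auto

lemma P_Suc_mult: "x \<in> P n \<Longrightarrow> y \<in> W \<Longrightarrow> x \<otimes>\<^bsub>A\<^esub> y \<in> P (Suc n)"
  using in_own_span[OF gens_carrier, of n] by auto

lemma P_Suc_minimal:
  assumes "VectorSpace.subspace K U A" "\<And>x y. x \<in> P n \<Longrightarrow> y \<in> W \<Longrightarrow> x \<otimes>\<^bsub>A\<^esub> y \<in> U"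
  shows "P (Suc n) \<subseteq> U"
  unfolding subspace_power.simps using assms by (intro span_minimal) auto

lemma P_Suc: "P n \<subseteq> P (Suc n)"
proof
  fix x assume "x \<in> P n"
  then show "x \<in> P (Suc n)" using P_Suc_mult[of x n "\<one>\<^bsub>A\<^esub>"] one_B BW P_carrier[of x n] by auto
qed

lemma P_mono: "i \<le> j \<Longrightarrow> P i \<subseteq> P j"
  using P_Suc by (rule lift_Suc_mono_le)

text \<open>Powers are extended on the right, so the induction runs over the right exponent and
  reassociates. For exponent 0 the factor from \<open>B\<close> is absorbed by the last factor from
  \<open>W\<close>, or by \<open>B\<close> itself when \<open>i = 0\<close>.\<close>

lemma P_mult:
  assumes "x \<in> P i" "y \<in> P j"
  shows "x \<otimes>\<^bsub>A\<^esub> y \<in> P (i + j)"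
  using assms
proof (induction j arbitrary: y)
  case 0
  then have y: "y \<in> B" by simp
  have yc: "y \<in> carrier A" using y W_carrier BW by auto
  show ?case
  proof (cases i)
    case (Suc k)
    note gens = gens_carrier[of k]
    have zy: "z \<otimes>\<^bsub>A\<^esub> y \<in> P i" if "z \<in> {x \<otimes>\<^bsub>A\<^esub> y | x y. x \<in> P k \<and> y \<in> W}" for z
    proof -
      from that obtain u w where u: "z = u \<otimes>\<^bsub>A\<^esub> w" "u \<in> P k" "w \<in> W" by blast
      then have "z \<otimes>\<^bsub>A\<^esub> y = u \<otimes>\<^bsub>A\<^esub> (w \<otimes>\<^bsub>A\<^esub> y)"
        using yc P_carrier[OF u(2)] W_carrier[OF u(3)] by (simp add: A.m_assoc)
      then show ?thesis using P_Suc_mult[OF u(2) WB[OF u(3) y]] Suc by simp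
    qed
    have xs: "x \<in> span {x \<otimes>\<^bsub>A\<^esub> y | x y. x \<in> P k \<and> y \<in> W}" using 0(1) Suc by simp
    have "x \<otimes>\<^bsub>A\<^esub> y \<in> P i"
    proof (rule mult_spans_in[OF gens _ P_subspace _ xs span_self[OF yc]])
      show "{y} \<subseteq> carrier A" using yc by simp
      show "s \<otimes>\<^bsub>A\<^esub> t \<in> P i" if "s \<in> {x \<otimes>\<^bsub>A\<^esub> y | x y. x \<in> P k \<and> y \<in> W}" "t \<in> {y}" for s t
        using zy[OF that(1)] that(2) by (simp only: singleton_iff)
    qed
    then show ?thesis by simp
  qed (use 0 BB in simp)
next
  case (Suc j)
  have xc: "x \<in> carrier A" by (rule P_carrier[OF Suc.prems(1)])
  have xz: "x \<otimes>\<^bsub>A\<^esub> z \<in> P (i + Suc j)" if "z \<in> {u \<otimes>\<^bsub>A\<^esub> w | u w. u \<in> P j \<and> w \<in> W}" for z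
  proof -
    from that obtain u w where u: "z = u \<otimes>\<^bsub>A\<^esub> w" "u \<in> P j" "w \<in> W" by blast
    then have "x \<otimes>\<^bsub>A\<^esub> z = (x \<otimes>\<^bsub>A\<^esub> u) \<otimes>\<^bsub>A\<^esub> w"
      using xc P_carrier[OF u(2)] W_carrier[OF u(3)] by (simp add: A.m_assoc)
    then show ?thesis using P_Suc_mult[OF Suc.IH[OF Suc.prems(1) u(2)] u(3)] by simp
  qed
  have ys: "y \<in> span {u \<otimes>\<^bsub>A\<^esub> w | u w. u \<in> P j \<and> w \<in> W}" using Suc.prems(2) by simp
  show ?case
  proof (rule mult_spans_in[OF _ gens_carrier P_subspace _ span_self[OF xc] ys])
    show "{x} \<subseteq> carrier A" using xc by simp
    show "s \<otimes>\<^bsub>A\<^esub> t \<in> P (i + Suc j)"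
      if "s \<in> {x}" "t \<in> {u \<otimes>\<^bsub>A\<^esub> w | u w. u \<in> P j \<and> w \<in> W}" for s t
      using xz[OF that(2)] that(1) by (simp only: singleton_iff)
  qed
qed

end

context filtered_algebra
begin

text \<open>Let \<open>B n\<close> be the part of \<open>F n\<close> inside the \<open>n\<close>-th
  power, enlarged by the preceding term. This is a subalgebra family agreeing with \<open>F\<close>
  in low degrees, so affineness of gr A forces \<open>B\<close> to be \<open>F\<close>; the
  enlargement is then removed by induction on \<open>n\<close>.\<close>

lemma F_in_powers:
  assumes grA: "affine_algebra K (gr_algebra A F)"
  obtains D where "\<And>n. F n \<subseteq> subspace_power K A (F 0) (F D) n" "subspace_powers K A (F 0) (F D)"
proof -
  obtain D where D: "\<And>B. subalgebra_family B \<Longrightarrow> \<forall>n\<le>D. B n = F n \<Longrightarrow> \<forall>n. B n = F n"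
    using affine_family[OF grA] by blast
  let ?D = "Suc D"
  interpret Q: subspace_powers K A "F 0" "F ?D"
  proof (intro subspace_powers.intro subspace_powers_axioms.intro assoc_algebra_axioms)
    show "F 0 \<subseteq> F ?D" by (rule R.F_mono) simp
    show "x \<otimes>\<^bsub>A\<^esub> y \<in> F ?D" if "x \<in> F ?D" "y \<in> F 0" for x y
      using R.F_mult[OF that] by simp
    show "x \<otimes>\<^bsub>A\<^esub> y \<in> F 0" if "x \<in> F 0" "y \<in> F 0" for x y
      using R.F_mult[OF that] by simp
  qed (rule R.F_subspace R.one_in_F)+
  \<comment> \<open>In degree 0 this is the choice of the zeroth power; for positive
    \<open>n\<close> all of \<open>F ?D\<close> already lies in the first power.\<close>
  have small: "F n \<subseteq> Q.P n" if "n \<le> ?D" for n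
  proof (cases n)
    case (Suc m)
    have "F ?D \<subseteq> Q.P 1"
    proof
      fix x assume "x \<in> F ?D"
      then show "x \<in> Q.P 1"
        using Q.P_Suc_mult[of "\<one>\<^bsub>A\<^esub>" 0 x] R.one_in_F R.F_carrier[of x ?D] by simp
    qed
    moreover have "F n \<subseteq> F ?D" by (rule R.F_mono[OF that])
    moreover have "Q.P 1 \<subseteq> Q.P n" using Suc by (intro Q.P_mono) simp
    ultimately show ?thesis by blast
  qed simp
  define B where "B n = {x \<oplus>\<^bsub>A\<^esub> z | x z. x \<in> F n \<inter> Q.P n \<and> z \<in> preceding A F n}" for n
  have FP: "VectorSpace.subspace K (F n \<inter> Q.P n) A" for n
    by (intro subspace_Int R.F_subspace Q.P_subspace)
  note FP' = subspaceD[OF FP] and pr' = subspaceD[OF R.preceding_subspace]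
  have BI: "x \<oplus>\<^bsub>A\<^esub> z \<in> B n" if "x \<in> F n \<inter> Q.P n" "z \<in> preceding A F n" for x z n
    using that unfolding B_def by blast
  have Fc: "x \<in> F n \<inter> Q.P n \<Longrightarrow> x \<in> carrier A" for x n using FP'(1) by blast
  have pc: "x \<in> preceding A F n \<Longrightarrow> x \<in> carrier A" for x n using pr'(1) by blast
  have FPB: "F n \<inter> Q.P n \<subseteq> B n" for n
  proof
    fix x assume x: "x \<in> F n \<inter> Q.P n"
    then show "x \<in> B n" using BI[OF x pr'(2)] Fc[OF x] by simp
  qed
  have preB: "preceding A F n \<subseteq> B n" for n
  proof
    fix x assume x: "x \<in> preceding A F n"
    then show "x \<in> B n" using BI[OF FP'(2) x] pc[OF x] by simp
  qed
  have pF: "x \<in> preceding A F n \<Longrightarrow> x \<in> F n" for x n using R.preceding_subset_F by blast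
  have BF: "B n \<subseteq> F n" for n
    unfolding B_def using R.F(3) pF by auto
  have "VectorSpace.subspace K (B n) A" for n
  proof (rule subspaceI)
    show "B n \<subseteq> carrier A" using BF R.F(1) by blast
    show "\<zero>\<^bsub>A\<^esub> \<in> B n" using preB pr'(2) by blast
  next
    fix x y assume "x \<in> B n" "y \<in> B n"
    then obtain u v u' v' where *: "u \<in> F n \<inter> Q.P n" "v \<in> preceding A F n" "x = u \<oplus>\<^bsub>A\<^esub> v"
      "u' \<in> F n \<inter> Q.P n" "v' \<in> preceding A F n" "y = u' \<oplus>\<^bsub>A\<^esub> v'" unfolding B_def by blast
    have "x \<oplus>\<^bsub>A\<^esub> y = (u \<oplus>\<^bsub>A\<^esub> u') \<oplus>\<^bsub>A\<^esub> (v \<oplus>\<^bsub>A\<^esub> v')"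
      using Fc[OF *(1)] Fc[OF *(4)] pc[OF *(2)] pc[OF *(5)] by (simp add: *(3,6) M.a_ac)
    then show "x \<oplus>\<^bsub>A\<^esub> y \<in> B n" using BI[OF FP'(3)[OF *(1,4)] pr'(3)[OF *(2,5)]] by simp
  next
    fix c x assume c: "c \<in> carrier K" and "x \<in> B n"
    then obtain u v where *: "u \<in> F n \<inter> Q.P n" "v \<in> preceding A F n" "x = u \<oplus>\<^bsub>A\<^esub> v"
      unfolding B_def by blast
    have "c \<odot>\<^bsub>A\<^esub> x = c \<odot>\<^bsub>A\<^esub> u \<oplus>\<^bsub>A\<^esub> c \<odot>\<^bsub>A\<^esub> v"
      using Fc[OF *(1)] pc[OF *(2)] c by (simp add: *(3) smult_r_distr)
    then show "c \<odot>\<^bsub>A\<^esub> x \<in> B n" using BI[OF FP'(4)[OF c *(1)] pr'(4)[OF c *(2)]] by simp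
  qed
  moreover have "\<one>\<^bsub>A\<^esub> \<in> B 0" using FPB[of 0] R.one_in_F by auto
  moreover have "x \<otimes>\<^bsub>A\<^esub> y \<in> B (i + j)" if "x \<in> B i" "y \<in> B j" for x y i j
  proof -
    from that obtain u v u' v' where *: "u \<in> F i \<inter> Q.P i" "v \<in> preceding A F i" "x = u \<oplus>\<^bsub>A\<^esub> v"
      "u' \<in> F j \<inter> Q.P j" "v' \<in> preceding A F j" "y = u' \<oplus>\<^bsub>A\<^esub> v'" unfolding B_def by blast
    note c = Fc[OF *(1)] Fc[OF *(4)] pc[OF *(2)] pc[OF *(5)]
    \<comment> \<open>Each of the last two products has a factor from a preceding term, so it lies
      in the preceding term of degree \<open>i + j\<close>.\<close>
    have "x \<otimes>\<^bsub>A\<^esub> y = u \<otimes>\<^bsub>A\<^esub> u' \<oplus>\<^bsub>A\<^esub> (u \<otimes>\<^bsub>A\<^esub> v' \<oplus>\<^bsub>A\<^esub> v \<otimes>\<^bsub>A\<^esub> y)"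
      using c by (simp add: *(3,6) A.l_distr A.r_distr M.a_ac)
    moreover have "u \<otimes>\<^bsub>A\<^esub> u' \<in> F (i + j) \<inter> Q.P (i + j)"
      using * R.F_mult Q.P_mult by blast
    moreover have "u \<otimes>\<^bsub>A\<^esub> v' \<in> preceding A F (i + j)" using * by (intro P.m_pre_right) auto
    moreover have "v \<otimes>\<^bsub>A\<^esub> y \<in> preceding A F (i + j)"
      using * that(2) BF by (intro P.m_pre_left) auto
    ultimately show ?thesis using BI pr'(3) by simp
  qed
  ultimately have "subalgebra_family B" unfolding subalgebra_family_def using preB BF by blast
  moreover have "B n = F n" if "n \<le> D" for n
    using small[of n] that FPB[of n] BF[of n] by auto
  ultimately have B: "B n = F n" for n using D by blast
  have "F n \<subseteq> Q.P n" for n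
  proof (induction n)
    case (Suc n)
    show ?case
    proof
      fix x assume "x \<in> F (Suc n)"
      then obtain u v where "u \<in> Q.P (Suc n)" "v \<in> F n" "x = u \<oplus>\<^bsub>A\<^esub> v"
        using B[of "Suc n"] unfolding B_def preceding_simps by blast
      then show "x \<in> Q.P (Suc n)" using Suc Q.P_Suc[of n] subspaceD(3)[OF Q.P_subspace] by blast
    qed
  qed simp
  then show thesis using that[of ?D] Q.subspace_powers_axioms by blast
qed

end

section \<open>Growth of powers against standard filtrations\<close>

lemma fin_dim_subspace_in_chain:
  assumes V: "vectorspace K V" and U: "fin_dim_subspace K U V"
    and E: "\<And>n. VectorSpace.subspace K (E n) V" "\<And>n. E n \<subseteq> E (Suc n)" and UE: "U \<subseteq> (\<Union>n. E n)"
  shows "\<exists>c. U \<subseteq> E c"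
proof -
  interpret vectorspace K V by (rule V)
  obtain S where S: "finite S" "S \<subseteq> U" "span S = U" by (rule fin_dim_subspace_ex_span[OF V U])
  have mono: "E i \<subseteq> E j" if "i \<le> j" for i j using E(2) that by (rule lift_Suc_mono_le)
  have "S \<subseteq> (\<Union>n. E n)" using S(2) UE by (rule subset_trans)
  with S(1) have "\<exists>c. S \<subseteq> E c"
  proof (induction S rule: finite_induct)
    case (insert x S)
    then obtain c d where "S \<subseteq> E c" "x \<in> E d" by auto
    then have "insert x S \<subseteq> E (max c d)" using mono[of c "max c d"] mono[of d "max c d"] by auto
    then show ?case ..
  qed simp
  then obtain c where "S \<subseteq> E c" ..
  then have "span S \<subseteq> E c" by (rule span_minimal[OF _ E(1)])
  then show ?thesis using S(3) by auto
qed

lemma power_space_powers: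
  assumes A: "assoc_algebra K A"
    and W: "VectorSpace.subspace K W A" and one: "\<one>\<^bsub>A\<^esub> \<in> W"
  shows "subspace_powers K A (module.span K A {\<one>\<^bsub>A\<^esub>}) W"
proof (intro subspace_powers.intro subspace_powers_axioms.intro A W)
  interpret assoc_algebra K A by (rule A)
  have 1: "{\<one>\<^bsub>A\<^esub>} \<subseteq> carrier A" by simp
  show sub: "VectorSpace.subspace K (span {\<one>\<^bsub>A\<^esub>}) A" using 1 by (rule span_is_subspace)
  show one1: "\<one>\<^bsub>A\<^esub> \<in> span {\<one>\<^bsub>A\<^esub>}" by (rule span_self) simp
  show "span {\<one>\<^bsub>A\<^esub>} \<subseteq> W" using one W by (intro span_minimal) auto
  show "x \<otimes>\<^bsub>A\<^esub> y \<in> span {\<one>\<^bsub>A\<^esub>}" if "x \<in> span {\<one>\<^bsub>A\<^esub>}" "y \<in> span {\<one>\<^bsub>A\<^esub>}" for x y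
    by (rule mult_spans_in[OF 1 1 sub _ that]) (use one1 in \<open>simp add: singleton_iff\<close>)
  show "x \<otimes>\<^bsub>A\<^esub> y \<in> W" if "x \<in> W" "y \<in> span {\<one>\<^bsub>A\<^esub>}" for x y
  proof -
    have xc: "x \<in> carrier A" using that(1) subspaceD(1)[OF W] by auto
    then show ?thesis
      using that(1) by (intro mult_spans_in[OF _ 1 W _ span_self[OF xc] that(2)]) auto
  qed
qed

text \<open>The union is a subspace and a subring, since any two elements lie in a common power, and
  it contains \<open>W\<close> through the first power.\<close>

lemma (in subspace_powers) P_Un:
  assumes "generated_subalgebra K A W = carrier A"
  shows "(\<Union>n. P n) = carrier A"
proof
  show "(\<Union>n. P n) \<subseteq> carrier A" using P_carrier by auto
  have both: "\<exists>k. x \<in> P k \<and> y \<in> P k" if "x \<in> (\<Union>n. P n)" "y \<in> (\<Union>n. P n)" for x y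
  proof -
    from that obtain i j where "x \<in> P i" "y \<in> P j" by auto
    then have "x \<in> P (max i j)" "y \<in> P (max i j)"
      using P_mono[of i "max i j"] P_mono[of j "max i j"] by auto
    then show ?thesis by blast
  qed
  have sp: "VectorSpace.subspace K (\<Union>n. P n) A"
  proof (rule subspaceI)
    show "(\<Union>n. P n) \<subseteq> carrier A" using P_carrier by auto
    show "\<zero>\<^bsub>A\<^esub> \<in> (\<Union>n. P n)" using subspaceD(2)[OF P_subspace] by auto
    show "x \<oplus>\<^bsub>A\<^esub> y \<in> (\<Union>n. P n)" if "x \<in> (\<Union>n. P n)" "y \<in> (\<Union>n. P n)" for x y
      using both[OF that] subspaceD(3)[OF P_subspace] by blast
    show "c \<odot>\<^bsub>A\<^esub> x \<in> (\<Union>n. P n)" if "c \<in> carrier K" "x \<in> (\<Union>n. P n)" for c x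
      using that subspaceD(4)[OF P_subspace] by blast
  qed
  have sr: "subring (\<Union>n. P n) A"
  proof (rule A.subringI)
    show "(\<Union>n. P n) \<subseteq> carrier A" using P_carrier by auto
    have "\<one>\<^bsub>A\<^esub> \<in> P 0" using one_B by simp
    then show "\<one>\<^bsub>A\<^esub> \<in> (\<Union>n. P n)" by blast
    show "\<ominus>\<^bsub>A\<^esub> x \<in> (\<Union>n. P n)" if "x \<in> (\<Union>n. P n)" for x
      using that by (rule subspaceD(5)[OF sp])
    show "x \<oplus>\<^bsub>A\<^esub> y \<in> (\<Union>n. P n)" if "x \<in> (\<Union>n. P n)" "y \<in> (\<Union>n. P n)" for x y
      using that by (rule subspaceD(3)[OF sp])
    show "x \<otimes>\<^bsub>A\<^esub> y \<in> (\<Union>n. P n)" if "x \<in> (\<Union>n. P n)" "y \<in> (\<Union>n. P n)" for x y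
      using that P_mult by blast
  qed
  have "W \<subseteq> P 1"
  proof
    fix x assume x: "x \<in> W"
    have "\<one>\<^bsub>A\<^esub> \<in> P 0" using one_B by simp
    from P_Suc_mult[OF this x] show "x \<in> P 1" using W_carrier[OF x] by simp
  qed
  then have "W \<subseteq> (\<Union>n. P n)" by blast
  then show "carrier A \<subseteq> (\<Union>n. P n)"
    using assms sp sr unfolding generated_subalgebra_def by blast
qed

context algebra_module
begin

context
  fixes W :: "'a set" and G :: "'m set"
  assumes W: "VectorSpace.subspace K W A" "\<one>\<^bsub>A\<^esub> \<in> W" and G: "G \<subseteq> carrier M"
begin

interpretation Q: subspace_powers K A "AK.span {\<one>\<^bsub>A\<^esub>}" W
  by (rule power_space_powers[OF assoc_algebra W])

abbreviation growth :: "nat \<Rightarrow> 'm set" where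
  "growth n \<equiv> product_space K A M (power_space K A W n) G"

lemma growth_generators: "{a \<odot>\<^bsub>M\<^esub> x | a x. a \<in> power_space K A W n \<and> x \<in> G} \<subseteq> carrier M"
  using G Q.P_carrier by (auto simp: power_space_eq intro!: L.smult_closed)

lemma growth_subspace: "VectorSpace.subspace K (growth n) V"
  unfolding product_space_def by (rule V.span_is_subspace) (use growth_generators in simp)

lemma growth_memI: "a \<in> power_space K A W n \<Longrightarrow> x \<in> G \<Longrightarrow> a \<odot>\<^bsub>M\<^esub> x \<in> growth n"
  unfolding product_space_def
  using V.in_own_span[of "{a \<odot>\<^bsub>M\<^esub> x | a x. a \<in> power_space K A W n \<and> x \<in> G}"]
    growth_generators by auto

lemma growth_minimal:
  assumes "VectorSpace.subspace K U V" "\<And>a x. a \<in> power_space K A W n \<Longrightarrow> x \<in> G \<Longrightarrow> a \<odot>\<^bsub>M\<^esub> x \<in> U"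
  shows "growth n \<subseteq> U"
  unfolding product_space_def using assms by (intro V.span_minimal) auto

lemma growth_mono: "i \<le> j \<Longrightarrow> growth i \<subseteq> growth j"
  using Q.P_mono[of i j]
  by (intro growth_minimal growth_subspace growth_memI) (auto simp: power_space_eq)

lemma smult_growth:
  assumes "a \<in> power_space K A W i" "x \<in> growth n"
  shows "a \<odot>\<^bsub>M\<^esub> x \<in> growth (i + n)"
proof (rule smult_span_in[OF growth_generators growth_subspace _ _ assms(2)[unfolded product_space_def]])
  show ac: "a \<in> carrier A" using assms(1) Q.P_carrier by (simp add: power_space_eq)
  fix y assume "y \<in> {a \<odot>\<^bsub>M\<^esub> x | a x. a \<in> power_space K A W n \<and> x \<in> G}"
  then obtain b x where y: "y = b \<odot>\<^bsub>M\<^esub> x" "b \<in> power_space K A W n" "x \<in> G" by blast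
  have "b \<in> carrier A" using y(2) Q.P_carrier by (simp add: power_space_eq)
  moreover have "x \<in> carrier M" using y(3) G by blast
  ultimately have "a \<odot>\<^bsub>M\<^esub> y = (a \<otimes>\<^bsub>A\<^esub> b) \<odot>\<^bsub>M\<^esub> x" using ac y(1) by (simp add: L.smult_assoc)
  moreover have "a \<otimes>\<^bsub>A\<^esub> b \<in> power_space K A W (i + n)"
    using assms(1) y(2) Q.P_mult by (simp add: power_space_eq)
  ultimately show "a \<odot>\<^bsub>M\<^esub> y \<in> growth (i + n)" using growth_memI y(3) by simp
qed

text \<open>The powers of \<open>W\<close> exhaust A and exponents add, which makes the union a
  submodule; it contains \<open>G\<close> through the multiples by one in exponent 0.\<close>

lemma growth_Un:
  assumes "generated_subalgebra K A W = carrier A" "generated_submodule A M G = carrier M"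
  shows "(\<Union>n. growth n) = carrier M"
proof (rule generated_submodule_eq_carrierD[OF assms(2)])
  note gr = V.subspaceD[OF growth_subspace, simplified V_simps V_minus]
  show "Module.submodule (\<Union>n. growth n) A M"
  proof (rule submoduleI)
    show "(\<Union>n. growth n) \<subseteq> carrier M" using gr(1) by blast
    show "\<zero>\<^bsub>M\<^esub> \<in> (\<Union>n. growth n)" using gr(2) by blast
    show "x \<oplus>\<^bsub>M\<^esub> y \<in> (\<Union>n. growth n)" if xy: "x \<in> (\<Union>n. growth n)" "y \<in> (\<Union>n. growth n)" for x y
    proof -
      from xy obtain i j where "x \<in> growth i" "y \<in> growth j" by auto
      then have "x \<in> growth (max i j)" "y \<in> growth (max i j)"
        using growth_mono[of i "max i j"] growth_mono[of j "max i j"] by auto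
      then show ?thesis using gr(3) by blast
    qed
    show "a \<odot>\<^bsub>M\<^esub> x \<in> (\<Union>n. growth n)" if ax: "a \<in> carrier A" "x \<in> (\<Union>n. growth n)" for a x
    proof -
      have "a \<in> (\<Union>n. power_space K A W n)" using ax(1) Q.P_Un[OF assms(1)] by (simp add: power_space_eq)
      then show ?thesis using ax(2) smult_growth by blast
    qed
  qed
  show "G \<subseteq> (\<Union>n. growth n)"
  proof
    fix x assume x: "x \<in> G"
    have "\<one>\<^bsub>A\<^esub> \<in> power_space K A W 0" using Q.one_B by simp
    from growth_memI[OF this x] have "x \<in> growth 0"
      using subsetD[OF G x] by (simp only: L.smult_one)
    then show "x \<in> (\<Union>n. growth n)" by blast
  qed
qed

end

end

context filtered_algebra_module
begin

sublocale FA: filtered_algebra K A F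
  using AK.assoc_algebra_axioms algebra_filtration
  by (simp add: filtered_algebra_def filtered_algebra_axioms_def)

text \<open>Finite-dimensional spaces lie in single terms of exhausting chains. So \<open>W\<close>
  lies in some \<open>F a\<close> and its powers in \<open>F (a * n)\<close>; conversely some
  \<open>F D\<close> lies in a power of \<open>W\<close>, while \<open>F n\<close> lies in the
  \<open>n\<close>-th power of \<open>F D\<close>. The module generators \<open>G\<close> and
  \<open>X\<close> only add constants to the index.\<close>

lemma growth_comparison:
  assumes grA: "affine_algebra K (gr_algebra A F)" and fd: "fin_dim_filtration K A F"
    and gens: "GK_generators K A M W G"
    and X: "finite X" "X \<subseteq> UNIV \<times> carrier M" "generated_submodule A M (snd ` X) = carrier M"
  obtains a b c c' where "a > 0" "c > 0"
    "\<And>n. growth W G n \<subseteq> filt X (a * n + b)" "\<And>n. filt X n \<subseteq> growth W G (c * n + c')"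
proof -
  have g: "fin_dim_subspace K W A" "\<one>\<^bsub>A\<^esub> \<in> W" "generated_subalgebra K A W = carrier A"
    "fin_dim_subspace K G V" "generated_submodule A M G = carrier M"
    using gens by (auto simp: GK_generators_def)
  have W: "VectorSpace.subspace K W A" using g(1) by (simp add: fin_dim_subspace_def)
  have Gc: "G \<subseteq> carrier M" using g(4) V.subspaceD(1)[of G] by (auto simp: fin_dim_subspace_def)
  interpret Q: subspace_powers K A "AK.span {\<one>\<^bsub>A\<^esub>}" W
    by (rule power_space_powers[OF assoc_algebra W g(2)])
  have Q_Un: "(\<Union>n. Q.P n) = carrier A" by (rule Q.P_Un[OF g(3)])
  have "\<exists>a. W \<subseteq> F a"
  proof (rule fin_dim_subspace_in_chain[where E = F, OF AK.vectorspace_axioms g(1) F_subspace F_Suc])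
    show "W \<subseteq> (\<Union>i. F i)" using F_Un Q.W_carrier by auto
  qed
  then obtain a0 where "W \<subseteq> F a0" ..
  \<comment> \<open>Passing to the successor makes the factor of the index positive; the same
    happens for \<open>c\<close> below.\<close>
  then have a: "W \<subseteq> F (Suc a0)" using F_Suc[of a0] by blast
  have "\<exists>b. G \<subseteq> filt X b"
    by (rule fin_dim_subspace_in_chain[where E = "filt X", OF V.vectorspace_axioms g(4) filt_subspace[OF X(2)]
          filt_mono[OF X(2)]])
      (use filt_Un_iff[OF X(2)] X(3) Gc in simp_all)
  then obtain b where b: "G \<subseteq> filt X b" ..
  have QF: "Q.P n \<subseteq> F (Suc a0 * n)" for n
  proof (induction n)
    case 0
    have "AK.span {\<one>\<^bsub>A\<^esub>} \<subseteq> F 0" using one_in_F by (intro AK.span_minimal F_subspace) simp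
    then show ?case by simp
  next
    case (Suc n)
    show ?case
    proof (rule Q.P_Suc_minimal[OF F_subspace])
      fix x y assume "x \<in> Q.P n" "y \<in> W"
      then have "x \<otimes>\<^bsub>A\<^esub> y \<in> F (Suc a0 * n + Suc a0)" using Suc a by (intro F_mult) auto
      then show "x \<otimes>\<^bsub>A\<^esub> y \<in> F (Suc a0 * Suc n)" by (simp add: algebra_simps)
    qed
  qed
  have upper: "growth W G n \<subseteq> filt X (Suc a0 * n + b)" for n
  proof (rule growth_minimal[OF W g(2) Gc filt_subspace[OF X(2)]])
    fix u x assume u: "u \<in> power_space K A W n" and x: "x \<in> G"
    have "u \<in> F (Suc a0 * n)" using subsetD[OF QF] u unfolding power_space_eq by blast
    then show "u \<odot>\<^bsub>M\<^esub> x \<in> filt X (Suc a0 * n + b)" using x b by (intro smult_filt[OF X(2)]) auto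
  qed
  obtain D where D: "\<And>n. F n \<subseteq> subspace_power K A (F 0) (F D) n" "subspace_powers K A (F 0) (F D)"
    using FA.F_in_powers[OF grA] by blast
  interpret R: subspace_powers K A "F 0" "F D" by (rule D(2))
  have "\<exists>c. F D \<subseteq> Q.P c"
  proof (rule fin_dim_subspace_in_chain[where E = Q.P, OF AK.vectorspace_axioms _ Q.P_subspace Q.P_Suc])
    show "fin_dim_subspace K (F D) A" using fd by (simp add: fin_dim_filtration_def)
    show "F D \<subseteq> (\<Union>n. Q.P n)" unfolding Q_Un by (rule F(1))
  qed
  then obtain c0 where "F D \<subseteq> Q.P c0" ..
  then have c: "F D \<subseteq> Q.P (Suc c0)" using Q.P_Suc[of c0] by blast
  \<comment> \<open>The additional \<open>Suc c0\<close> pays for the zeroth power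
    \<open>F 0\<close>, which need not consist of scalars and is bounded through
    \<open>F D\<close>.\<close>
  have RQ: "R.P n \<subseteq> Q.P (Suc c0 * n + Suc c0)" for n
  proof (induction n)
    case 0
    then show ?case using R.BW c by simp
  next
    case (Suc n)
    show ?case
    proof (rule R.P_Suc_minimal[OF Q.P_subspace])
      fix x y assume "x \<in> R.P n" "y \<in> F D"
      then have "x \<otimes>\<^bsub>A\<^esub> y \<in> Q.P (Suc c0 * n + Suc c0 + Suc c0)" using Suc c by (intro Q.P_mult) auto
      then show "x \<otimes>\<^bsub>A\<^esub> y \<in> Q.P (Suc c0 * Suc n + Suc c0)" by (simp add: algebra_simps)
    qed
  qed
  have "\<exists>e. snd ` X \<subseteq> growth W G e"
  proof -
    have Xc: "snd ` X \<subseteq> carrier V" using X(2) by auto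
    have "\<exists>e. V.span (snd ` X) \<subseteq> growth W G e"
    proof (rule fin_dim_subspace_in_chain[where E = "growth W G", OF V.vectorspace_axioms])
      show "fin_dim_subspace K (V.span (snd ` X)) V"
        using X(1) Xc by (intro fin_dim_subspace_span V.vectorspace_axioms) auto
      show "VectorSpace.subspace K (growth W G n) V" for n by (rule growth_subspace[OF W g(2) Gc])
      show "growth W G n \<subseteq> growth W G (Suc n)" for n by (rule growth_mono[OF W g(2) Gc]) simp
      show "V.span (snd ` X) \<subseteq> (\<Union>n. growth W G n)"
        using growth_Un[OF W g(2) Gc g(3,5)] V.span_is_subset2[OF Xc] by simp
    qed
    then obtain e where "V.span (snd ` X) \<subseteq> growth W G e" ..
    with V.in_own_span[OF Xc] have "snd ` X \<subseteq> growth W G e" by (rule subset_trans)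
    then show ?thesis ..
  qed
  then obtain e where e: "snd ` X \<subseteq> growth W G e" ..
  have lower: "filt X n \<subseteq> growth W G (Suc c0 * n + (Suc c0 + e))" for n
  proof (rule filt_subset[OF X(2) growth_subspace[OF W g(2) Gc]])
    fix u i x assume *: "(i, x) \<in> X" "i \<le> n" "u \<in> F (n - i)"
    \<comment> \<open>The degree of the generator is forgotten here: \<open>F (n - i)\<close> is
      simply enlarged to \<open>F n\<close>.\<close>
    have "u \<in> F n" using * F_mono[of "n - i" n] by auto
    then have "u \<in> power_space K A W (Suc c0 * n + Suc c0)"
      using D(1)[of n] RQ[of n] unfolding power_space_eq by blast
    moreover have "x \<in> growth W G e" using *(1) e by force
    ultimately have "u \<odot>\<^bsub>M\<^esub> x \<in> growth W G (Suc c0 * n + Suc c0 + e)"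
      by (rule smult_growth[OF W g(2) Gc])
    then show "u \<odot>\<^bsub>M\<^esub> x \<in> growth W G (Suc c0 * n + (Suc c0 + e))" by (simp only: add.assoc)
  qed
  show thesis by (rule that[OF _ _ upper lower]) simp_all
qed

text \<open>Adjoining one to algebra generators and passing to spans yields admissible data. A
  witness is required because \<open>GK\<close> selects its value by \<open>SOME\<close>.\<close>

lemma exists_GK_generators:
  assumes A: "affine_algebra K A" and X: "finite X" "X \<subseteq> UNIV \<times> carrier M"
    "generated_submodule A M (snd ` X) = carrier M"
  shows "\<exists>W G. GK_generators K A M W G"
proof -
  interpret B: affine_algebra K A by (rule A)
  obtain S where S: "finite S" "S \<subseteq> carrier A" "generated_subalgebra K A S = carrier A"
    using B.finitely_generated by blast
  let ?S = "insert \<one>\<^bsub>A\<^esub> S" and ?W = "AK.span (insert \<one>\<^bsub>A\<^esub> S)" and ?G = "V.span (snd ` X)"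
  have Sc: "?S \<subseteq> carrier A" using S(2) by simp
  have SW: "?S \<subseteq> ?W" by (rule AK.in_own_span[OF Sc])
  have "VectorSpace.subspace K (carrier A) A" by (rule AK.subspace_carrier)
  moreover have "subring (carrier A) A" by (rule A.carrier_is_subring)
  moreover have "?W \<subseteq> carrier A" by (rule AK.span_is_subset2[OF Sc])
  ultimately have "generated_subalgebra K A ?W \<subseteq> carrier A" unfolding generated_subalgebra_def by blast
  moreover have "generated_subalgebra K A S \<subseteq> generated_subalgebra K A ?W"
    using SW unfolding generated_subalgebra_def by blast
  ultimately have W: "generated_subalgebra K A ?W = carrier A" using S(3) by simp
  have Xc: "snd ` X \<subseteq> carrier M" using X(2) by auto
  have G: "generated_submodule A M ?G = carrier M"
  proof (rule generated_submodule_eq_carrierI)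
    show "?G \<subseteq> carrier M" using V.span_is_subset2[of "snd ` X"] Xc by simp
    fix N assume N: "Module.submodule N A M" "?G \<subseteq> N"
    have "snd ` X \<subseteq> N" using N(2) V.in_own_span[of "snd ` X"] Xc by auto
    then show "carrier M \<subseteq> N" using generated_submodule_eq_carrierD[OF X(3) N(1)] by simp
  qed
  have "GK_generators K A M ?W ?G"
    unfolding GK_generators_def
  proof (intro conjI W G)
    show "fin_dim_subspace K ?W A" "fin_dim_subspace K ?G V"
      using S(1) X(1) Sc Xc
      by (simp_all add: fin_dim_subspace_span AK.vectorspace_axioms V.vectorspace_axioms)
    show "\<one>\<^bsub>A\<^esub> \<in> ?W" using SW by simp
  qed
  then show ?thesis by blast
qed

text \<open>Every admissible choice of generating subspaces grows like \<open>filt X\<close> up to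
  linear changes of the index, so all choices give the same limsup and the value selected by
  \<open>SOME\<close> is determined. The zero module is split off because its polynomial 0 has
  degree 0 in HOL, while its dimension is -\<infinity>.\<close>

lemma GK_eq:
  assumes A: "affine_algebra K A" and grA: "affine_algebra K (gr_algebra A F)"
    and fd: "fin_dim_filtration K A F"
    and X: "finite X" "X \<subseteq> UNIV \<times> carrier M" "generated_submodule A M (snd ` X) = carrier M"
    and H: "\<forall>\<^sub>F n in sequentially. poly H (real n) = real (dim_of K V (filt X n))"
  shows "GK K A M = (if carrier M = {\<zero>\<^bsub>M\<^esub>} then -\<infinity> else ereal (real (degree H)))"
    and "carrier M \<noteq> {\<zero>\<^bsub>M\<^esub>} \<Longrightarrow> lead_coeff H > 0" and "carrier M = {\<zero>\<^bsub>M\<^esub>} \<Longrightarrow> H = 0"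
proof -
  have fdX: "fin_dim_subspace K (filt X n) V" for n by (rule filt_fin_dim[OF X(2,1) fd])
  have nz: "lead_coeff H > 0" if M: "carrier M \<noteq> {\<zero>\<^bsub>M\<^esub>}"
  proof -
    obtain x where x: "x \<in> carrier M" "x \<noteq> \<zero>\<^bsub>M\<^esub>" using M M.zero_closed by blast
    then obtain m where m: "x \<in> filt X m" using filt_Un_iff[OF X(2)] X(3) by blast
    have ge: "dim_of K V (filt X n) \<ge> 1" if "n \<ge> m" for n
    proof -
      have "filt X n \<noteq> {\<zero>\<^bsub>V\<^esub>}" using filt_mono[OF X(2) that] m x(2) by auto
      then show ?thesis using dim_of_eq_0_iff[OF V.vectorspace_axioms fdX, of n] by simp
    qed
    \<comment> \<open>A nonzero element lies in all late terms, so their dimensions are at least 1;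
      this excludes \<open>H = 0\<close>.\<close>
    have ev: "\<forall>\<^sub>F n in sequentially. poly H (real n) \<ge> 1"
      using H eventually_ge_at_top[of m] by eventually_elim (use ge in force)
    then have "\<forall>\<^sub>F n in sequentially. poly H (real n) \<ge> 0" by eventually_elim simp
    then have "lead_coeff H \<ge> 0" by (rule lead_coeff_nonneg_if_eventually_nonneg)
    moreover have "H \<noteq> 0" using ev by auto
    ultimately show ?thesis by (simp add: less_le)
  qed
  then show "carrier M \<noteq> {\<zero>\<^bsub>M\<^esub>} \<Longrightarrow> lead_coeff H > 0" .
  show "H = 0" if M: "carrier M = {\<zero>\<^bsub>M\<^esub>}"
  proof -
    have "filt X n = {\<zero>\<^bsub>V\<^esub>}" for n using filtD(1,2)[OF X(2), of n] M by auto
    then have "dim_of K V (filt X n) = 0" for n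
      using dim_of_eq_0_iff[OF V.vectorspace_axioms fdX] by simp
    \<comment> \<open>A polynomial vanishing at all large integers has infinitely many
      roots.\<close>
    then have ev: "\<forall>\<^sub>F n in sequentially. poly H (real n) = 0" using H by simp
    show ?thesis
    proof (rule ccontr)
      assume "H \<noteq> 0"
      then have "finite {x. poly H x = 0}" by (rule poly_roots_finite)
      moreover obtain N where N: "\<And>n. n \<ge> N \<Longrightarrow> poly H (real n) = 0"
        using ev unfolding eventually_sequentially by blast
      have "real ` {N..} \<subseteq> {x. poly H x = 0}" using N by auto
      ultimately have "finite (real ` {N..})" by (rule rev_finite_subset)
      then have "finite {N..}" by (rule finite_imageD) (simp add: inj_on_def)
      then show False by (simp add: infinite_Ici)
    qed
  qed
  have lim: "limsup (\<lambda>n. log_dim n (dim_of K V (growth W G n)))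
      = (if carrier M = {\<zero>\<^bsub>M\<^esub>} then -\<infinity> else ereal (real (degree H)))"
    if gens: "GK_generators K A M W G" for W G
  proof -
    have g: "VectorSpace.subspace K W A" "\<one>\<^bsub>A\<^esub> \<in> W" "G \<subseteq> carrier M"
      using gens V.subspaceD(1)[of G] by (auto simp: GK_generators_def fin_dim_subspace_def)
    obtain a b c c' where ac: "a > 0" "c > 0" "\<And>n. growth W G n \<subseteq> filt X (a * n + b)"
      "\<And>n. filt X n \<subseteq> growth W G (c * n + c')"
      by (rule growth_comparison[OF grA fd gens X]) (rule that)
    note mono = fin_dim_subspace_mono[OF V.vectorspace_axioms]
    \<comment> \<open>Finite-dimensionality of the growth spaces is inherited from the terms of the
      standard filtration containing them.\<close>
    have fdG: "fin_dim_subspace K (growth W G n) V" for n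
      using mono(1)[OF fdX growth_subspace[OF g] ac(3)] .
    have upper: "dim_of K V (growth W G n) \<le> dim_of K V (filt X (a * n + b))" for n
      using mono(2)[OF fdX growth_subspace[OF g] ac(3)] .
    have lower: "dim_of K V (filt X n) \<le> dim_of K V (growth W G (c * n + c'))" for n
      using mono(2)[OF fdG filt_subspace[OF X(2)] ac(4)] .
    show ?thesis
    proof (cases "carrier M = {\<zero>\<^bsub>M\<^esub>}")
      case True
      then have "growth W G n = {\<zero>\<^bsub>V\<^esub>}" for n
        using V.subspaceD(1,2)[OF growth_subspace[OF g, of n]] by auto
      then have "dim_of K V (growth W G n) = 0" for n
        using dim_of_eq_0_iff[OF V.vectorspace_axioms fdG] by simp
      then show ?thesis using True by (simp add: log_dim_def Limsup_const)
    next
      case False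
      then show ?thesis using limsup_log_dim[OF H nz[OF False] upper ac(1) lower ac(2)] by simp
    qed
  qed
  obtain W G where "GK_generators K A M W G" using exists_GK_generators[OF A X] by blast
  then show "GK K A M = (if carrier M = {\<zero>\<^bsub>M\<^esub>} then -\<infinity> else ereal (real (degree H)))"
    unfolding GK_def
  proof (intro some_equality exI conjI)
    assume gens: "GK_generators K A M W G"
    show "GK_generators K A M W G" by (rule gens)
    show "(if carrier M = {\<zero>\<^bsub>M\<^esub>} then -\<infinity> else ereal (real (degree H)))
      = limsup (\<lambda>n. log_dim n (dim_of K V (growth W G n)))" using lim[OF gens] by simp
  next
    fix d assume "\<exists>W G. GK_generators K A M W G \<and>
      d = limsup (\<lambda>n. log_dim n (dim_of K V (growth W G n)))"
    then obtain W G where "GK_generators K A M W G"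
      "d = limsup (\<lambda>n. log_dim n (dim_of K V (growth W G n)))" by blast
    then show "d = (if carrier M = {\<zero>\<^bsub>M\<^esub>} then -\<infinity> else ereal (real (degree H)))"
      using lim by simp
  qed
qed

end

section \<open>Hilbert-Samuel polynomials and multiplicity\<close>

text \<open>The value at 0 mirrors the GK dimension of the zero module; the plain degree would not
  separate 0 from the nonzero constants.\<close>

definition growth_degree :: "real poly \<Rightarrow> ereal" where
  "growth_degree p = (if p = 0 then -\<infinity> else ereal (real (degree p)))"

text \<open>This number becomes the multiplicity. The factorial makes it an integer whenever the
  polynomial is integral at large integers, and it vanishes only for the zero polynomial.\<close>

definition normalized_lead :: "real poly \<Rightarrow> real" where
  "normalized_lead p = fact (degree p) * lead_coeff p"

lemma growth_add:
  assumes "p = 0 \<or> lead_coeff p > 0" "q = 0 \<or> lead_coeff q > 0"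
  shows "growth_degree (p + q) = max (growth_degree p) (growth_degree q)"
    and "growth_degree p < growth_degree q \<Longrightarrow> normalized_lead (p + q) = normalized_lead q"
    and "growth_degree q < growth_degree p \<Longrightarrow> normalized_lead (p + q) = normalized_lead p"
    and "growth_degree p = growth_degree q \<Longrightarrow>
      normalized_lead (p + q) = normalized_lead p + normalized_lead q"
proof -
  consider "p = 0" | "q = 0" | "p \<noteq> 0" "q \<noteq> 0" "degree p < degree q"
    | "p \<noteq> 0" "q \<noteq> 0" "degree q < degree p" | "p \<noteq> 0" "q \<noteq> 0" "degree p = degree q"
    by linarith
  then have "growth_degree (p + q) = max (growth_degree p) (growth_degree q) \<and>
    (growth_degree p < growth_degree q \<longrightarrow> normalized_lead (p + q) = normalized_lead q) \<and>
    (growth_degree q < growth_degree p \<longrightarrow> normalized_lead (p + q) = normalized_lead p) \<and>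
    (growth_degree p = growth_degree q \<longrightarrow>
      normalized_lead (p + q) = normalized_lead p + normalized_lead q)"
  proof cases
    case 3
    then have "degree (p + q) = degree q" by (simp add: degree_add_eq_right)
    moreover from this 3 have "p + q \<noteq> 0" by auto
    ultimately show ?thesis
      using 3 by (auto simp: growth_degree_def normalized_lead_def coeff_eq_0)
  next
    case 4
    then have "degree (p + q) = degree p" by (simp add: degree_add_eq_left)
    moreover from this 4 have "p + q \<noteq> 0" by auto
    ultimately show ?thesis
      using 4 by (auto simp: growth_degree_def normalized_lead_def coeff_eq_0)
  next
    case 5
    have pos: "Polynomial.coeff (p + q) (degree p) > 0" using assms 5 by simp
    then have "degree p \<le> degree (p + q)" by (intro le_degree) simp
    moreover have "degree (p + q) \<le> degree p" using 5 by (intro degree_add_le) auto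
    ultimately have "degree (p + q) = degree p" by simp
    moreover have "p + q \<noteq> 0" using pos by (metis Polynomial.coeff_0 less_irrefl)
    ultimately show ?thesis
      using 5 by (auto simp: growth_degree_def normalized_lead_def distrib_left)
  qed (auto simp: growth_degree_def normalized_lead_def)
  then show "growth_degree (p + q) = max (growth_degree p) (growth_degree q)"
    "growth_degree p < growth_degree q \<Longrightarrow> normalized_lead (p + q) = normalized_lead q"
    "growth_degree q < growth_degree p \<Longrightarrow> normalized_lead (p + q) = normalized_lead p"
    "growth_degree p = growth_degree q \<Longrightarrow>
      normalized_lead (p + q) = normalized_lead p + normalized_lead q"
    by blast+
qed

lemma poly_map_of_rat: "poly (map_poly of_rat p) (of_rat x) = (of_rat (poly p x) :: real)"
  by (induction p) (simp_all add: map_poly_pCons of_rat_add of_rat_mult)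

text \<open>A homomorphism carries the spanning products of one filtration to those of the other;
  \<open>map_prod id g\<close> leaves the degrees of the generators unchanged.\<close>

lemma filt_image:
  assumes M: "filtered_algebra_module K A M F" and M': "filtered_algebra_module K A M' F"
    and g: "g \<in> module_hom A M M'" and X: "X \<subseteq> UNIV \<times> carrier M"
  shows "std_filtration K A F M' (map_prod id g ` X) n = g ` std_filtration K A F M X n"
proof -
  interpret M: filtered_algebra_module K A M F by (rule M)
  interpret M': filtered_algebra_module K A M' F by (rule M')
  note g' = module_homD[OF g]
  have X': "map_prod id g ` X \<subseteq> UNIV \<times> carrier M'" using X g'(1) by auto
  note fD = M.filtD[OF X, where n = n] and fD' = M'.filtD[OF X', where n = n]
  have g0: "g \<zero>\<^bsub>M\<^esub> = \<zero>\<^bsub>M'\<^esub>"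
    using g'(3)[OF M.A.zero_closed M.M.zero_closed] g'(1)[OF M.M.zero_closed] by simp
  have gs: "g (c \<odot>\<^bsub>M.V\<^esub> x) = c \<odot>\<^bsub>M'.V\<^esub> g x" if "c \<in> carrier K" "x \<in> carrier M" for c x
    using that g'(3)[of "c \<odot>\<^bsub>A\<^esub> \<one>\<^bsub>A\<^esub>" x] by simp
  have sub: "VectorSpace.subspace K (g ` M.filt X n) M'.V"
  proof (rule M'.V.subspaceI)
    show "g ` M.filt X n \<subseteq> carrier M'.V" using fD(1) g'(1) by auto
    show "\<zero>\<^bsub>M'.V\<^esub> \<in> g ` M.filt X n" using fD(2) g0 by force
    show "x \<oplus>\<^bsub>M'.V\<^esub> y \<in> g ` M.filt X n" if "x \<in> g ` M.filt X n" "y \<in> g ` M.filt X n" for x y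
    proof -
      from that obtain u v where u: "u \<in> M.filt X n" "v \<in> M.filt X n" "x = g u" "y = g v" by blast
      have "u \<in> carrier M" "v \<in> carrier M" using u(1,2) fD(1) by blast+
      then have "x \<oplus>\<^bsub>M'.V\<^esub> y = g (u \<oplus>\<^bsub>M\<^esub> v)" using g'(2)[of u v] u(3,4) by simp
      then show ?thesis using fD(3)[OF u(1,2)] by blast
    qed
    show "c \<odot>\<^bsub>M'.V\<^esub> x \<in> g ` M.filt X n" if "c \<in> carrier K" "x \<in> g ` M.filt X n" for c x
    proof -
      from that(2) obtain u where u: "u \<in> M.filt X n" "x = g u" by blast
      then have "u \<in> carrier M" using fD(1) by blast
      then have "c \<odot>\<^bsub>M'.V\<^esub> x = g (c \<odot>\<^bsub>M.V\<^esub> u)" using gs[OF that(1)] u(2) by simp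
      moreover have "c \<odot>\<^bsub>M.V\<^esub> u \<in> M.filt X n"
        using M.V.subspaceD(4)[OF M.filt_subspace[OF X] that(1) u(1)] .
      ultimately show ?thesis by blast
    qed
  qed
  have sub': "VectorSpace.subspace K {x \<in> carrier M. g x \<in> M'.filt (map_prod id g ` X) n} M.V"
  proof (rule M.V.subspaceI)
    fix c x assume *: "c \<in> carrier K" "x \<in> {x \<in> carrier M. g x \<in> M'.filt (map_prod id g ` X) n}"
    then have "c \<odot>\<^bsub>M'.V\<^esub> g x \<in> M'.filt (map_prod id g ` X) n"
      using M'.V.subspaceD(4)[OF M'.filt_subspace[OF X']] by blast
    then have "g (c \<odot>\<^bsub>M.V\<^esub> x) \<in> M'.filt (map_prod id g ` X) n" using gs * by simp
    moreover have "c \<odot>\<^bsub>M.V\<^esub> x \<in> carrier M.V" using * by (intro M.V.smult_closed) auto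
    ultimately show "c \<odot>\<^bsub>M.V\<^esub> x \<in> {x \<in> carrier M. g x \<in> M'.filt (map_prod id g ` X) n}" by simp
  qed (use g0 fD'(2) fD'(3) g'(2) in auto)
  show ?thesis
  proof
    show "M'.filt (map_prod id g ` X) n \<subseteq> g ` M.filt X n"
    proof (rule M'.filt_subset[OF X' sub])
      fix b i y assume *: "(i, y) \<in> map_prod id g ` X" "i \<le> n" "b \<in> F (n - i)"
      then obtain x where x: "(i, x) \<in> X" "y = g x" by auto
      then have "b \<odot>\<^bsub>M'\<^esub> y = g (b \<odot>\<^bsub>M\<^esub> x)"
        using X M.F_carrier[OF *(3)] g'(3) by auto
      then show "b \<odot>\<^bsub>M'\<^esub> y \<in> g ` M.filt X n" using M.filt_memI[OF X x(1) *(2,3)] by blast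
    qed
    have "M.filt X n \<subseteq> {x \<in> carrier M. g x \<in> M'.filt (map_prod id g ` X) n}"
    proof (rule M.filt_subset[OF X sub'])
      fix b i x assume *: "(i, x) \<in> X" "i \<le> n" "b \<in> F (n - i)"
      have xc: "x \<in> carrier M" using * X by auto
      have "(i, g x) \<in> map_prod id g ` X" using *(1) by force
      then have "b \<odot>\<^bsub>M'\<^esub> g x \<in> M'.filt (map_prod id g ` X) n" using *(2,3) by (rule M'.filt_memI[OF X'])
      then show "b \<odot>\<^bsub>M\<^esub> x \<in> {x \<in> carrier M. g x \<in> M'.filt (map_prod id g ` X) n}"
        using g'(3)[OF M.F_carrier[OF *(3)] xc] xc M.F_carrier[OF *(3)] by (simp add: M.L.smult_closed)
    qed
    then show "g ` M.filt X n \<subseteq> M'.filt (map_prod id g ` X) n" by auto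
  qed
qed

section \<open>Hilbert polynomials of finitely generated modules\<close>

locale hilbert_samuel_algebra =
  fixes K :: "'k ring" and A :: "('k, 'a) module" and F :: "nat \<Rightarrow> 'a set"
  assumes affine: "affine_algebra K A"
    and filtration: "algebra_filtration K A F" "fin_dim_filtration K A F"
    and gr_affine: "affine_algebra K (gr_algebra A F)"
    and gr_noetherian: "left_noetherian (gr_algebra A F)"
    and hilbert_samuel: "\<And>(M :: ('a, (nat \<Rightarrow> 'a) set) module) \<Omega>.
      fg_module A M \<Longrightarrow> good_filtration K A F M \<Omega> \<Longrightarrow>
      fin_dim_filtration K (restrict_scalars A M) \<Omega> \<Longrightarrow>
      \<exists>H :: rat poly. \<forall>\<^sub>F n in sequentially.
        poly H (of_nat n) = of_nat (dim_of K (restrict_scalars A M) (\<Omega> n))"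
begin

lemma filtered: "left_module A M \<Longrightarrow> filtered_algebra_module K A M F"
  using affine filtration(1)
  by (simp add: filtered_algebra_module_def filtered_algebra_module_axioms_def algebra_module_def
      affine_algebra_def)

definition filt_gens :: "('a, 'm) module \<Rightarrow> (nat \<times> 'm) set \<Rightarrow> bool" where
  "filt_gens M X \<longleftrightarrow> finite X \<and> X \<subseteq> UNIV \<times> carrier M \<and> generated_submodule A M (snd ` X) = carrier M"

text \<open>A relation instead of a function, because the polynomial depends on the generators
  \<open>X\<close>; what is extracted from it later, its degree and leading coefficient, depends on
  \<open>M\<close> alone.\<close>

definition hilbert_poly :: "('a, 'm) module \<Rightarrow> real poly \<Rightarrow> bool" where
  "hilbert_poly M H \<longleftrightarrow> (\<exists>X. filt_gens M X \<and>
    (\<forall>\<^sub>F n in sequentially.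
      poly H (real n) = real (dim_of K (restrict_scalars A M) (std_filtration K A F M X n))))"

lemma hom_dim:
  assumes M: "left_module A M" and M': "left_module A M'" and g: "g \<in> module_hom A M M'"
    and X: "filt_gens M X"
  shows "dim_of K (restrict_scalars A M) (std_filtration K A F M X n) =
    dim_of K (restrict_scalars A M) {x \<in> std_filtration K A F M X n. g x = \<zero>\<^bsub>M'\<^esub>} +
    dim_of K (restrict_scalars A M') (g ` std_filtration K A F M X n)"
proof -
  interpret M: filtered_algebra_module K A M F by (rule filtered[OF M])
  interpret M': filtered_algebra_module K A M' F by (rule filtered[OF M'])
  note g' = module_homD[OF g]
  have X': "X \<subseteq> UNIV \<times> carrier M" "finite X" using X by (simp_all add: filt_gens_def)
  have c: "x \<in> M.filt X n \<Longrightarrow> x \<in> carrier M" for x using M.filtD(1)[OF X'(1)] by blast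
  have "dim_of K M.V (M.filt X n) =
    dim_of K M.V {x \<in> M.filt X n. g x = \<zero>\<^bsub>M'.V\<^esub>} + dim_of K M'.V (g ` M.filt X n)"
  proof (rule dim_of_image(2)[OF M.V.vectorspace_axioms M'.V.vectorspace_axioms
        M.filt_fin_dim[OF X' filtration(2)]])
    fix x assume x: "x \<in> M.filt X n"
    show "g x \<in> carrier M'.V" using g'(1)[OF c[OF x]] by simp
    show "g (x \<oplus>\<^bsub>M.V\<^esub> y) = g x \<oplus>\<^bsub>M'.V\<^esub> g y" if "y \<in> M.filt X n" for y
      using g'(2)[OF c[OF x] c[OF that]] by simp
    show "g (a \<odot>\<^bsub>M.V\<^esub> x) = a \<odot>\<^bsub>M'.V\<^esub> g x" if "a \<in> carrier K" for a
      using g'(3)[OF _ c[OF x], of "a \<odot>\<^bsub>A\<^esub> \<one>\<^bsub>A\<^esub>"] that by simp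
  qed
  then show ?thesis by simp
qed

text \<open>The kernel on each term is zero, so \<open>hom_dim\<close> leaves only the dimension of
  the image.\<close>

lemma inj_hom_dim:
  assumes M: "left_module A M" and M': "left_module A M'" and g: "g \<in> module_hom A M M'"
    and X: "filt_gens M X" and inj: "inj_on g (carrier M)"
  shows "dim_of K (restrict_scalars A M') (g ` std_filtration K A F M X n) =
    dim_of K (restrict_scalars A M) (std_filtration K A F M X n)"
proof -
  interpret M: filtered_algebra_module K A M F by (rule filtered[OF M])
  interpret M': filtered_algebra_module K A M' F by (rule filtered[OF M'])
  note g' = module_homD[OF g]
  have X': "X \<subseteq> UNIV \<times> carrier M" using X by (simp_all add: filt_gens_def)
  note fD = M.filtD[OF X', where n = n]
  have g0: "g \<zero>\<^bsub>M\<^esub> = \<zero>\<^bsub>M'\<^esub>"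
    using g'(3)[OF M.A.zero_closed M.M.zero_closed] g'(1)[OF M.M.zero_closed] by simp
  have ker0: "x = \<zero>\<^bsub>M\<^esub>" if x: "x \<in> M.filt X n" "g x = \<zero>\<^bsub>M'\<^esub>" for x
  proof (rule inj_onD[OF inj])
    show "g x = g \<zero>\<^bsub>M\<^esub>" using x(2) g0 by simp
    show "x \<in> carrier M" using x(1) fD(1) by blast
  qed simp
  have ker: "{x \<in> M.filt X n. g x = \<zero>\<^bsub>M'\<^esub>} = {\<zero>\<^bsub>M\<^esub>}"
    using ker0 fD(2) g0 by blast
  have sub: "VectorSpace.subspace K {\<zero>\<^bsub>M.V\<^esub>} M.V"
  proof (rule M.V.subspaceI)
    show "x \<oplus>\<^bsub>M.V\<^esub> y \<in> {\<zero>\<^bsub>M.V\<^esub>}" if "x \<in> {\<zero>\<^bsub>M.V\<^esub>}" "y \<in> {\<zero>\<^bsub>M.V\<^esub>}" for x y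
      using that M.V.M.r_zero[OF M.V.M.zero_closed] by (simp only: singleton_iff)
    show "c \<odot>\<^bsub>M.V\<^esub> x \<in> {\<zero>\<^bsub>M.V\<^esub>}" if "c \<in> carrier K" "x \<in> {\<zero>\<^bsub>M.V\<^esub>}" for c x
      using that M.V.smult_r_null by (simp only: singleton_iff)
    show "{\<zero>\<^bsub>M.V\<^esub>} \<subseteq> carrier M.V" using M.V.M.zero_closed by blast
  qed (rule singletonI)
  have "finite X" using X by (simp add: filt_gens_def)
  note fd = M.filt_fin_dim[OF X' this filtration(2), of n]
  have "{\<zero>\<^bsub>M.V\<^esub>} \<subseteq> M.filt X n" using fD(2) by simp
  note fd0 = fin_dim_subspace_mono(1)[OF M.V.vectorspace_axioms fd sub this]
  have "dim_of K M.V {\<zero>\<^bsub>M.V\<^esub>} = 0"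
    by (rule iffD2[OF dim_of_eq_0_iff[OF M.V.vectorspace_axioms fd0] refl])
  then show ?thesis using hom_dim[OF M M' g X, of n] unfolding ker M.V_simps by simp
qed

lemma filt_gens_image:
  assumes M: "left_module A M" and M': "left_module A M'" and g: "g \<in> module_hom A M M'"
    and X: "filt_gens M X" and surj: "g ` carrier M = carrier M'"
  shows "filt_gens M' (map_prod id g ` X)"
proof -
  interpret M: filtered_algebra_module K A M F by (rule filtered[OF M])
  interpret M': filtered_algebra_module K A M' F by (rule filtered[OF M'])
  have X': "finite X" "X \<subseteq> UNIV \<times> carrier M" "generated_submodule A M (snd ` X) = carrier M"
    using X by (simp_all add: filt_gens_def)
  have sub: "map_prod id g ` X \<subseteq> UNIV \<times> carrier M'"
  proof
    fix y assume "y \<in> map_prod id g ` X"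
    then obtain i x where "(i, x) \<in> X" "y = (i, g x)" by auto
    moreover from this have "x \<in> carrier M" using X'(2) by auto
    ultimately show "y \<in> UNIV \<times> carrier M'" using module_homD(1)[OF g] by simp
  qed
  have "(\<Union>n. M'.filt (map_prod id g ` X) n) = g ` (\<Union>n. M.filt X n)"
    by (simp only: filt_image[OF M.filtered_algebra_module_axioms
          M'.filtered_algebra_module_axioms g X'(2)] image_UN)
  also have "\<dots> = carrier M'" using M.filt_Un_iff[OF X'(2)] X'(3) surj by simp
  finally show ?thesis using M'.filt_Un_iff[OF sub] sub X'(1) by (simp add: filt_gens_def)
qed

text \<open>The assumption covers carriers of type \<open>(nat \<Rightarrow> 'a) set\<close> only.
  An isomorphic copy of that type receives the images of the generators; its standard filtration is
  the image of the given one and has the same dimensions.\<close>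

lemma hilbert_poly_exists:
  assumes M: "fg_module A M" and X: "filt_gens M X"
  shows "\<exists>H :: real poly. \<forall>\<^sub>F n in sequentially.
    poly H (real n) = real (dim_of K (restrict_scalars A M) (std_filtration K A F M X n))"
proof -
  obtain N :: "('a, (nat \<Rightarrow> 'a) set) module" and \<phi> where
    N: "fg_module A N" "\<phi> \<in> module_hom A M N" "bij_betw \<phi> (carrier M) (carrier N)"
    using fg_module_copy[OF M] by blast
  have lM: "left_module A M" and lN: "left_module A N" using M N(1) by (auto simp: fg_module_def)
  interpret M: filtered_algebra_module K A M F by (rule filtered[OF lM])
  interpret N: filtered_algebra_module K A N F by (rule filtered[OF lN])
  let ?Y = "map_prod id \<phi> ` X"
  have Y: "filt_gens N ?Y"
    using N(3) by (intro filt_gens_image[OF lM lN N(2) X]) (simp add: bij_betw_def)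
  then have Y': "?Y \<subseteq> UNIV \<times> carrier N" "finite ?Y" "generated_submodule A N (snd ` ?Y) = carrier N"
    by (simp_all add: filt_gens_def)
  have "fin_dim_filtration K N.V (N.filt ?Y)"
    using N.filt_fin_dim[OF Y'(1,2) filtration(2)] by (simp add: fin_dim_filtration_def)
  then obtain H :: "rat poly" where H: "\<forall>\<^sub>F n in sequentially.
      poly H (of_nat n) = of_nat (dim_of K N.V (N.filt ?Y n))"
    using hilbert_samuel[OF N(1) N.filt_good[OF Y']] by blast
  have XM: "X \<subseteq> UNIV \<times> carrier M" using X by (simp add: filt_gens_def)
  have dim: "dim_of K N.V (N.filt ?Y n) = dim_of K M.V (M.filt X n)" for n
    using inj_hom_dim[OF lM lN N(2) X] N(3)
    by (simp add: filt_image[OF M.filtered_algebra_module_axioms N.filtered_algebra_module_axioms N(2) XM]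
        bij_betw_def)
  have "\<forall>\<^sub>F n in sequentially. poly (map_poly of_rat H) (real n) = real (dim_of K M.V (M.filt X n))"
    using H
  proof eventually_elim
    case (elim n)
    have "poly (map_poly of_rat H) (real n) = of_rat (poly H (of_nat n))"
      using poly_map_of_rat[of H "of_nat n"] by simp
    then show ?case using elim dim[of n] by simp
  qed
  then show ?thesis by blast
qed

lemma fg_gens:
  assumes "fg_module A M"
  obtains S where "finite S" "S \<subseteq> carrier M" "filt_gens M ({0} \<times> S)"
proof -
  obtain S where S: "finite S" "S \<subseteq> carrier M" "generated_submodule A M S = carrier M"
    using assms by (auto simp: fg_module_def finitely_generated_over_def)
  then have "filt_gens M ({0} \<times> S)" by (auto simp: filt_gens_def)
  then show thesis using that S by blast
qed

lemma hilbert_poly_ex: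
  assumes "fg_module A M"
  shows "\<exists>H. hilbert_poly M H"
proof -
  obtain S where "filt_gens M ({0} \<times> S)" using fg_gens[OF assms] by blast
  then show ?thesis using hilbert_poly_exists[OF assms] unfolding hilbert_poly_def by blast
qed

lemma hilbert_poly_GK:
  assumes M: "fg_module A M" and H: "hilbert_poly M H"
  shows "GK K A M = growth_degree H" "H = 0 \<or> lead_coeff H > 0" "H = 0 \<longleftrightarrow> carrier M = {\<zero>\<^bsub>M\<^esub>}"
proof -
  have lM: "left_module A M" using M by (simp add: fg_module_def)
  interpret M: filtered_algebra_module K A M F by (rule filtered[OF lM])
  obtain X where X: "finite X" "X \<subseteq> UNIV \<times> carrier M" "generated_submodule A M (snd ` X) = carrier M"
    and ev: "\<forall>\<^sub>F n in sequentially. poly H (real n) = real (dim_of K M.V (M.filt X n))"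
    using H unfolding hilbert_poly_def filt_gens_def by blast
  note GK = M.GK_eq[OF affine gr_affine filtration(2) X ev]
  show 1: "H = 0 \<longleftrightarrow> carrier M = {\<zero>\<^bsub>M\<^esub>}"
  proof
    assume "H = 0"
    then show "carrier M = {\<zero>\<^bsub>M\<^esub>}" using GK(2) by (cases "carrier M = {\<zero>\<^bsub>M\<^esub>}") simp_all
  qed (rule GK(3))
  then show "GK K A M = growth_degree H" "H = 0 \<or> lead_coeff H > 0"
    using GK(1,2) by (simp_all add: growth_degree_def, cases "H = 0", simp_all)
qed

text \<open>Any standard filtration lies in a shift of any other, so the comparison of degrees and
  leading coefficients applies in both directions. Lower coefficients may differ.\<close>

lemma hilbert_poly_unique:
  assumes M: "fg_module A M" and H: "hilbert_poly M H" and H': "hilbert_poly M H'"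
  shows "normalized_lead H = normalized_lead H'"
proof (cases "carrier M = {\<zero>\<^bsub>M\<^esub>}")
  \<comment> \<open>The comparison needs a positive leading coefficient, so the zero module is
    treated separately.\<close>
  case True
  then show ?thesis using hilbert_poly_GK(3)[OF M H] hilbert_poly_GK(3)[OF M H'] by simp
next
  case False
  have lM: "left_module A M" using M by (simp add: fg_module_def)
  interpret M: filtered_algebra_module K A M F by (rule filtered[OF lM])
  have *: "degree P < degree Q \<or> degree P = degree Q \<and> lead_coeff P \<le> lead_coeff Q"
    if P: "hilbert_poly M P" and Q: "hilbert_poly M Q" for P Q
  proof -
    obtain X where X: "finite X" "X \<subseteq> UNIV \<times> carrier M" "generated_submodule A M (snd ` X) = carrier M"
      and evX: "\<forall>\<^sub>F n in sequentially. poly P (real n) = real (dim_of K M.V (M.filt X n))"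
      using P unfolding hilbert_poly_def filt_gens_def by blast
    obtain Y where Y: "finite Y" "Y \<subseteq> UNIV \<times> carrier M" "generated_submodule A M (snd ` Y) = carrier M"
      and evY: "\<forall>\<^sub>F n in sequentially. poly Q (real n) = real (dim_of K M.V (M.filt Y n))"
      using Q unfolding hilbert_poly_def filt_gens_def by blast
    obtain q where q: "\<And>n. M.filt X n \<subseteq> M.filt Y (n + q)"
      using M.filt_shift[OF X(1,2) Y(2,3)] by blast
    have le: "dim_of K M.V (M.filt X n) \<le> dim_of K M.V (M.filt Y (n + q))" for n
      by (rule fin_dim_subspace_mono(2)[OF M.V.vectorspace_axioms
            M.filt_fin_dim[OF Y(2,1) filtration(2)] M.filt_subspace[OF X(2)] q])
    have evY': "\<forall>\<^sub>F n in sequentially. poly Q (real (n + q)) = real (dim_of K M.V (M.filt Y (n + q)))"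
      using evY eventually_sequentially_seg[of "\<lambda>n. poly Q (real n) = real (dim_of K M.V (M.filt Y n))" q]
      by simp
    have "\<forall>\<^sub>F n in sequentially. poly P (real n) \<le> poly Q (real (n + q))"
      using evX evY'
    proof eventually_elim
      case (elim n)
      show ?case unfolding elim using le[of n] by (rule of_nat_mono)
    qed
    moreover have "lead_coeff P > 0" using hilbert_poly_GK(2,3)[OF M P] False by auto
    ultimately show ?thesis by (rule lead_coeff_mono_if_eventually_le)
  qed
  have "degree H = degree H' \<and> lead_coeff H = lead_coeff H'"
    using *[OF H H'] *[OF H' H] by linarith
  then show ?thesis by (metis normalized_lead_def)
qed

text \<open>Dimensions are integers, so the factorial of the degree clears the denominator of the
  leading coefficient; the sign comes from the positivity of that coefficient.\<close>

lemma normalized_lead_nat: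
  assumes M: "fg_module A M" and H: "hilbert_poly M H"
  shows "real (nat \<lfloor>normalized_lead H\<rfloor>) = normalized_lead H"
proof -
  have "\<forall>\<^sub>F n in sequentially. poly H (real n) \<in> \<int>"
  proof -
    obtain X where "\<forall>\<^sub>F n in sequentially.
        poly H (real n) = real (dim_of K (restrict_scalars A M) (std_filtration K A F M X n))"
      using H unfolding hilbert_poly_def by blast
    then show ?thesis by eventually_elim simp
  qed
  then have "normalized_lead H \<in> \<int>"
    unfolding normalized_lead_def by (intro fact_coeff_int_if_eventually_int) simp
  moreover have "normalized_lead H \<ge> 0"
    using hilbert_poly_GK(2)[OF M H] by (auto simp: normalized_lead_def)
  ultimately show ?thesis by (metis Ints_cases floor_of_int of_int_0_le_iff of_nat_nat)
qed

text \<open>All three polynomials come from one filtration: that of \<open>M\<close> is restricted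
  to the kernel and pushed to the quotient, so dimensions add term by term. That the restriction is
  again a standard filtration, and thus has a Hilbert polynomial, is where the Noetherian hypothesis
  enters.\<close>

lemma hilbert_poly_short_exact:
  assumes M': "fg_module A M'" and M: "fg_module A M" and M'': "fg_module A M''"
    and ex: "short_exact A M' M M''"
  obtains H' H'' where "hilbert_poly M' H'" "hilbert_poly M'' H''" "hilbert_poly M (H' + H'')"
proof -
  have lM': "left_module A M'" and lM: "left_module A M" and lM'': "left_module A M''"
    using M' M M'' by (simp_all add: fg_module_def)
  interpret M': filtered_algebra_module K A M' F by (rule filtered[OF lM'])
  interpret M: filtered_algebra_module K A M F by (rule filtered[OF lM])
  interpret M'': filtered_algebra_module K A M'' F by (rule filtered[OF lM''])
  obtain f g where f: "f \<in> module_hom A M' M" "inj_on f (carrier M')"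
    and g: "g \<in> module_hom A M M''" "g ` carrier M = carrier M''"
    and fg: "f ` carrier M' = {x \<in> carrier M. g x = \<zero>\<^bsub>M''\<^esub>}"
    using ex unfolding short_exact_def by blast
  note f' = module_homD[OF f(1)] and g' = module_homD[OF g(1)]
  define N where "N = f ` carrier M'"
  have sub: "Module.submodule N A M"
  proof (rule M.submoduleI)
    show "N \<subseteq> carrier M" unfolding N_def using f'(1) by (rule image_subsetI)
    have "f \<zero>\<^bsub>M'\<^esub> = \<zero>\<^bsub>M\<^esub>"
      using f'(3)[OF M'.A.zero_closed M'.M.zero_closed] f'(1)[OF M'.M.zero_closed] by simp
    then show "\<zero>\<^bsub>M\<^esub> \<in> N" unfolding N_def by force
    show "x \<oplus>\<^bsub>M\<^esub> y \<in> N" if xy: "x \<in> N" "y \<in> N" for x y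
    proof -
      from xy obtain u v where "u \<in> carrier M'" "v \<in> carrier M'" "x = f u" "y = f v"
        unfolding N_def by blast
      then have "x \<oplus>\<^bsub>M\<^esub> y = f (u \<oplus>\<^bsub>M'\<^esub> v)" "u \<oplus>\<^bsub>M'\<^esub> v \<in> carrier M'" using f'(2) by simp_all
      then show ?thesis unfolding N_def by blast
    qed
    show "a \<odot>\<^bsub>M\<^esub> x \<in> N" if a: "a \<in> carrier A" and x: "x \<in> N" for a x
    proof -
      from x obtain u where "u \<in> carrier M'" "x = f u" unfolding N_def by blast
      then have "a \<odot>\<^bsub>M\<^esub> x = f (a \<odot>\<^bsub>M'\<^esub> u)" "a \<odot>\<^bsub>M'\<^esub> u \<in> carrier M'"
        using a f'(3) by (simp_all add: M'.L.smult_closed)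
      then show ?thesis unfolding N_def by blast
    qed
  qed
  obtain S where S: "finite S" "S \<subseteq> carrier M" "filt_gens M ({0} \<times> S)" using fg_gens[OF M] by blast
  let ?X = "{0} \<times> S"
  have X: "?X \<subseteq> UNIV \<times> carrier M" using S(2) by auto
  have "assoc_algebra K (gr_algebra A F)" using gr_affine by (simp add: affine_algebra_def)
  then obtain Y where Y: "finite Y" "Y \<subseteq> UNIV \<times> N" "\<And>n. N \<inter> M.filt ?X n = M.filt Y n"
    using M.submodule_filtration[OF _ gr_noetherian S(1,2) sub] by blast
  \<comment> \<open>The generators of the filtration induced on \<open>N\<close> are pulled back to
    \<open>M'\<close> along the injective map \<open>f\<close>.\<close>
  define Z where "Z = map_prod id (inv_into (carrier M') f) ` Y"
  have YN: "x \<in> f ` carrier M'" if "(i, x) \<in> Y" for i x using that Y(2) unfolding N_def by blast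
  have Z: "finite Z" "Z \<subseteq> UNIV \<times> carrier M'"
  proof -
    show "finite Z" using Y(1) by (simp add: Z_def)
    show "Z \<subseteq> UNIV \<times> carrier M'"
      unfolding Z_def by (rule image_subsetI) (use inv_into_into[OF YN] in \<open>simp add: split_paired_all\<close>)
  qed
  have "map_prod id f ` Z = Y"
  proof -
    have "map_prod id f (map_prod id (inv_into (carrier M') f) y) = y" if "y \<in> Y" for y
      using that f_inv_into_f[OF YN] by (cases y) simp
    then show ?thesis unfolding Z_def image_image by simp
  qed
  then have fZ: "f ` M'.filt Z n = N \<inter> M.filt ?X n" for n
    using filt_image[OF M'.filtered_algebra_module_axioms M.filtered_algebra_module_axioms f(1) Z(2)]
      Y(3) by simp
  have XU: "(\<Union>n. M.filt ?X n) = carrier M"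
    using M.filt_Un_iff[OF X] S(3) by (simp add: filt_gens_def)
  \<comment> \<open>\<open>Z\<close> generates \<open>M'\<close>: the terms
    \<open>N \<inter> M.filt ?X n\<close> exhaust \<open>N\<close>, and \<open>f\<close> is
    injective.\<close>
  have "f ` (\<Union>n. M'.filt Z n) = f ` carrier M'"
  proof -
    have "f ` (\<Union>n. M'.filt Z n) = N \<inter> (\<Union>n. M.filt ?X n)" by (simp only: image_UN fZ Int_UN_distrib)
    moreover have "N \<inter> carrier M = N" using M.submoduleD(1)[OF sub] by blast
    ultimately show ?thesis unfolding XU N_def by simp
  qed
  moreover have "(\<Union>n. M'.filt Z n) \<subseteq> carrier M'" using M'.filtD(1)[OF Z(2)] by blast
  ultimately have "(\<Union>n. M'.filt Z n) = carrier M'"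
    using inj_on_image_eq_iff[OF f(2)] by simp
  then have gensZ: "filt_gens M' Z" using M'.filt_Un_iff[OF Z(2)] Z by (simp add: filt_gens_def)
  let ?X'' = "map_prod id g ` ?X"
  have gens'': "filt_gens M'' ?X''" by (rule filt_gens_image[OF lM lM'' g(1) S(3) g(2)])
  obtain H' where H': "\<forall>\<^sub>F n in sequentially. poly H' (real n) = real (dim_of K M'.V (M'.filt Z n))"
    using hilbert_poly_exists[OF M' gensZ] by blast
  obtain H'' where H'': "\<forall>\<^sub>F n in sequentially. poly H'' (real n) = real (dim_of K M''.V (M''.filt ?X'' n))"
    using hilbert_poly_exists[OF M'' gens''] by blast
  have dim: "dim_of K M.V (M.filt ?X n) = dim_of K M'.V (M'.filt Z n) + dim_of K M''.V (M''.filt ?X'' n)" for n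
  proof -
    \<comment> \<open>By exactness the kernel of \<open>g\<close> inside a term is the intersection
      with \<open>N\<close>, hence the image of the corresponding term of \<open>M'\<close>.\<close>
    have "{x \<in> M.filt ?X n. g x = \<zero>\<^bsub>M''\<^esub>} = f ` M'.filt Z n"
      unfolding fZ N_def fg using M.filtD(1)[OF X, where n = n] by blast
    then show ?thesis
      using hom_dim[OF lM lM'' g(1) S(3), of n] inj_hom_dim[OF lM' lM f(1) gensZ f(2), of n]
        filt_image[OF M.filtered_algebra_module_axioms M''.filtered_algebra_module_axioms g(1) X, of n]
      by simp
  qed
  have "\<forall>\<^sub>F n in sequentially. poly (H' + H'') (real n) = real (dim_of K M.V (M.filt ?X n))"
    using H' H'' by eventually_elim (simp add: dim)
  then have "hilbert_poly M (H' + H'')" using S(3) unfolding hilbert_poly_def by blast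
  moreover have "hilbert_poly M' H'" using H' gensZ unfolding hilbert_poly_def by blast
  moreover have "hilbert_poly M'' H''" using H'' gens'' unfolding hilbert_poly_def by blast
  ultimately show thesis by (intro that)
qed

text \<open>The choice of \<open>H\<close> is immaterial by \<open>hilbert_poly_unique\<close>, and
  the rounding changes nothing by \<open>normalized_lead_nat\<close>.\<close>

definition multiplicity :: "('a, 'm) module \<Rightarrow> nat" where
  "multiplicity M = nat \<lfloor>normalized_lead (SOME H. hilbert_poly M H)\<rfloor>"

lemma multiplicity_eq:
  assumes "fg_module A M" "hilbert_poly M H"
  shows "real (multiplicity M) = normalized_lead H"
proof -
  have "hilbert_poly M (SOME H. hilbert_poly M H)" using assms(2) by (rule someI)
  then show ?thesis
    unfolding multiplicity_def
    using normalized_lead_nat[OF assms(1)] hilbert_poly_unique[OF assms(1) _ assms(2)] by simp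
qed

lemma very_nice: "very_nice TYPE('m) K A"
proof -
  \<comment> \<open>The cases compare the dimensions of the two outer modules, as for sums of
    polynomials. \<open>is_multiplicity\<close> compares each of them with the middle one; the
    maximum formula translates between the two.\<close>
  have ses: "GK K A M = max (GK K A M') (GK K A M'') \<and>
    (GK K A M' < GK K A M'' \<longrightarrow> multiplicity M = multiplicity M'') \<and>
    (GK K A M'' < GK K A M' \<longrightarrow> multiplicity M = multiplicity M') \<and>
    (GK K A M' = GK K A M'' \<longrightarrow> multiplicity M = multiplicity M' + multiplicity M'')"
    if A: "fg_module A M'" "fg_module A M" "fg_module A M''" "short_exact A M' M M''"
    for M' M M'' :: "('a, 'm) module"
  proof -
    obtain H' H'' where H: "hilbert_poly M' H'" "hilbert_poly M'' H''" "hilbert_poly M (H' + H'')"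
      by (rule hilbert_poly_short_exact[OF A]) (rule that)
    note GK = hilbert_poly_GK(1)[OF A(1) H(1)] hilbert_poly_GK(1)[OF A(3) H(2)]
      hilbert_poly_GK(1)[OF A(2) H(3)]
    note e = multiplicity_eq[OF A(1) H(1)] multiplicity_eq[OF A(3) H(2)]
      multiplicity_eq[OF A(2) H(3)]
    note add = growth_add[OF hilbert_poly_GK(2)[OF A(1) H(1)] hilbert_poly_GK(2)[OF A(3) H(2)]]
    \<comment> \<open>Multiplicities are compared as real numbers, where they are normalized leading
      coefficients.\<close>
    have "real (multiplicity M) = real (multiplicity M'')" if "GK K A M' < GK K A M''"
      unfolding e using add(2) that unfolding GK .
    moreover have "real (multiplicity M) = real (multiplicity M')" if "GK K A M'' < GK K A M'"
      unfolding e using add(3) that unfolding GK .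
    moreover have "real (multiplicity M) = real (multiplicity M' + multiplicity M'')"
      if "GK K A M' = GK K A M''"
      unfolding of_nat_add e using add(4) that unfolding GK .
    moreover have "GK K A M = max (GK K A M') (GK K A M'')" unfolding GK by (rule add(1))
    ultimately show ?thesis unfolding of_nat_eq_iff by blast
  qed
  have "GK_exact TYPE('m) K A" unfolding GK_exact_def using ses by blast
  moreover have "\<exists>d :: nat. GK K A M = ereal (real d)"
    if M: "fg_module A M" "carrier M \<noteq> {\<zero>\<^bsub>M\<^esub>}" for M :: "('a, 'm) module"
  proof -
    obtain H where H: "hilbert_poly M H" using hilbert_poly_ex[OF M(1)] ..
    then have "GK K A M = ereal (real (degree H))"
      using hilbert_poly_GK(1,3)[OF M(1) H] M(2) by (simp add: growth_degree_def)
    then show ?thesis ..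
  qed
  moreover have "is_multiplicity K A (multiplicity :: ('a, 'm) module \<Rightarrow> nat)"
    unfolding is_multiplicity_def
  proof (intro conjI allI impI)
    fix M :: "('a, 'm) module" assume M: "fg_module A M"
    obtain H where H: "hilbert_poly M H" using hilbert_poly_ex[OF M] ..
    have "multiplicity M = 0 \<longleftrightarrow> normalized_lead H = 0"
      using multiplicity_eq[OF M H] by (metis of_nat_eq_0_iff)
    also have "\<dots> \<longleftrightarrow> H = 0" by (simp add: normalized_lead_def)
    also have "\<dots> \<longleftrightarrow> carrier M = {\<zero>\<^bsub>M\<^esub>}" by (rule hilbert_poly_GK(3)[OF M H])
    finally show "multiplicity M = 0 \<longleftrightarrow> carrier M = {\<zero>\<^bsub>M\<^esub>}" .
  next
    fix M' M M'' :: "('a, 'm) module"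
    assume A: "fg_module A M'" "fg_module A M" "fg_module A M''" "short_exact A M' M M''"
    note * = ses[OF A]
    show "multiplicity M = multiplicity M''" if "GK K A M' < GK K A M \<and> GK K A M = GK K A M''"
      using * that by metis
    show "multiplicity M = multiplicity M'" if "GK K A M' = GK K A M \<and> GK K A M'' < GK K A M"
      using * that by metis
    show "multiplicity M = multiplicity M' + multiplicity M''"
      if "GK K A M' = GK K A M \<and> GK K A M = GK K A M''"
      using * that by metis
  qed
  ultimately show ?thesis unfolding very_nice_def by blast
qed

end

text \<open>The hypothesis is taken at the one carrier type that holds copies of all finitely
  generated modules, the conclusion at an arbitrary type \<open>'m\<close>.\<close>

theorem theorem3p11:
  fixes K :: "'k ring" and A :: "('k, 'a) module"
  assumes "field K"
    and "affine_algebra K A"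
    and "admits_Hilbert_Samuel TYPE((nat \<Rightarrow> 'a) set) K A"
  shows "very_nice TYPE('m) K A"
proof -
  obtain F where F: "algebra_filtration K A F" "fin_dim_filtration K A F"
      "affine_algebra K (gr_algebra A F)" "left_noetherian (gr_algebra A F)"
    and HS: "\<And>(M :: ('a, (nat \<Rightarrow> 'a) set) module) \<Omega>.
      fg_module A M \<Longrightarrow> good_filtration K A F M \<Omega> \<Longrightarrow>
      fin_dim_filtration K (restrict_scalars A M) \<Omega> \<Longrightarrow>
      \<exists>H :: rat poly. \<forall>\<^sub>F n in sequentially.
        poly H (of_nat n) = of_nat (dim_of K (restrict_scalars A M) (\<Omega> n))"
    using assms(3) unfolding admits_Hilbert_Samuel_def by blast
  have "hilbert_samuel_algebra K A F"
    by (rule hilbert_samuel_algebra.intro[OF assms(2) F HS])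
  then show ?thesis by (rule hilbert_samuel_algebra.very_nice)
qed

end
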